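(* Let $X$ be a conservative CBI-process with functional characteristics $(F,R)$, where $F$ has parameters $(b,m)$ and $R$ has parameters $(\alpha,\beta,\mu)$, and suppose that $X$ converges to a limit distribution $L$. Let $\lambda_0\in(0,\infty]$ be the effective drift of $\widehat X^R=-X^R$ (with $b/\infty=0$), let $W$ be the scale function of $\widehat X^R$, and let $k(x)=b\,W'_+(x)+\int_{(0,\infty)}[W(x)-W(x-\xi)]\,m(\mathrm{d}\xi)$ for $x>0$. Then: - if $\int_0^1\frac{k(x)}{x}\,\mathrm{d}x=\infty$, then $L$ is absolutely continuous on $[0,\infty)$; - if $\int_0^1\frac{k(x)}{x}\,\mathrm{d}x<\infty$, then $L$ is absolutely continuous on $[0,\infty)\setminus\{b/\lambda_0\}$ with an atom at $b/\lambda_0$. (Absolute continuity is with respect to Lebesgue measure.)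
   Context: A conservative CBI-process (continuous-state branching process with immigration) is a stochastically continuous Markov process $X=(X_t)_{t\ge0}$ with state space $[0,\infty)$ such that $-\log\mathbb{E}^x[e^{-uX_t}]=\phi(t,u)+x\psi(t,u)$ for all $t,u,x\ge 0$ and some functions $\phi,\psi$. By Kawazu–Watanabe, the derivatives $F(u)=\partial_t\phi(t,u)|_{t=0}$, $R(u)=\partial_t\psi(t,u)|_{t=0}$ exist and have the form $$F(u)=bu-\int_{(0,\infty)}(e^{-u\xi}-1)\,m(\mathrm{d}\xi),\qquad R(u)=-\alpha u^2+\beta u-\int_{(0,\infty)}\left(e^{-u\xi}-1+u\xi\mathbf 1_{(0,1]}(\xi)\right)\mu(\mathrm{d}\xi),$$ with $\alpha,b\ge0$, $\beta\in\mathbb{R}$, $m,\mu$ Lévy measures on $(0,\infty)$, $\int(\xi\wedge1)\,m(\mathrm{d}\xi)<\infty$, $\int(\xi^2\wedge 1)\,\mu(\mathrm{d}\xi)<\infty$, and $\int_{0+}\frac{\mathrm{d}s}{\max(R(s),0)}=\infty$ (the integral over an arbitrarily small right neighbourhood of $0$). Moreover $\partial_t\phi=F(\psi)$, $\phi(0,u)=0$, $\partial_t\psi=R(\psi)$, $\psi(0,u)=u$. Conversely, any such pair $(F,R)$ determines a unique conservative CBI-process. $(F,R)$ are its functional characteristics. $X^R$ denotes the Lévy process without negative jumps with $\mathbb{E}[e^{-uX^R_t}]=e^{-tR(u)}$. A probability measure $L$ on $[0,\infty)$ is the limit distribution of $X$ if $X_t\to L$ in distribution as $t\to\infty$ under $\mathbb{P}^x$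 for every $x\ge0$. If $L$ exists then $R'_+(0)\le0$, $R\not\equiv0$, $R(u)<0$ for all $u>0$, and $-\log\int e^{-ux}L(\mathrm{d}x)=-\int_0^uF(s)/R(s)\,\mathrm{d}s$ for $u\ge0$. The scale function of $\widehat X^R$ is the unique function $W:\mathbb{R}\to[0,\infty)$ that vanishes on $(-\infty,0)$, is continuous and increasing (non-decreasing) on $[0,\infty)$, and satisfies $\int_0^\infty e^{-ux}W(x)\,\mathrm{d}x=-1/R(u)$ for $u>0$. On $(0,\infty)$ it is strictly positive, absolutely continuous and log-concave; $W'_+$ denotes its right derivative. The Lévy–Khintchine decomposition of $L$ is $-\log\int_{[0,\infty)}e^{-ux}L(\mathrm{d}x)=ubW(0)-\int_{(0,\infty)}(e^{-xu}-1)\frac{k(x)}{x}\mathrm{d}x$. Effective drift: $\lambda_0=\int_{(0,1]}\xi\,\mu(\mathrm{d}\xi)-\beta$ if $X^R$ has paths of bounded variation (i.e. $\alpha=0$ and $\int_{(0,1]}\xi\mu(\mathrm{d}\xi)<\infty$), and $\lambda_0=+\infty$ otherwise; $\lambda_0>0$ whenever $L$ exists. *)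

theory Defs
  imports "HOL-Probability.Probability"
begin

section \<open>Conservative CBI-processes\<close>

definition past :: "'w measure \<Rightarrow> (real \<Rightarrow> 'w \<Rightarrow> real) \<Rightarrow> real \<Rightarrow> 'w measure" where
  "past M X s = sigma (space M) {X r -` A \<inter> space M | r A. 0 \<le> r \<and> r \<le> s \<and> A \<in> sets borel}"

text \<open>
  A stochastically continuous Markov process with state space \<open>[0,\<infinity>)\<close>: \<open>M\<close> only supplies the
  underlying measurable space, and \<open>P x\<close>, \<open>x \<ge> 0\<close>, is the law under which the process starts in \<open>x\<close>.
  Time and state are real numbers; only times \<open>t \<ge> 0\<close> and starting points \<open>x \<ge> 0\<close> matter.
\<close>

locale nonneg_markov_process =
  fixes M :: "'w measure" and P :: "real \<Rightarrow> 'w measure" and X :: "real \<Rightarrow> 'w \<Rightarrow> real"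
  assumes prob_space_P: "\<And>x. 0 \<le> x \<Longrightarrow> prob_space (P x)"
    and sets_P: "\<And>x. 0 \<le> x \<Longrightarrow> sets (P x) = sets M"
    and measurable_X: "\<And>t. 0 \<le> t \<Longrightarrow> X t \<in> borel_measurable M"
    and nonneg_X: "\<And>t \<omega>. 0 \<le> t \<Longrightarrow> \<omega> \<in> space M \<Longrightarrow> 0 \<le> X t \<omega>"
    and start: "\<And>x. 0 \<le> x \<Longrightarrow> AE \<omega> in P x. X 0 \<omega> = x"
    and measurable_kernel: "\<And>t A. 0 \<le> t \<Longrightarrow> A \<in> sets borel \<Longrightarrow>
      (\<lambda>x. measure (P x) (X t -` A \<inter> space M)) \<in> borel_measurable (restrict_space borel {0..})"
    and markov: "\<And>x s t A. 0 \<le> x \<Longrightarrow> 0 \<le> s \<Longrightarrow> 0 \<le> t \<Longrightarrow> A \<in> sets borel \<Longrightarrow>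
      AE \<omega> in P x. real_cond_exp (P x) (past M X s) (\<lambda>\<omega>'. indicator A (X (s + t) \<omega>')) \<omega>
        = measure (P (X s \<omega>)) (X t -` A \<inter> space M)"
    and stochastically_continuous: "\<And>x t \<epsilon>. 0 \<le> x \<Longrightarrow> 0 \<le> t \<Longrightarrow> 0 < \<epsilon> \<Longrightarrow>
      ((\<lambda>s. measure (P x) {\<omega> \<in> space M. \<bar>X s \<omega> - X t \<omega>\<bar> > \<epsilon>}) \<longlongrightarrow> 0) (at t within {0..})"

definition affine_exponents ::
  "(real \<Rightarrow> 'w measure) \<Rightarrow> (real \<Rightarrow> 'w \<Rightarrow> real) \<Rightarrow> (real \<Rightarrow> real \<Rightarrow> real) \<Rightarrow> (real \<Rightarrow> real \<Rightarrow> real) \<Rightarrow> bool"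
where
  "affine_exponents P X \<phi> \<psi> \<longleftrightarrow>
     (\<forall>t\<ge>0. \<forall>u\<ge>0. \<forall>x\<ge>0. - ln (\<integral>\<omega>. exp (- u * X t \<omega>) \<partial>P x) = \<phi> t u + x * \<psi> t u)"

locale conservative_CBI = nonneg_markov_process +
  assumes affine: "\<exists>\<phi> \<psi>. affine_exponents P X \<phi> \<psi>"

definition functional_characteristics ::
  "(real \<Rightarrow> 'w measure) \<Rightarrow> (real \<Rightarrow> 'w \<Rightarrow> real) \<Rightarrow> (real \<Rightarrow> real) \<Rightarrow> (real \<Rightarrow> real) \<Rightarrow> bool"
where
  "functional_characteristics P X F R \<longleftrightarrow>
     (\<exists>\<phi> \<psi>. affine_exponents P X \<phi> \<psi> \<and>
        (\<forall>u\<ge>0. ((\<lambda>t. \<phi> t u) has_real_derivative F u) (at 0 within {0..}) \<and>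
               ((\<lambda>t. \<psi> t u) has_real_derivative R u) (at 0 within {0..})))"

text \<open>Measures on \<open>(0,\<infinity>)\<close> are Borel measures on the real line that do not charge \<open>(-\<infinity>,0]\<close>.\<close>

definition levy_measure :: "real measure \<Rightarrow> bool" where
  "levy_measure \<nu> \<longleftrightarrow> sets \<nu> = sets borel \<and> emeasure \<nu> {..0} = 0 \<and>
     (\<integral>\<^sup>+\<xi>\<in>{0<..}. ennreal (min (\<xi>\<^sup>2) 1) \<partial>\<nu>) < \<infinity>"

definition F_fun :: "real \<Rightarrow> real measure \<Rightarrow> real \<Rightarrow> real" where
  "F_fun b m u = b * u - (LINT \<xi>:{0<..}|m. exp (- u * \<xi>) - 1)"

definition R_fun :: "real \<Rightarrow> real \<Rightarrow> real measure \<Rightarrow> real \<Rightarrow> real" where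
  "R_fun \<alpha> \<beta> \<mu> u = - \<alpha> * u\<^sup>2 + \<beta> * u
     - (LINT \<xi>:{0<..}|\<mu>. exp (- u * \<xi>) - 1 + u * \<xi> * indicator {0<..1} \<xi>)"

text \<open>
  The last conjunct is \<open>\<integral>\<^bsub>0+\<^esub> ds / max (R s) 0 = \<infinity>\<close>; the inverse is taken in \<^typ>\<open>ennreal\<close>,
  where it is \<open>\<infinity>\<close> at \<open>0\<close>.
\<close>

definition admissible_parameters ::
  "real \<Rightarrow> real measure \<Rightarrow> real \<Rightarrow> real \<Rightarrow> real measure \<Rightarrow> bool"
where
  "admissible_parameters b m \<alpha> \<beta> \<mu> \<longleftrightarrow>
     0 \<le> b \<and> 0 \<le> \<alpha> \<and> levy_measure m \<and> levy_measure \<mu> \<and>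
     (\<integral>\<^sup>+\<xi>\<in>{0<..}. ennreal (min \<xi> 1) \<partial>m) < \<infinity> \<and>
     (\<forall>\<epsilon>>0. (\<integral>\<^sup>+s\<in>{0<..<\<epsilon>}. inverse (ennreal (max (R_fun \<alpha> \<beta> \<mu> s) 0)) \<partial>lborel) = \<infinity>)"

section \<open>Limit distribution, effective drift and scale function\<close>

text \<open>
  Weak convergence as \<open>t \<rightarrow> \<infinity>\<close> is weak convergence along every sequence of times tending to infinity.
\<close>

definition limit_distribution ::
  "(real \<Rightarrow> 'w measure) \<Rightarrow> (real \<Rightarrow> 'w \<Rightarrow> real) \<Rightarrow> real measure \<Rightarrow> bool"
where
  "limit_distribution P X L \<longleftrightarrow> real_distribution L \<and> emeasure L {..<0} = 0 \<and>
     (\<forall>x\<ge>0. \<forall>\<tau> :: nat \<Rightarrow> real. (\<forall>n. 0 \<le> \<tau> n) \<longrightarrow> filterlim \<tau> at_top sequentially \<longrightarrow>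
        weak_conv_m (\<lambda>n. distr (P x) borel (X (\<tau> n))) L)"

definition effective_drift :: "real \<Rightarrow> real \<Rightarrow> real measure \<Rightarrow> ereal" where
  "effective_drift \<alpha> \<beta> \<mu> =
     (if \<alpha> = 0 \<and> (\<integral>\<^sup>+\<xi>\<in>{0<..1}. ennreal \<xi> \<partial>\<mu>) < \<infinity>
      then ereal ((LINT \<xi>:{0<..1}|\<mu>. \<xi>) - \<beta>) else \<infinity>)"

definition scale_function :: "(real \<Rightarrow> real) \<Rightarrow> (real \<Rightarrow> real) \<Rightarrow> bool" where
  "scale_function R W \<longleftrightarrow>
     (\<forall>x. 0 \<le> W x) \<and> (\<forall>x<0. W x = 0) \<and> continuous_on {0..} W \<and> mono_on {0..} W \<and>
     (\<forall>u>0. set_integrable lborel {0..} (\<lambda>x. exp (- u * x) * W x) \<and>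
            (LINT x:{0..}|lborel. exp (- u * x) * W x) = - 1 / R u)"

definition k_fun ::
  "real \<Rightarrow> real measure \<Rightarrow> (real \<Rightarrow> real) \<Rightarrow> (real \<Rightarrow> real) \<Rightarrow> real \<Rightarrow> real"
where
  "k_fun b m W W' x = b * W' x + (LINT \<xi>:{0<..}|m. W x - W (x - \<xi>))"

definition absolutely_continuous_on :: "real set \<Rightarrow> real measure \<Rightarrow> bool" where
  "absolutely_continuous_on A L \<longleftrightarrow>
     absolutely_continuous (restrict_space lborel A) (restrict_space L A)"

end

theory Submission
  imports Defs "HOL-Real_Asymp.Real_Asymp"
begin

text \<open>
  Let \<open>l\<close> be the Laplace transform of \<open>L\<close>. The semigroup property of the affine exponents and
  \<open>X t \<rightarrow> L\<close> give \<open>- ln (l u) = \<phi> s u - ln (l (\<psi> s u))\<close>; differentiating at \<open>s = 0\<close> yields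
  \<open>- l'/l = - F/R\<close>, so no differential equation has to be solved. Since \<open>- 1/R\<close> is the Laplace
  transform of \<open>W\<close>, the function \<open>- F/R\<close> is the Laplace transform of the measure
  \<open>b W(0) \<delta>\<^sub>0 + k(x) dx\<close>, and \<open>b W(0) = b/\<lambda>\<^sub>0 = c\<close>. By uniqueness of Laplace transforms,
  \<open>(x - c) L(dx) = (k(x) dx * L)(dx)\<close>, which is absolutely continuous; hence so is \<open>L\<close> off \<open>c\<close>.
  Finally \<open>L{c}\<close> is the limit of \<open>exp (c u) * l u\<close> as \<open>u \<rightarrow> \<infinity>\<close>, and \<open>- ln (exp (c u) * l u)\<close> increases,
  up to a constant, to the integral of \<open>exp (- x) * k(x) / x\<close>, which is finite iff the integral of
  \<open>k(x) / x\<close> over \<open>(0,1)\<close> is.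
\<close>

section \<open>Uniqueness of Laplace transforms\<close>

text \<open>The delicate point is that \<open>W'\<close> is only a right derivative, given on (0,
  infinity). To see that the Stieltjes measure dW has density \<open>W'\<close> there, one needs a
  fundamental theorem for continuous monotone functions that have a finite right derivative at every
  point; the section on right derivatives provides it. The transform of dW is u times that of
  \<open>W\<close>, and the transform of W(x) - W(x - \<xi>) is that of \<open>W\<close> times 1 -
  exp (- u \<xi>), which is how \<open>F\<close> enters. Dividing by \<open>R\<close> is justified
  by two observations. If \<open>R\<close> vanished identically, \<open>\<psi> t 1\<close> would be
  constant in t, although it tends to 0. If \<open>R\<close> vanished at a single u > 0, then
  \<open>- 1 / R u\<close> would be 0, so \<open>W\<close> would be zero almost everywhere and
  \<open>R\<close> would vanish on all of (0, infinity). The measure (x - c) L(dx) is nonnegative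
  because \<open>L\<close> lives on [c, infinity), which follows from an exponential Markov bound.
  Nonnegative integrals are kept in \<open>ennreal\<close>, so that Tonelli applies even where inner
  integrals diverge.\<close>

lemma finite_borel_measure_moments_unique:
  fixes M N :: "real measure"
  assumes M: "finite_borel_measure M" and N: "finite_borel_measure N"
    and M01: "AE x in M. x \<in> {0..1}" and N01: "AE x in N. x \<in> {0..1}"
    and moments: "\<And>n. (\<integral>x. x ^ n \<partial>M) = (\<integral>x. x ^ n \<partial>N)"
  shows "M = N"
proof -
  interpret M: finite_borel_measure M by (rule M)
  interpret N: finite_borel_measure N by (rule N)
  have intg: "integrable K f"
    if K: "finite_borel_measure K" "AE x in K. x \<in> {0..1}" and f: "f \<in> borel_measurable borel"
      and B: "\<And>x. x \<in> {0..1} \<Longrightarrow> \<bar>f x\<bar> \<le> B" for K and f :: "real \<Rightarrow> real" and B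
  proof -
    interpret K: finite_borel_measure K by (rule K)
    have "f \<in> borel_measurable K" using f K.M_is_borel by (simp cong: measurable_cong_sets)
    then show ?thesis
      using K(2) B by (intro K.integrable_const_bound[where B=B]) auto
  qed
  have pow: "integrable K (\<lambda>x. a * x ^ n)"
    if K: "finite_borel_measure K" "AE x in K. x \<in> {0..1}" for K :: "real measure" and a n
    by (rule intg[OF K, where B="\<bar>a\<bar>"])
      (auto simp: abs_mult mult_le_cancel_left1 intro!: mult_left_le power_le_one)
  \<comment> \<open>Weierstrass approximation: polynomials are uniformly close to f on [0,1], and
    both measures are finite and live there, so equal moments give equal integrals of f.\<close>
  have cont: "(\<integral>x. f x \<partial>M) = (\<integral>x. f x \<partial>N)" if f: "continuous_on UNIV f" for f :: "real \<Rightarrow> real"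
  proof -
    define d where "d = \<bar>(\<integral>x. f x \<partial>M) - (\<integral>x. f x \<partial>N)\<bar>"
    define C where "C = measure M UNIV + measure N UNIV"
    have C: "C \<ge> 0" by (simp add: C_def)
    have fm: "f \<in> borel_measurable borel" by (rule borel_measurable_continuous_onI[OF f])
    have cpt: "compact (f ` {0..1})"
      by (intro compact_continuous_image continuous_on_subset[OF f]) auto
    then obtain B where B: "\<And>x. x \<in> {0..1} \<Longrightarrow> \<bar>f x\<bar> \<le> B"
      using compact_imp_bounded[OF cpt] unfolding bounded_iff by (metis imageI real_norm_def)
    have "d \<le> e * C" if e: "e > 0" for e
    proof -
      have cf: "continuous_on {0..1} f" by (rule continuous_on_subset[OF f]) simp
      obtain g where g: "real_polynomial_function g" "\<And>x. x \<in> {0..1} \<Longrightarrow> \<bar>f x - g x\<bar> < e"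
        using Stone_Weierstrass_real_polynomial_function[OF compact_Icc cf e] by metis
      obtain a n where gs: "g = (\<lambda>x. \<Sum>i\<le>n. a i * x ^ i)"
        using g(1) unfolding real_polynomial_function_iff_sum by blast
      have gm: "g \<in> borel_measurable borel" unfolding gs by simp
      have gi: "integrable K g" if "finite_borel_measure K" "AE x in K. x \<in> {0..1}" for K
        unfolding gs by (intro Bochner_Integration.integrable_sum pow that)
      have geq: "(\<integral>x. g x \<partial>M) = (\<integral>x. g x \<partial>N)"
        unfolding gs using pow[OF M M01] pow[OF N N01] moments
        by (subst (1 2) Bochner_Integration.integral_sum) (simp_all)
      have diff: "\<bar>(\<integral>x. f x \<partial>K) - (\<integral>x. g x \<partial>K)\<bar> \<le> e * measure K UNIV"
        if K: "finite_borel_measure K" "AE x in K. x \<in> {0..1}" for K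
      proof -
        interpret K: finite_borel_measure K by (rule K)
        have fi: "integrable K f" by (rule intg[OF K fm B])
        have "(\<integral>x. f x \<partial>K) - (\<integral>x. g x \<partial>K) = (\<integral>x. f x - g x \<partial>K)"
          using fi gi[OF K] by simp
        also have "\<bar>\<dots>\<bar> \<le> (\<integral>x. \<bar>f x - g x\<bar> \<partial>K)"
          using integral_norm_bound[of K "\<lambda>x. f x - g x"] by simp
        also have "\<dots> \<le> (\<integral>x. e \<partial>K)"
          using fi gi[OF K] K(2) g(2) by (intro integral_mono_AE) (auto simp: less_imp_le)
        finally show ?thesis using K.borel_UNIV by (simp add: mult.commute)
      qed
      show ?thesis using diff[OF M M01] diff[OF N N01] geq
        unfolding d_def C_def by (simp add: algebra_simps abs_le_iff)
    qed
    note bound = this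
    have *: "d \<le> e" if "e > 0" for e
    proof -
      \<comment> \<open>Dividing by \<open>C + 1\<close> instead of \<open>C\<close> covers the case
        that both measures are zero.\<close>
      have "d \<le> (e / (C + 1)) * C" using that C by (intro bound) simp
      also have "\<dots> \<le> e" using that C by (simp add: field_simps)
      finally show ?thesis .
    qed
    have "d \<le> 0" by (rule field_le_epsilon) (use * in auto)
    then show ?thesis by (simp add: d_def)
  qed
  have "cdf M = cdf N"
  proof
    fix a :: real
    \<comment> \<open>For n > 0 this is the continuous piecewise linear function that is 1 up to a
      and 0 from a + 1/n on; it tends pointwise to the indicator of \<open>{..a}\<close>.\<close>
    define r where "r n x = max 0 (min 1 (1 - real n * (x - a)))" for n :: nat and x :: real
    have r_lim: "(\<lambda>n. r n x) \<longlonglongrightarrow> indicator {..a} x" for x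
    proof (cases "x \<le> a")
      case True
      have "r n x = 1" for n
      proof -
        have "real n * (x - a) \<le> 0" using True by (simp add: mult_nonneg_nonpos)
        then show ?thesis by (simp add: r_def)
      qed
      then show ?thesis using True by simp
    next
      case False
      have "r n x = 0" if "n \<ge> nat \<lceil>1 / (x - a)\<rceil>" for n
      proof -
        have "1 / (x - a) \<le> real n" using that by linarith
        then have "1 \<le> real n * (x - a)" using False by (simp add: field_simps)
        then show ?thesis by (simp add: r_def)
      qed
      then have "eventually (\<lambda>n. r n x = 0) sequentially"
        unfolding eventually_sequentially by blast
      then show ?thesis using False by (simp add: tendsto_eventually)
    qed
    have lim: "(\<lambda>n. \<integral>x. r n x \<partial>K) \<longlonglongrightarrow> cdf K a" if K: "finite_borel_measure K" for K
    proof -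
      interpret K: finite_borel_measure K by (rule K)
      have "r n \<in> borel_measurable borel" for n
        unfolding r_def by measurable
      then have rm: "r n \<in> borel_measurable K" for n
        by (simp cong: measurable_cong_sets[OF K.M_is_borel refl])
      have "(\<lambda>n. \<integral>x. r n x \<partial>K) \<longlonglongrightarrow> (\<integral>x. indicator {..a} x \<partial>K)"
      proof (rule integral_dominated_convergence[where w="\<lambda>_. 1"])
        show "indicator {..a} \<in> borel_measurable K"
          by (simp cong: measurable_cong_sets[OF K.M_is_borel refl])
      qed (use r_lim rm in auto, simp add: r_def)
      also have "(\<integral>x. indicator {..a} x \<partial>K) = cdf K a"
        using K.borel_UNIV by (simp add: cdf_def)
      finally show ?thesis .
    qed
    have "(\<integral>x. r n x \<partial>M) = (\<integral>x. r n x \<partial>N)" for n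
      unfolding r_def by (intro cont continuous_intros)
    then show "cdf M a = cdf N a"
      using lim[OF M] lim[OF N] by (simp add: LIMSEQ_unique)
  qed
  then show ?thesis by (rule cdf_unique'[OF M N])
qed

text \<open>The substitution y = exp (- x) maps [0, infinity) into [0,1]. The weight exp (- x) makes
  the image measure \<open>T K\<close> finite even if \<open>K\<close> is not, and the n-th moment
  of \<open>T K\<close> is the Laplace transform of \<open>K\<close> at n + 1. So the moment problem
  on [0,1] decides.\<close>

lemma laplace_transform_unique:
  fixes M N :: "real measure"
  assumes sM[measurable_cong, simp]: "sets M = sets borel" and sN[measurable_cong, simp]: "sets N = sets borel"
    and M0: "AE x in M. 0 \<le> x" and N0: "AE x in N. 0 \<le> x"
    and fin: "\<And>u. u > 0 \<Longrightarrow> (\<integral>\<^sup>+x. ennreal (exp (- u * x)) \<partial>M) < \<infinity>"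
    and eq: "\<And>u. u > 0 \<Longrightarrow> (\<integral>\<^sup>+x. ennreal (exp (- u * x)) \<partial>M) = (\<integral>\<^sup>+x. ennreal (exp (- u * x)) \<partial>N)"
  shows "M = N"
proof -
  define T where "T K = distr (density K (\<lambda>x. ennreal (exp (- x)))) borel (\<lambda>x. exp (- x))" for K :: "real measure"
  have T: "finite_borel_measure (T K)" "AE x in T K. x \<in> {0..1}"
      "\<And>n. (\<integral>x. x ^ n \<partial>T K) = enn2real (\<integral>\<^sup>+x. ennreal (exp (- real (Suc n) * x)) \<partial>K)"
      "density (distr (T K) borel (\<lambda>y. - ln y)) (\<lambda>x. ennreal (exp x)) = K"
    if K[measurable_cong, simp]: "sets K = sets borel" and K0: "AE x in K. 0 \<le> x"
      and Kf: "(\<integral>\<^sup>+x. ennreal (exp (- 1 * x)) \<partial>K) < \<infinity>" for K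
  proof -
    have "emeasure (T K) UNIV = (\<integral>\<^sup>+x. ennreal (exp (- 1 * x)) \<partial>K)"
      unfolding T_def by (subst emeasure_distr) (auto simp: emeasure_density space_borel sets_eq_imp_space_eq[OF K])
    then show "finite_borel_measure (T K)"
      using Kf by (intro finite_borel_measure.intro finite_borel_measure_axioms.intro finite_measureI)
        (auto simp: T_def)
    show AE01: "AE x in T K. x \<in> {0..1}"
      using K0 unfolding T_def by (subst AE_distr_iff) (auto simp: AE_density)
    show "(\<integral>x. x ^ n \<partial>T K) = enn2real (\<integral>\<^sup>+x. ennreal (exp (- real (Suc n) * x)) \<partial>K)" for n
    proof -
      have "(\<integral>x. x ^ n \<partial>T K) = enn2real (\<integral>\<^sup>+x. ennreal (x ^ n) \<partial>T K)"
        using AE01 by (intro integral_eq_nn_integral) (auto simp: T_def)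
      also have "(\<integral>\<^sup>+x. ennreal (x ^ n) \<partial>T K) = (\<integral>\<^sup>+x. ennreal (exp (- x)) * ennreal (exp (- x) ^ n) \<partial>K)"
        unfolding T_def by (simp add: nn_integral_distr nn_integral_density)
      also have "\<dots> = (\<integral>\<^sup>+x. ennreal (exp (- real (Suc n) * x)) \<partial>K)"
      proof (intro nn_integral_cong)
        fix x :: real
        have "exp (- x) * exp (- x) ^ n = exp (- real (Suc n) * x)"
          by (metis exp_of_nat_mult mult_minus_left mult_minus_right power_Suc)
        then show "ennreal (exp (- x)) * ennreal (exp (- x) ^ n) = ennreal (exp (- real (Suc n) * x))"
          by (simp only: ennreal_mult[symmetric] exp_ge_zero zero_le_power)
      qed
      finally show ?thesis .
    qed
    \<comment> \<open>The map \<open>T\<close> is injective: - ln undoes the substitution, and the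
      density exp x cancels the weight exp (- x).\<close>
    have "distr (T K) borel (\<lambda>y. - ln y) = density K (\<lambda>x. ennreal (exp (- x)))"
      unfolding T_def by (subst distr_distr) (auto simp: comp_def intro!: distr_id2)
    then show "density (distr (T K) borel (\<lambda>y. - ln y)) (\<lambda>x. ennreal (exp x)) = K"
      by (simp add: density_density_eq ennreal_mult[symmetric] mult_exp_exp density_1)
  qed
  have finM: "(\<integral>\<^sup>+x. ennreal (exp (- 1 * x)) \<partial>M) < \<infinity>" using fin[of 1] by simp
  have finN: "(\<integral>\<^sup>+x. ennreal (exp (- 1 * x)) \<partial>N) < \<infinity>" using fin[of 1] eq[of 1] by simp
  note TM = T[OF sM M0 finM] and TN = T[OF sN N0 finN]
  have TMN: "T M = T N"
  proof (rule finite_borel_measure_moments_unique[OF TM(1) TN(1) TM(2) TN(2)])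
    show "(\<integral>x. x ^ n \<partial>T M) = (\<integral>x. x ^ n \<partial>T N)" for n
      unfolding TM(3) TN(3) using eq[of "real (Suc n)"] by simp
  qed
  have "M = density (distr (T M) borel (\<lambda>y. - ln y)) (\<lambda>x. ennreal (exp x))" by (rule TM(4)[symmetric])
  also have "\<dots> = N" unfolding TMN by (rule TN(4))
  finally show ?thesis .
qed

section \<open>Right derivatives\<close>

text \<open>The mean value theorem is not at hand for a one-sided derivative. Instead, for each
  slope e > 0, the set of points up to b that satisfy the bound with slope e is closed; at its
  supremum the right derivative 0 would carry the bound further, so the supremum is b.\<close>

lemma continuous_right_derivative_zero_imp_constant:
  fixes f :: "real \<Rightarrow> real"
  assumes cont: "continuous_on {a..} f"
    and der: "\<And>x. a \<le> x \<Longrightarrow> (f has_real_derivative 0) (at_right x)"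
    and b: "a \<le> b"
  shows "f b = f a"
proof -
  have "\<bar>f b - f a\<bar> \<le> e * (b - a)" if e: "e > 0" for e
  proof -
    define S where "S = {x \<in> {a..b}. \<bar>f x - f a\<bar> \<le> e * (x - a)}"
    have contb: "continuous_on {a..b} f" by (rule continuous_on_subset[OF cont]) auto
    have "closed S" unfolding S_def
      by (intro continuous_on_closed_Collect_le continuous_intros contb closed_atLeastAtMost)
    moreover have aS: "a \<in> S" using b by (simp add: S_def)
    moreover have bdd: "bdd_above S" by (auto simp: S_def bdd_above_def)
    ultimately have sS: "Sup S \<in> S" by (metis closed_contains_Sup empty_iff)
    define s where "s = Sup S"
    have s: "a \<le> s" "s \<le> b" "\<bar>f s - f a\<bar> \<le> e * (s - a)" using sS by (auto simp: s_def S_def)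
    have "s = b"
    proof (rule ccontr)
      assume "s \<noteq> b"
      with s have sb: "s < b" by simp
      have "((\<lambda>y. (f y - f s) / (y - s)) \<longlongrightarrow> 0) (at_right s)"
        using der[OF s(1)] by (simp add: has_field_derivative_iff)
      then have "eventually (\<lambda>y. \<bar>(f y - f s) / (y - s)\<bar> < e) (at_right s)"
        by (drule_tac tendstoD[OF _ e]) (simp add: dist_real_def)
      moreover have "eventually (\<lambda>y. s < y \<and> y < b) (at_right s)"
        using sb by (auto simp: eventually_at_right)
      ultimately have "eventually (\<lambda>y. \<bar>(f y - f s) / (y - s)\<bar> < e \<and> s < y \<and> y < b) (at_right s)"
        by eventually_elim simp
      then obtain y where y: "\<bar>(f y - f s) / (y - s)\<bar> < e" "s < y" "y < b"
        using eventually_happens[of _ "at_right s"] trivial_limit_at_right_real by blast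
      have "\<bar>f y - f s\<bar> \<le> e * (y - s)" using y by (simp add: abs_divide field_simps)
      then have "\<bar>f y - f a\<bar> \<le> e * (y - a)" using s(3) by (simp add: algebra_simps abs_le_iff)
      then have "y \<in> S" using y s by (simp add: S_def)
      then have "y \<le> s" unfolding s_def using bdd by (rule cSup_upper)
      then show False using y by simp
    qed
    then show ?thesis using s by simp
  qed
  note bound = this
  have *: "\<bar>f b - f a\<bar> \<le> e" if "e > 0" for e
  proof -
    have "\<bar>f b - f a\<bar> \<le> (e / (b - a + 1)) * (b - a)" using that b by (intro bound) simp
    also have "\<dots> \<le> e" using that b by (simp add: field_simps)
    finally show ?thesis .
  qed
  have "\<bar>f b - f a\<bar> \<le> 0" by (rule field_le_epsilon) (use * in auto)
  then show ?thesis by simp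
qed

text \<open>An inequality between measures on intervals does not pass to complements of sets, so it
  is first turned into an equation. The bound is asked for short intervals only, since the estimate
  to which it is applied is local; longer intervals are cut into pieces of length \<delta>.\<close>

lemma emeasure_le_lborel_if_Ioc:
  fixes \<nu> :: "real measure"
  assumes sets_\<nu>[measurable_cong, simp]: "sets \<nu> = sets borel" and r: "0 \<le> r" and \<delta>: "0 < \<delta>"
    and le: "\<And>a b. a \<le> b \<Longrightarrow> b - a \<le> \<delta> \<Longrightarrow> emeasure \<nu> {a<..b} \<le> ennreal (r * (b - a))"
    and A: "A \<in> sets borel"
  shows "emeasure \<nu> A \<le> ennreal r * emeasure lborel A"
proof -
  have le': "b - a \<le> real n * \<delta> \<Longrightarrow> a \<le> b \<Longrightarrow> emeasure \<nu> {a<..b} \<le> ennreal (r * (b - a))" for n a b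
  proof (induction n arbitrary: a)
    case 0
    then have "a = b" by simp
    then show ?case by simp
  next
    case (Suc n)
    show ?case
    proof (cases "b - a \<le> \<delta>")
      case False
      have "{a<..b} = {a<..a+\<delta>} \<union> {a+\<delta><..b}" using False \<delta> by auto
      then have "emeasure \<nu> {a<..b} \<le> emeasure \<nu> {a<..a+\<delta>} + emeasure \<nu> {a+\<delta><..b}"
        by (simp add: emeasure_subadditive)
      also have "\<dots> \<le> ennreal (r * \<delta>) + ennreal (r * (b - (a + \<delta>)))"
        using Suc.prems False \<delta> le[of a "a + \<delta>"]
        by (intro add_mono Suc.IH) (auto simp: algebra_simps)
      also have "\<dots> = ennreal (r * (b - a))"
      proof (subst ennreal_plus[symmetric])
        show "0 \<le> r * \<delta>" "0 \<le> r * (b - (a + \<delta>))" using r \<delta> False by simp_all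
      qed (simp add: algebra_simps)
      finally show ?thesis .
    qed (use le Suc in auto)
  qed
  have le: "emeasure \<nu> {a<..b} \<le> ennreal (r * (b - a))" if "a \<le> b" for a b
  proof -
    obtain n where "(b - a) / \<delta> \<le> real n" using real_arch_simple by blast
    then show ?thesis using \<delta> that by (intro le'[of b a n]) (auto simp: field_simps)
  qed
  then have fin: "emeasure \<nu> {a<..b} < \<infinity>" for a b
  proof (cases "a \<le> b")
    case True then show ?thesis using le[OF True] by (simp add: order_le_less_trans[OF _ ennreal_less_top])
  qed simp
  define G where "G x = (if 0 \<le> x then measure \<nu> {0<..x} else - measure \<nu> {x<..0})" for x
  have mUn: "measure \<nu> {a<..c} = measure \<nu> {a<..b} + measure \<nu> {b<..c}" if "a \<le> b" "b \<le> c" for a b c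
  proof -
    have "{a<..c} = {a<..b} \<union> {b<..c}" using that by auto
    then show ?thesis using fin[of a b] fin[of b c]
      by (simp only:) (rule measure_Un_AE, auto simp: fmeasurable_def)
  qed
  have G: "measure \<nu> {a<..b} = G b - G a" if "a \<le> b" for a b
    using that mUn[of 0 a b] mUn[of a b 0] mUn[of a 0 b] by (auto simp: G_def)
  have em: "emeasure \<nu> {a<..b} = ennreal (G b - G a)" if "a \<le> b" for a b
    using fin[of a b] G[OF that] by (simp add: emeasure_eq_ennreal_measure)
  have Glip: "0 \<le> G b - G a \<and> G b - G a \<le> r * (b - a)" if "a \<le> b" for a b
    using le[OF that] em[OF that] G[OF that, symmetric] r that by (auto simp: ennreal_le_iff)
  \<comment> \<open>\<open>G\<close> is the distribution function of \<nu>, normalised to be 0 at 0.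
    It is Lipschitz with constant r, so \<open>H\<close> is nondecreasing and continuous and defines
    the missing part of r times Lebesgue measure.\<close>
  define H where "H x = r * x - G x" for x
  have Hmono: "H x \<le> H y" if "x \<le> y" for x y
    using Glip[OF that] by (simp add: H_def algebra_simps)
  have Hcont: "continuous (at_right a) H" for a
  proof -
    have "r-lipschitz_on UNIV G"
    proof (rule lipschitz_onI)
      show "dist (G x) (G y) \<le> r * dist x y" for x y
        using Glip[of x y] Glip[of y x] by (cases "x \<le> y") (auto simp: dist_real_def)
    qed (rule r)
    then have "continuous_on UNIV H"
      unfolding H_def by (intro continuous_intros lipschitz_on_continuous_on)
    then show ?thesis by (simp add: continuous_on_eq_continuous_at continuous_at_imp_continuous_within)
  qed
  define \<sigma> where "\<sigma> = interval_measure H"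
  have sets_\<sigma>[measurable_cong, simp]: "sets \<sigma> = sets borel" by (simp add: \<sigma>_def)
  have em\<sigma>: "emeasure \<sigma> {a<..b} = ennreal (H b - H a)" if "a \<le> b" for a b
    unfolding \<sigma>_def by (rule emeasure_interval_measure_Ioc[OF that Hmono Hcont])
  have base: "emeasure \<nu> {a<..b} + emeasure \<sigma> {a<..b} = ennreal r * emeasure lborel {a<..b}" for a b
  proof (cases "a \<le> b")
    case True
    then show ?thesis using Glip[OF True] Hmono[OF True] r
      by (simp add: em em\<sigma> ennreal_plus[symmetric] ennreal_mult[symmetric] del: ennreal_plus)
        (simp add: H_def algebra_simps)
  qed simp
  have fin\<sigma>: "emeasure \<sigma> {a<..b} < \<infinity>" for a b
    by (cases "a \<le> b") (auto simp: em\<sigma>)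
  have borel_sets: "sets borel = sigma_sets UNIV (range (\<lambda>(a, b). {a<..b::real}))"
    unfolding borel_sigma_sets_Ioc by (rule sets_measure_of) simp
  have Ioc_stable: "Int_stable (range (\<lambda>(a, b). {a<..b::real}))"
    by (auto simp: Int_stable_def image_iff)
  have subset_Pow: "range (\<lambda>(a, b). {a<..b::real}) \<subseteq> Pow UNIV" by simp
  \<comment> \<open>The complementary measure \<open>\<sigma>\<close> turns the inequality into an identity, which extends to all Borel sets.\<close>
  have key: "emeasure \<nu> (A \<inter> {a<..b}) + emeasure \<sigma> (A \<inter> {a<..b}) = ennreal r * emeasure lborel (A \<inter> {a<..b})" for a b
    using A[unfolded borel_sets]
  proof (induction rule: sigma_sets_induct_disjoint
        [OF Ioc_stable subset_Pow, consumes 1, case_names basic empty compl union])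
    case (basic X)
    then obtain c d where "X = {c<..d}" by auto
    then have "X \<inter> {a<..b} = {max c a<..min d b}" by auto
    then show ?case by (simp only: base)
  next
    case empty
    then show ?case by simp
  next
    case (compl X)
    have [measurable]: "X \<in> sets borel" using compl(1) unfolding borel_sets .
    have fm: "emeasure K (X \<inter> {a<..b}) \<noteq> \<infinity>" if "sets K = sets borel" "emeasure K {a<..b} < \<infinity>" for K
      using emeasure_mono[of "X \<inter> {a<..b}" "{a<..b}" K] that by auto
    have split: "emeasure K {a<..b} = emeasure K (X \<inter> {a<..b}) + emeasure K ((UNIV - X) \<inter> {a<..b})"
      if [measurable_cong, simp]: "sets K = sets borel" for K :: "real measure"
      by (subst plus_emeasure) (auto intro!: arg_cong[where f="emeasure K"])
    \<comment> \<open>Complements call for subtraction. In \<open>ennreal\<close> it is replaced by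
      adding the terms of X on both sides and cancelling them, which requires finiteness; this is
      why everything is intersected with \<open>{a<..b}\<close>.\<close>
    have "(emeasure \<nu> (X \<inter> {a<..b}) + emeasure \<sigma> (X \<inter> {a<..b}))
        + (emeasure \<nu> ((UNIV - X) \<inter> {a<..b}) + emeasure \<sigma> ((UNIV - X) \<inter> {a<..b}))
        = (emeasure \<nu> (X \<inter> {a<..b}) + emeasure \<sigma> (X \<inter> {a<..b}))
        + ennreal r * emeasure lborel ((UNIV - X) \<inter> {a<..b})"
      using base[of a b] unfolding compl(2)
      by (simp add: split[of \<nu>] split[of \<sigma>] split[of lborel] compl(2)[symmetric] distrib_left add_ac)
    then show ?case
      using fm[of \<nu>] fm[of \<sigma>] fin fin\<sigma> by (simp add: ennreal_add_left_cancel)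
  next
    case (union X)
    have [measurable]: "X i \<in> sets borel" for i using union(2) unfolding borel_sets by auto
    have s: "emeasure K ((\<Union>i. X i) \<inter> {a<..b}) = (\<Sum>i. emeasure K (X i \<inter> {a<..b}))"
      if [measurable_cong, simp]: "sets K = sets borel" for K :: "real measure"
    proof -
      have "disjoint_family (\<lambda>i. X i \<inter> {a<..b})" using union(1) by (auto simp: disjoint_family_on_def)
      then show ?thesis by (subst suminf_emeasure) auto
    qed
    show ?case
      by (simp add: s suminf_add union(3) ennreal_suminf_cmult)
  qed
  define B where "B n = A \<inter> {- real n<..real n}" for n
  have UB: "(\<Union>n. B n) = A"
  proof -
    have "\<exists>n. - real n < x \<and> x \<le> real n" for x
    proof -
      obtain n where "\<bar>x\<bar> + 1 \<le> real n" using real_arch_simple by blast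
      then have "- real n < x" "x \<le> real n" by linarith+
      then show ?thesis by blast
    qed
    then show ?thesis by (auto simp: B_def)
  qed
  have "incseq B" by (force simp: B_def incseq_def)
  then have "emeasure \<nu> A = (SUP n. emeasure \<nu> (B n))"
  proof (subst SUP_emeasure_incseq)
    show "range B \<subseteq> sets \<nu>" using A by (auto simp: B_def)
  qed (simp_all only: UB)
  also have "\<dots> \<le> ennreal r * emeasure lborel A"
  proof (rule SUP_least)
    fix n
    have "emeasure \<nu> (B n) \<le> ennreal r * emeasure lborel (B n)"
      unfolding B_def key[symmetric] by simp
    also have "\<dots> \<le> ennreal r * emeasure lborel A"
      using A by (intro mult_left_mono emeasure_mono) (auto simp: B_def)
    finally show "emeasure \<nu> (B n) \<le> ennreal r * emeasure lborel A" .
  qed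
  finally show ?thesis .
qed

lemma mono_right_derivative_borel_measurable:
  fixes G :: "real \<Rightarrow> real"
  assumes G: "mono G" and der: "\<And>x. (G has_real_derivative D x) (at_right x)"
  shows "D \<in> borel_measurable borel" "0 \<le> D x"
    "(\<lambda>n. (G (x + 1 / real (Suc n)) - G x) * real (Suc n)) \<longlonglongrightarrow> D x"
proof -
  have lim: "(\<lambda>n. (G (x + 1 / real (Suc n)) - G x) * real (Suc n)) \<longlonglongrightarrow> D x" for x
  proof -
    have "filterlim (\<lambda>n. x + 1 / real (Suc n)) (at_right x) sequentially"
      unfolding filterlim_at using LIMSEQ_inverse_real_of_nat_add[of x]
      by (auto simp: inverse_eq_divide)
    with der[of x] have "(\<lambda>n. (G (x + 1 / real (Suc n)) - G x) / (x + 1 / real (Suc n) - x)) \<longlonglongrightarrow> D x"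
      unfolding has_field_derivative_iff by (rule filterlim_compose)
    then show ?thesis by simp
  qed
  show "(\<lambda>n. (G (x + 1 / real (Suc n)) - G x) * real (Suc n)) \<longlonglongrightarrow> D x" by (rule lim)
  show "0 \<le> D x"
    by (rule LIMSEQ_le_const[OF lim[of x]], rule exI[of _ 0], intro allI impI mult_nonneg_nonneg)
      (auto intro!: monoD[OF G])
  have [measurable]: "G \<in> borel_measurable borel" by (rule borel_measurable_mono[OF G])
  show "D \<in> borel_measurable borel"
    by (rule borel_measurable_LIMSEQ_real[OF lim]) measurable
qed

text \<open>Since the finite right derivative exists at every point, without exceptional null set, a
  singular part as in the Cantor function cannot occur. The upper bound is Fatou applied to
  difference quotients. For the lower bound, on a set where D < r the Stieltjes measure of G is at
  most r times Lebesgue measure, and the interval is sliced according to the values of D.\<close>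

lemma nn_integral_right_derivative_mono:
  fixes G D :: "real \<Rightarrow> real"
  assumes G: "mono G" and cont: "continuous_on UNIV G"
    and der: "\<And>x. (G has_real_derivative D x) (at_right x)"
    and ab: "a \<le> b"
  shows "(\<integral>\<^sup>+x. ennreal (D x) * indicator {a<..b} x \<partial>lborel) = ennreal (G b - G a)"
proof (rule antisym)
  note D = mono_right_derivative_borel_measurable[OF G der]
  note [measurable] = D(1)
  have Gmono: "G x \<le> G y" if "x \<le> y" for x y using G that by (rule monoD)
  have [measurable]: "G \<in> borel_measurable borel" by (rule borel_measurable_mono[OF G])
  define h where "h n = 1 / real (Suc n)" for n
  have h: "0 < h n" "h n \<le> 1" "h n * real (Suc n) = 1" for n by (auto simp: h_def)
  \<comment> \<open>The integral starts at a - 1 so that the antiderivative of G has a two-sided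
    derivative at a as well.\<close>
  define H where "H x = integral {a - 1..x} G" for x
  have derH: "(H has_real_derivative G x) (at x)" if "a \<le> x" for x
  proof -
    have "(H has_real_derivative G x) (at x within {a - 1..x + 1})"
      unfolding H_def using that
      by (intro integral_has_real_derivative continuous_on_subset[OF cont]) auto
    moreover have "x \<in> interior {a - 1..x + 1}" using that by simp
    ultimately show ?thesis by (simp only: at_within_interior)
  qed
  have Hbounds: "h n * G x \<le> H (x + h n) - H x" "H (x + h n) - H x \<le> h n * G (x + h n)" if "a \<le> x" for x n
  proof -
    have "\<exists>z. x < z \<and> z < x + h n \<and> H (x + h n) - H x = (x + h n - x) * G z"
      using that h(1)[of n] by (intro MVT2 derH) auto
    then obtain z where z: "x < z" "z < x + h n" "H (x + h n) - H x = (x + h n - x) * G z"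
      by blast
    then show "h n * G x \<le> H (x + h n) - H x" "H (x + h n) - H x \<le> h n * G (x + h n)"
      using h(1)[of n] Gmono[of x z] Gmono[of z "x + h n"] by auto
  qed
  show "(\<integral>\<^sup>+x. ennreal (D x) * indicator {a<..b} x \<partial>lborel) \<le> ennreal (G b - G a)"
  proof -
    define q where "q n x = (G (x + h n) - G x) * real (Suc n)" for n x
    have q: "(\<lambda>n. ennreal (q n x) * indicator {a<..b} x) \<longlonglongrightarrow> ennreal (D x) * indicator {a<..b} x" for x
      using D(3)[of x] by (cases "x \<in> {a<..b}") (auto simp: q_def h_def)
    have int_q: "(\<integral>\<^sup>+x. ennreal (q n x) * indicator {a<..b} x \<partial>lborel) \<le> ennreal (G (b + h n) - G a)" for n
    proof -
      \<comment> \<open>\<open>Q x\<close> is the mean of G over [x, x + h n]; it lies between G x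
        and G (x + h n) and is an antiderivative of the difference quotient
        \<open>q n\<close>.\<close>
      define Q where "Q x = (H (x + h n) - H x) * real (Suc n)" for x
      have "(Q has_real_derivative q n x) (at x)" if "a \<le> x" for x
      proof -
        have "((\<lambda>x. H (x + h n)) has_real_derivative G (x + h n)) (at x)"
          using derH[of "x + h n"] that h(1)[of n] by (simp add: DERIV_shift)
        then show ?thesis
          unfolding Q_def q_def by (intro DERIV_cmult_right DERIV_diff derH that)
      qed
      then have "(\<integral>\<^sup>+x. ennreal (q n x) * indicator {a..b} x \<partial>lborel) = ennreal (Q b - Q a)"
        using ab h(1)[of n]
        by (intro nn_integral_FTC_Icc) (auto simp: q_def intro!: mult_nonneg_nonneg Gmono)
      also have "\<dots> \<le> ennreal (G (b + h n) - G a)"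
      proof (rule ennreal_leI)
        have "Q b \<le> G (b + h n)" "G a \<le> Q a"
          using Hbounds(2)[of b n] Hbounds(1)[of a n] ab h(3)[of n] unfolding Q_def
          by (auto simp: h_def field_simps simp del: of_nat_Suc)
        then show "Q b - Q a \<le> G (b + h n) - G a" by simp
      qed
      finally show ?thesis
        by (rule order_trans[rotated]) (auto intro!: nn_integral_mono split: split_indicator)
    qed
    have "(\<integral>\<^sup>+x. ennreal (D x) * indicator {a<..b} x \<partial>lborel)
        = (\<integral>\<^sup>+x. liminf (\<lambda>n. ennreal (q n x) * indicator {a<..b} x) \<partial>lborel)"
      using q by (intro nn_integral_cong lim_imp_Liminf[symmetric]) auto
    also have "\<dots> \<le> liminf (\<lambda>n. \<integral>\<^sup>+x. ennreal (q n x) * indicator {a<..b} x \<partial>lborel)"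
      by (intro nn_integral_liminf) (auto simp: q_def)
    also have "\<dots> \<le> liminf (\<lambda>n. ennreal (G (b + h n) - G a))"
      by (intro Liminf_mono always_eventually allI int_q)
    also have "\<dots> = ennreal (G b - G a)"
    proof (rule lim_imp_Liminf)
      have "(\<lambda>n. b + h n) \<longlonglongrightarrow> b"
        unfolding h_def using LIMSEQ_inverse_real_of_nat_add[of b] by (simp add: inverse_eq_divide)
      moreover have "isCont G b" using cont by (simp add: continuous_on_eq_continuous_at)
      ultimately have "(\<lambda>n. G (b + h n)) \<longlonglongrightarrow> G b" by (intro isCont_tendsto_compose[of b G])
      then show "(\<lambda>n. ennreal (G (b + h n) - G a)) \<longlonglongrightarrow> ennreal (G b - G a)"
        by (intro tendsto_ennrealI tendsto_intros)
    qed simp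
    finally show ?thesis .
  qed
  define \<mu> where "\<mu> = interval_measure G"
  have [measurable_cong, simp]: "sets \<mu> = sets borel" by (simp add: \<mu>_def)
  have rcont: "continuous (at_right x) G" for x
    using cont by (simp add: continuous_on_eq_continuous_at continuous_at_imp_continuous_within)
  have Ioc: "emeasure \<mu> {x<..y} = ennreal (G y - G x)" if "x \<le> y" for x y
    unfolding \<mu>_def by (rule emeasure_interval_measure_Ioc[OF that Gmono rcont])
  have Icc: "emeasure \<mu> {x..y} = ennreal (G y - G x)" if "x \<le> y" for x y
    unfolding \<mu>_def by (rule emeasure_interval_measure_Icc[OF that Gmono cont])
  have less: "emeasure \<mu> A \<le> ennreal r * emeasure lborel A"
    if A[measurable]: "A \<in> sets borel" and r: "0 < r" "\<And>x. x \<in> A \<Longrightarrow> D x < r" for A r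
  proof -
    \<comment> \<open>A right derivative below r makes the increments from x at most r t for all
      small t. \<open>C n\<close> collects the points where all t up to \<open>h n\<close> are small
      enough; it is closed by continuity of G, hence measurable, and these sets exhaust A.\<close>
    define C where "C n = (\<Inter>t\<in>{0<..h n}. {x. G (x + t) - G x \<le> r * t})" for n
    have "closed (C n)" for n
      unfolding C_def
      by (intro closed_INT ballI closed_Collect_le continuous_intros continuous_on_compose2[OF cont]) auto
    then have [measurable]: "C n \<in> sets borel" for n by (rule borel_closed)
    have inc: "incseq (\<lambda>n. A \<inter> C n)"
    proof (rule incseq_SucI)
      fix n
      have "h (Suc n) \<le> h n" by (simp add: h_def frac_le)
      then show "A \<inter> C n \<subseteq> A \<inter> C (Suc n)" unfolding C_def by auto
    qed
    have UN: "(\<Union>n. A \<inter> C n) = A"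
    proof -
      have "\<exists>n. x \<in> C n" if "x \<in> A" for x
      proof -
        have "eventually (\<lambda>y. (G y - G x) / (y - x) < r) (at_right x)"
          using der[of x] r(2)[OF that] unfolding has_field_derivative_iff by (rule order_tendstoD)
        then obtain b where b: "b > x" "\<And>y. x < y \<Longrightarrow> y < b \<Longrightarrow> (G y - G x) / (y - x) < r"
          unfolding eventually_at_right_field by blast
        obtain n where n: "h n < b - x"
          using reals_Archimedean[of "b - x"] b(1) by (auto simp: h_def inverse_eq_divide)
        have "G (x + t) - G x \<le> r * t" if "0 < t" "t \<le> h n" for t
          using b(2)[of "x + t"] that n by (simp add: field_simps)
        then show ?thesis unfolding C_def by (auto intro!: exI[of _ n])
      qed
      then show ?thesis by auto
    qed
    have "emeasure \<mu> (A \<inter> C n) \<le> ennreal r * emeasure lborel A" for n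
    proof -
      define \<nu> where "\<nu> = density \<mu> (indicator (A \<inter> C n))"
      have em\<nu>: "emeasure \<nu> X = emeasure \<mu> (A \<inter> C n \<inter> X)" if "X \<in> sets borel" for X
        unfolding \<nu>_def using that by (simp add: emeasure_density indicator_inter_arith[symmetric])
      have "emeasure \<nu> A \<le> ennreal r * emeasure lborel A"
      proof (rule emeasure_le_lborel_if_Ioc[OF _ _ h(1)[of n] _ A])
        show "sets \<nu> = sets borel" by (simp add: \<nu>_def)
        show "0 \<le> r" using r by simp
        fix c d :: real assume cd: "c \<le> d" "d - c \<le> h n"
        define S where "S = A \<inter> C n \<inter> {c<..d}"
        have "emeasure \<mu> S \<le> ennreal (r * (d - c))"
        proof (cases "S = {}")
          case False
          have bdd: "bdd_below S" by (rule bdd_belowI[of _ c]) (auto simp: S_def)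
          \<comment> \<open>Every point x of S satisfies G d - G x <= r (d - c). This is a closed
            condition, so it also holds at the infimum p, and S is contained in {p..d}.\<close>
          define p where "p = Inf S"
          have cl: "closed {x. G d - G x \<le> r * (d - c)}"
            by (intro closed_Collect_le continuous_intros continuous_on_compose2[OF cont]) auto
          have sub: "S \<subseteq> {x. G d - G x \<le> r * (d - c)}"
          proof
            fix x assume x: "x \<in> S"
            show "x \<in> {x. G d - G x \<le> r * (d - c)}"
            proof (cases "x = d")
              case False
              then have "G (x + (d - x)) - G x \<le> r * (d - x)"
                using x cd(2) unfolding S_def C_def by (fastforce simp del: add_diff_inverse)
              also have "\<dots> \<le> r * (d - c)" using x r(1) by (intro mult_left_mono) (auto simp: S_def)
              finally show ?thesis by simp
            qed (use cd r in simp)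
          qed
          have "p \<in> closure S" unfolding p_def by (rule closure_contains_Inf[OF False bdd])
          then have p: "G d - G p \<le> r * (d - c)" using closure_minimal[OF sub cl] by auto
          have pS: "S \<subseteq> {p..d}" unfolding p_def using cInf_lower[OF _ bdd] by (auto simp: S_def)
          then have pd: "p \<le> d" using False by fastforce
          have "emeasure \<mu> S \<le> emeasure \<mu> {p..d}" by (rule emeasure_mono[OF pS]) simp
          also have "\<dots> \<le> ennreal (r * (d - c))" unfolding Icc[OF pd] by (rule ennreal_leI[OF p])
          finally show ?thesis .
        qed simp
        then show "emeasure \<nu> {c<..d} \<le> ennreal (r * (d - c))" by (simp add: em\<nu> S_def)
      qed
      then show ?thesis by (simp add: em\<nu> Int_commute Int_left_commute)
    qed
    moreover have "emeasure \<mu> A = (SUP n. emeasure \<mu> (A \<inter> C n))"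
    proof (subst SUP_emeasure_incseq)
      show "range (\<lambda>n. A \<inter> C n) \<subseteq> sets \<mu>" by auto
    qed (simp_all only: UN inc)
    ultimately show ?thesis by (simp add: SUP_least)
  qed
  show "ennreal (G b - G a) \<le> (\<integral>\<^sup>+x. ennreal (D x) * indicator {a<..b} x \<partial>lborel)" (is "_ \<le> ?I")
  proof (rule ennreal_le_epsilon)
    fix e :: real assume e: "0 < e"
    define d where "d = e / (b - a + 1)"
    \<comment> \<open>The mesh d is chosen so that the total error d (b - a) of the slicing stays
      below e, also when a = b.\<close>
    have d: "0 < d" "d * (b - a) \<le> e" using e ab by (auto simp: d_def field_simps)
    define \<kappa> where "\<kappa> = density lborel (\<lambda>x. ennreal (D x + d))"
    have [measurable_cong, simp]: "sets \<kappa> = sets borel" by (simp add: \<kappa>_def)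
    \<comment> \<open>On the k-th slice the Stieltjes measure is at most (k + 1) d times Lebesgue
      measure, while D + d is at least (k + 1) d there.\<close>
    define S where "S k = {a<..b} \<inter> {x. real k * d \<le> D x \<and> D x < real (Suc k) * d}" for k
    have [measurable]: "S k \<in> sets borel" for k unfolding S_def by measurable
    have disj: "disjoint_family S"
    proof -
      have "S i \<inter> S j = {}" if "i < j" for i j
      proof -
        have "real (Suc i) * d \<le> real j * d" using that d(1) by (intro mult_right_mono) auto
        then show ?thesis by (auto simp: S_def simp del: of_nat_Suc)
      qed
      then show ?thesis unfolding disjoint_family_on_def by (metis Int_commute linorder_neqE_nat)
    qed
    have UN: "(\<Union>k. S k) = {a<..b}"
    proof -
      have "\<exists>k. real k * d \<le> D x \<and> D x < real (Suc k) * d" for x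
      proof -
        have "0 \<le> D x / d" using D(2)[of x] d(1) by simp
        then have "real (nat \<lfloor>D x / d\<rfloor>) \<le> D x / d" "D x / d < real (Suc (nat \<lfloor>D x / d\<rfloor>))" by linarith+
        then show ?thesis using d(1) by (intro exI[of _ "nat \<lfloor>D x / d\<rfloor>"]) (simp add: field_simps)
      qed
      then show ?thesis unfolding S_def by auto
    qed
    have SK: "emeasure \<mu> (S k) \<le> emeasure \<kappa> (S k)" for k
    proof -
      have "emeasure \<mu> (S k) \<le> ennreal (real (Suc k) * d) * emeasure lborel (S k)"
        using d(1) by (intro less) (auto simp: S_def)
      also have "\<dots> = (\<integral>\<^sup>+x. ennreal (real (Suc k) * d) * indicator (S k) x \<partial>lborel)"
        by (simp add: nn_integral_cmult_indicator)
      also have "\<dots> \<le> emeasure \<kappa> (S k)"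
        unfolding \<kappa>_def
        by (subst emeasure_density)
          (auto intro!: nn_integral_mono ennreal_leI simp: S_def algebra_simps
            simp del: ennreal_plus split: split_indicator)
      finally show ?thesis .
    qed
    have "ennreal (G b - G a) = emeasure \<mu> (\<Union>k. S k)" using Ioc[OF ab] UN by simp
    also have "\<dots> = (\<Sum>k. emeasure \<mu> (S k))" using disj by (subst suminf_emeasure) auto
    also have "\<dots> \<le> (\<Sum>k. emeasure \<kappa> (S k))" by (intro suminf_le SK summableI)
    also have "\<dots> = emeasure \<kappa> {a<..b}" using disj UN by (subst suminf_emeasure) auto
    also have "\<dots> = (\<integral>\<^sup>+x. ennreal (D x) * indicator {a<..b} x + ennreal d * indicator {a<..b} x \<partial>lborel)"
      unfolding \<kappa>_def using D(2) d(1)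
      by (subst emeasure_density) (auto intro!: nn_integral_cong split: split_indicator)
    also have "\<dots> = ?I + ennreal d * emeasure lborel {a<..b}"
      by (subst nn_integral_add) (auto simp: nn_integral_cmult_indicator)
    also have "\<dots> \<le> ?I + ennreal e"
      using d ab by (intro add_left_mono) (simp add: ennreal_mult[symmetric] ennreal_leI)
    finally show "ennreal (G b - G a) \<le> ?I + ennreal e" .
  qed
qed

section \<open>Differentiating the Laplace transform\<close>

definition laplace :: "real measure \<Rightarrow> real \<Rightarrow> real" where
  "laplace L u = (\<integral>x. exp (- u * x) \<partial>L)"

lemma laplace_pos:
  assumes "prob_space L" "sets L = sets borel" "AE x in L. 0 \<le> x" "0 \<le> u"
  shows "integrable L (\<lambda>x. exp (- u * x))" "0 < laplace L u"
proof -
  interpret prob_space L by fact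
  note [measurable_cong] = assms(2)
  show int: "integrable L (\<lambda>x. exp (- u * x))"
    using assms(3,4) by (intro integrable_const_bound[where B=1]) auto
  have "laplace L u \<noteq> 0"
  proof
    assume "laplace L u = 0"
    then have "AE x in L. exp (- u * x) = 0"
      using int unfolding laplace_def by (subst (asm) integral_nonneg_eq_0_iff_AE) auto
    then show False by simp
  qed
  moreover have "0 \<le> laplace L u" unfolding laplace_def by simp
  ultimately show "0 < laplace L u" by simp
qed

lemma mult_exp_minus_le: "x * exp (- u * x) \<le> 1 / u" if "0 < u" for x u :: real
proof -
  have "u * x \<le> exp (u * x)" using exp_ge_add_one_self[of "u * x"] by linarith
  then show ?thesis using that by (simp add: exp_minus field_simps)
qed

text \<open>Differentiation under the integral. By the mean value theorem the difference quotient at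
  v is - x exp (- z x) with z between u and v. Once v >= u / 2, its modulus is at most 2 / u, a
  bound that does not involve a first moment of L.\<close>

lemma laplace_has_real_derivative:
  assumes L: "prob_space L" "sets L = sets borel" "AE x in L. 0 \<le> x" and u: "0 < u"
  shows "integrable L (\<lambda>x. x * exp (- u * x))"
    "(laplace L has_real_derivative - (\<integral>x. x * exp (- u * x) \<partial>L)) (at u)"
proof -
  interpret prob_space L by fact
  note [measurable_cong] = L(2)
  show "integrable L (\<lambda>x. x * exp (- u * x))"
    using L(3) u mult_exp_minus_le[OF u]
    by (intro integrable_const_bound[where B="1 / u"]) (auto simp: abs_mult)
  have "((\<lambda>v. (laplace L v - laplace L u) / (v - u)) \<longlongrightarrow> - (\<integral>x. x * exp (- u * x) \<partial>L)) (at u)"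
    unfolding tendsto_at_iff_sequentially comp_def
  proof (intro allI impI)
    fix v :: "nat \<Rightarrow> real" assume v: "\<forall>i. v i \<in> UNIV - {u}" "v \<longlonglongrightarrow> u"
    obtain N where N: "\<And>n. n \<ge> N \<Longrightarrow> \<bar>v n - u\<bar> < u / 2"
      using v(2) u unfolding LIMSEQ_def dist_real_def by (meson half_gt_zero)
    define q where "q n x = (exp (- v (n + N) * x) - exp (- u * x)) / (v (n + N) - u)" for n x
    have vN: "v (n + N) \<ge> u / 2" "v (n + N) \<noteq> u" for n
      using N[of "n + N", THEN abs_le_D2[OF less_imp_le]] v(1) by (linarith, simp)
    have der: "((\<lambda>w. exp (- w * x)) has_real_derivative - (x * exp (- w * x))) (at w)" for w x :: real
      by (auto intro!: derivative_eq_intros)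
    have "(\<lambda>n. \<integral>x. q n x \<partial>L) \<longlonglongrightarrow> (\<integral>x. - (x * exp (- u * x)) \<partial>L)"
    proof (rule integral_dominated_convergence[where w="\<lambda>_. 2 / u"])
      show "AE x in L. (\<lambda>n. q n x) \<longlonglongrightarrow> - (x * exp (- u * x))"
      proof (intro AE_I2)
        fix x
        have "filterlim (\<lambda>n. v (n + N)) (at u) sequentially"
          unfolding filterlim_at using LIMSEQ_ignore_initial_segment[OF v(2), of N] vN(2) by auto
        with der[of x u] show "(\<lambda>n. q n x) \<longlonglongrightarrow> - (x * exp (- u * x))"
          unfolding q_def has_field_derivative_iff by (rule filterlim_compose)
      qed
      fix n
      show "AE x in L. norm (q n x) \<le> 2 / u"
        using L(3)
      proof eventually_elim
        case (elim x)
        have "\<exists>z. u / 2 \<le> z \<and> q n x = - (x * exp (- z * x))"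
        proof (cases "v (n + N) < u")
          case True
          have "\<exists>z. v (n + N) < z \<and> z < u \<and> exp (- u * x) - exp (- v (n + N) * x)
              = (u - v (n + N)) * - (x * exp (- z * x))"
            using True by (intro MVT2 der)
          then obtain z where z: "v (n + N) < z" "exp (- u * x) - exp (- v (n + N) * x)
              = (u - v (n + N)) * - (x * exp (- z * x))" by blast
          have "q n x = - (x * exp (- z * x))"
            using z(2) True unfolding q_def by (simp add: field_simps)
          then show ?thesis using z(1) vN(1)[of n] by (intro exI[of _ z]) simp
        next
          case False
          then have less: "u < v (n + N)" using vN(2)[of n] by simp
          have "\<exists>z. u < z \<and> z < v (n + N) \<and> exp (- v (n + N) * x) - exp (- u * x)
              = (v (n + N) - u) * - (x * exp (- z * x))"
            using less by (intro MVT2 der)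
          then obtain z where z: "u < z" "exp (- v (n + N) * x) - exp (- u * x)
              = (v (n + N) - u) * - (x * exp (- z * x))" by blast
          have "q n x = - (x * exp (- z * x))"
            using z(2) less unfolding q_def by (simp add: field_simps)
          then show ?thesis using z(1) u by (intro exI[of _ z]) simp
        qed
        then obtain z where z: "u / 2 \<le> z" "q n x = - (x * exp (- z * x))" by blast
        have "norm (q n x) = x * exp (- z * x)" using z(2) elim by simp
        also have "\<dots> \<le> 1 / z" using z(1) u by (intro mult_exp_minus_le) simp
        also have "\<dots> \<le> 2 / u" using z(1) u by (simp add: field_simps)
        finally show ?case .
      qed
    qed (auto simp: q_def)
    also have "(\<lambda>n. \<integral>x. q n x \<partial>L)
        = (\<lambda>n. (laplace L (v (n + N)) - laplace L u) / (v (n + N) - u))"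
    proof
      fix n
      show "(\<integral>x. q n x \<partial>L) = (laplace L (v (n + N)) - laplace L u) / (v (n + N) - u)"
        unfolding q_def laplace_def
        using laplace_pos(1)[OF L, of u] laplace_pos(1)[OF L, of "v (n + N)"] vN(1)[of n] u by simp
    qed
    finally show "(\<lambda>n. (laplace L (v n) - laplace L u) / (v n - u)) \<longlonglongrightarrow> - (\<integral>x. x * exp (- u * x) \<partial>L)"
      by (simp add: LIMSEQ_offset[where k=N])
  qed
  then show "(laplace L has_real_derivative - (\<integral>x. x * exp (- u * x) \<partial>L)) (at u)"
    by (simp add: has_field_derivative_iff)
qed

section \<open>Affine Markov processes and their limits\<close>

context nonneg_markov_process
begin

lemma space_P: "0 \<le> x \<Longrightarrow> space (P x) = space M"
  using sets_P by (rule sets_eq_imp_space_eq)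

lemma measurable_X_P: "0 \<le> x \<Longrightarrow> 0 \<le> t \<Longrightarrow> X t \<in> borel_measurable (P x)"
  using measurable_X by (simp cong: measurable_cong_sets[OF sets_P refl])

text \<open>This is the Chapman-Kolmogorov equation. The Markov property is given for indicators and
  as a conditional expectation; taking expectations identifies the law of \<open>X (s + t)\<close>
  with the law of \<open>X s\<close> bound to the transition kernel, and the identity then extends
  to all measurable f.\<close>

lemma nn_integral_markov:
  assumes x: "0 \<le> x" and s: "0 \<le> s" and t: "0 \<le> t" and f: "f \<in> borel_measurable borel"
  shows "(\<integral>\<^sup>+\<omega>. f (X (s + t) \<omega>) \<partial>P x) = (\<integral>\<^sup>+\<omega>. \<integral>\<^sup>+\<omega>'. f (X t \<omega>') \<partial>P (X s \<omega>) \<partial>P x)"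
proof -
  \<comment> \<open>Only \<open>P x\<close> with x >= 0 is known to be a probability measure;
    \<open>max y 0\<close> extends the kernel to the whole line, as required by
    \<open>subprob_algebra\<close>.\<close>
  define \<kappa> where "\<kappa> y = distr (P (max y 0)) borel (X t)" for y
  interpret Px: prob_space "P x" by (rule prob_space_P[OF x])
  have Xs[measurable]: "X s \<in> borel_measurable (P x)" and Xst[measurable]: "X (s + t) \<in> borel_measurable (P x)"
    using x s t by (auto intro: measurable_X_P)
  have em\<kappa>: "emeasure (\<kappa> y) A = ennreal (measure (P (max y 0)) (X t -` A \<inter> space M))"
    if "A \<in> sets borel" for y A
  proof -
    interpret Py: prob_space "P (max y 0)" by (rule prob_space_P) simp
    show ?thesis
      using that t unfolding \<kappa>_def
      by (subst emeasure_distr) (auto simp: measurable_X_P space_P Py.emeasure_eq_measure)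
  qed
  have \<kappa>: "\<kappa> \<in> measurable borel (subprob_algebra borel)"
  proof (rule measurable_subprob_algebra)
    fix y :: real
    interpret Py: prob_space "P (max y 0)" by (rule prob_space_P) simp
    show "subprob_space (\<kappa> y)"
      unfolding \<kappa>_def
      by (intro prob_space_imp_subprob_space Py.prob_space_distr measurable_X_P t) simp
    show "sets (\<kappa> y) = sets borel" by (simp add: \<kappa>_def)
  next
    fix A :: "real set" assume A: "A \<in> sets borel"
    have "(\<lambda>y. max y 0 :: real) \<in> measurable borel (restrict_space borel {0..})"
      by (intro measurable_restrict_space2) auto
    from measurable_compose[OF this measurable_kernel[OF t A]]
    show "(\<lambda>y. emeasure (\<kappa> y) A) \<in> borel_measurable borel"
      by (simp add: em\<kappa>[OF A])
  qed
  have "distr (P x) borel (X (s + t)) = distr (P x) borel (X s) \<bind> \<kappa>"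
  proof (rule measure_eqI)
    show sets_eq: "sets (distr (P x) borel (X (s + t))) = sets (distr (P x) borel (X s) \<bind> \<kappa>)"
      by (subst sets_bind[where N=borel]) (auto simp: \<kappa>_def)
    fix A assume "A \<in> sets (distr (P x) borel (X (s + t)))"
    then have A[measurable]: "A \<in> sets borel" by simp
    have sub: "subalgebra (P x) (past M X s)"
      unfolding subalgebra_def past_def
    proof (intro conjI)
      show "space (sigma (space M) {X r -` A \<inter> space M |r A. 0 \<le> r \<and> r \<le> s \<and> A \<in> sets borel}) = space (P x)"
        by (subst space_measure_of) (auto simp: space_P[OF x])
      have "sigma_sets (space M) {X r -` A \<inter> space M |r A. 0 \<le> r \<and> r \<le> s \<and> A \<in> sets borel} \<subseteq> sets M"
        using measurable_X by (intro sets.sigma_sets_subset) (auto intro: measurable_sets)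
      then show "sets (sigma (space M) {X r -` A \<inter> space M |r A. 0 \<le> r \<and> r \<le> s \<and> A \<in> sets borel}) \<subseteq> sets (P x)"
        by (subst sets_measure_of) (auto simp: sets_P[OF x])
    qed
    interpret finite_measure_subalgebra "P x" "past M X s" by unfold_locales (rule sub)
    interpret sigma_finite_subalgebra "P x" "past M X s"
      by (rule finite_measure_subalgebra_is_sigma_finite) unfold_locales
    have meas: "(\<lambda>\<omega>. measure (P (max (X s \<omega>) 0)) (X t -` A \<inter> space M)) \<in> borel_measurable (P x)"
    proof -
      have "(\<lambda>\<omega>. max (X s \<omega>) 0) \<in> measurable (P x) (restrict_space borel {0..})"
        by (intro measurable_restrict_space2) auto
      from measurable_compose[OF this measurable_kernel[OF t A]] show ?thesis .
    qed
    have max_eq: "max (X s \<omega>) 0 = X s \<omega>" if "\<omega> \<in> space (P x)" for \<omega>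
      using nonneg_X[OF s] that by (simp add: space_P[OF x])
    have int: "integrable (P x) (\<lambda>\<omega>. indicator A (X (s + t) \<omega>) :: real)"
      by (intro Px.integrable_const_bound[where B=1]) (auto simp: indicator_def)
    have le1: "measure (P (max y 0)) B \<le> 1" for y :: real and B
      using prob_space.prob_le_1[OF prob_space_P, of "max y 0" B] by simp
    have "emeasure (distr (P x) borel (X s) \<bind> \<kappa>) A = (\<integral>\<^sup>+y. emeasure (\<kappa> y) A \<partial>distr (P x) borel (X s))"
      using \<kappa> by (intro emeasure_bind[where N=borel]) auto
    also have "\<dots> = (\<integral>\<^sup>+\<omega>. emeasure (\<kappa> (X s \<omega>)) A \<partial>P x)"
      by (subst nn_integral_distr) (auto intro!: measurable_emeasure_kernel[OF \<kappa>])
    also have "\<dots> = ennreal (\<integral>\<omega>. measure (P (max (X s \<omega>) 0)) (X t -` A \<inter> space M) \<partial>P x)"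
      unfolding em\<kappa>[OF A] using meas le1
      by (intro nn_integral_eq_integral Px.integrable_const_bound[where B=1]) auto
    also have "(\<integral>\<omega>. measure (P (max (X s \<omega>) 0)) (X t -` A \<inter> space M) \<partial>P x)
        = (\<integral>\<omega>. real_cond_exp (P x) (past M X s) (\<lambda>\<omega>'. indicator A (X (s + t) \<omega>')) \<omega> \<partial>P x)"
    proof (rule integral_cong_AE)
      show "AE \<omega> in P x. measure (P (max (X s \<omega>) 0)) (X t -` A \<inter> space M)
          = real_cond_exp (P x) (past M X s) (\<lambda>\<omega>'. indicator A (X (s + t) \<omega>')) \<omega>"
        using markov[OF x s t A] AE_space by eventually_elim (simp add: max_eq)
    qed (use meas in auto)
    also have "\<dots> = (\<integral>\<omega>. indicator A (X (s + t) \<omega>) \<partial>P x)" by (rule real_cond_exp_int(2)[OF int])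
    also have "ennreal \<dots> = (\<integral>\<^sup>+\<omega>. indicator A (X (s + t) \<omega>) \<partial>P x)"
      using int by (subst nn_integral_eq_integral[symmetric]) (auto simp: ennreal_indicator)
    also have "\<dots> = emeasure (distr (P x) borel (X (s + t))) A"
    proof -
      have "emeasure (distr (P x) borel (X (s + t))) A
          = (\<integral>\<^sup>+y. indicator A y \<partial>distr (P x) borel (X (s + t)))" by simp
      also have "\<dots> = (\<integral>\<^sup>+\<omega>. indicator A (X (s + t) \<omega>) \<partial>P x)"
        by (subst nn_integral_distr) auto
      finally show ?thesis ..
    qed
    finally show "emeasure (distr (P x) borel (X (s + t))) A = emeasure (distr (P x) borel (X s) \<bind> \<kappa>) A" ..
  qed
  then have "(\<integral>\<^sup>+y. f y \<partial>distr (P x) borel (X (s + t))) = (\<integral>\<^sup>+y. f y \<partial>(distr (P x) borel (X s) \<bind> \<kappa>))"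
    by simp
  also have "\<dots> = (\<integral>\<^sup>+y. \<integral>\<^sup>+z. f z \<partial>\<kappa> y \<partial>distr (P x) borel (X s))"
    using f \<kappa> by (intro nn_integral_bind) auto
  also have "\<dots> = (\<integral>\<^sup>+\<omega>. \<integral>\<^sup>+z. f z \<partial>\<kappa> (X s \<omega>) \<partial>P x)"
    by (rule nn_integral_distr[OF Xs])
      (use measurable_compose[OF \<kappa> nn_integral_measurable_subprob_algebra[OF f]] in simp)
  also have "\<dots> = (\<integral>\<^sup>+\<omega>. \<integral>\<^sup>+\<omega>'. f (X t \<omega>') \<partial>P (X s \<omega>) \<partial>P x)"
  proof (rule nn_integral_cong)
    fix \<omega> assume "\<omega> \<in> space (P x)"
    then have "0 \<le> X s \<omega>" using nonneg_X[OF s] by (simp add: space_P[OF x])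
    then show "(\<integral>\<^sup>+z. f z \<partial>\<kappa> (X s \<omega>)) = (\<integral>\<^sup>+\<omega>'. f (X t \<omega>') \<partial>P (X s \<omega>))"
      unfolding \<kappa>_def using f t by (subst nn_integral_distr) (auto intro: measurable_X_P)
  qed
  also have "(\<integral>\<^sup>+y. f y \<partial>distr (P x) borel (X (s + t))) = (\<integral>\<^sup>+\<omega>. f (X (s + t) \<omega>) \<partial>P x)"
    using f by (subst nn_integral_distr) auto
  finally show ?thesis .
qed

end

locale affine_markov_process = nonneg_markov_process +
  fixes \<phi> \<psi> :: "real \<Rightarrow> real \<Rightarrow> real"
  assumes affine_exponents: "affine_exponents P X \<phi> \<psi>"
begin

lemma expectation_exp:
  assumes x: "0 \<le> x" and t: "0 \<le> t" and u: "0 \<le> u"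
  shows "integrable (P x) (\<lambda>\<omega>. exp (- u * X t \<omega>))"
    "(\<integral>\<omega>. exp (- u * X t \<omega>) \<partial>P x) = exp (- (\<phi> t u + x * \<psi> t u))"
    "0 \<le> \<phi> t u + x * \<psi> t u"
proof -
  interpret Px: prob_space "P x" by (rule prob_space_P[OF x])
  note [measurable] = measurable_X_P[OF x t]
  let ?L = "distr (P x) borel (X t)"
  have AE: "AE y in ?L. 0 \<le> y"
    using nonneg_X[OF t] by (subst AE_distr_iff) (auto simp: space_P[OF x])
  have L: "prob_space ?L" by (rule Px.prob_space_distr) measurable
  note pos = laplace_pos[OF L sets_distr AE u]
  show int: "integrable (P x) (\<lambda>\<omega>. exp (- u * X t \<omega>))"
    using pos(1) by (subst (asm) integrable_distr_eq) auto
  have E: "laplace ?L u = (\<integral>\<omega>. exp (- u * X t \<omega>) \<partial>P x)"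
    unfolding laplace_def by (subst integral_distr) auto
  have ln: "- ln (\<integral>\<omega>. exp (- u * X t \<omega>) \<partial>P x) = \<phi> t u + x * \<psi> t u"
    using affine_exponents x t u unfolding affine_exponents_def by blast
  then show "(\<integral>\<omega>. exp (- u * X t \<omega>) \<partial>P x) = exp (- (\<phi> t u + x * \<psi> t u))"
    using pos(2) unfolding E by (simp add: ln[symmetric])
  have "(\<integral>\<omega>. exp (- u * X t \<omega>) \<partial>P x) \<le> (\<integral>\<omega>. 1 \<partial>P x)"
    using int u nonneg_X[OF t] by (intro integral_mono) (auto simp: space_P[OF x])
  then show "0 \<le> \<phi> t u + x * \<psi> t u"
    using pos(2) unfolding E by (simp add: ln[symmetric] Px.prob_space)
qed

lemma \<phi>_nonneg: "0 \<le> t \<Longrightarrow> 0 \<le> u \<Longrightarrow> 0 \<le> \<phi> t u"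
  using expectation_exp(3)[of 0 t u] by simp

lemma \<psi>_nonneg:
  assumes "0 \<le> t" "0 \<le> u"
  shows "0 \<le> \<psi> t u"
proof (rule ccontr)
  assume neg: "\<not> 0 \<le> \<psi> t u"
  \<comment> \<open>At this starting point x the exponent \<open>\<phi> t u + x * \<psi> t u\<close>
    equals -1, although exponents are nonnegative.\<close>
  have "0 \<le> (\<phi> t u + 1) / - \<psi> t u"
    using \<phi>_nonneg[OF assms] neg by (intro divide_nonneg_pos) auto
  from expectation_exp(3)[OF this assms] show False using neg by (simp add: field_simps)
qed

lemma exponents_0:
  assumes u: "0 \<le> u"
  shows "\<phi> 0 u = 0" "\<psi> 0 u = u"
proof -
  have *: "\<phi> 0 u + x * \<psi> 0 u = u * x" if x: "0 \<le> x" for x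
  proof -
    interpret Px: prob_space "P x" by (rule prob_space_P[OF x])
    note [measurable] = measurable_X_P[OF x order_refl]
    have "(\<integral>\<omega>. exp (- u * X 0 \<omega>) \<partial>P x) = (\<integral>\<omega>. exp (- u * x) \<partial>P x)"
      using start[OF x] by (intro integral_cong_AE) auto
    then show ?thesis using expectation_exp(2)[OF x order_refl u] by (simp add: Px.prob_space)
  qed
  show "\<phi> 0 u = 0" "\<psi> 0 u = u" using *[of 0] *[of 1] by simp_all
qed

text \<open>Conditioning on time s turns the expectation of exp (- u X(s + t)) into exp (-
  \<open>\<phi> t u\<close>) times the expectation of exp (- v X(s)) with v =
  \<open>\<psi> t u\<close>. This v is nonnegative, so the affine formula applies once more, and
  both sides are affine in x; comparing them at x = 0 and x = 1 separates the exponents.\<close>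

lemma exponents_semigroup:
  assumes s: "0 \<le> s" and t: "0 \<le> t" and u: "0 \<le> u"
  shows "\<psi> (s + t) u = \<psi> s (\<psi> t u)" "\<phi> (s + t) u = \<phi> t u + \<phi> s (\<psi> t u)"
proof -
  have nn: "(\<integral>\<^sup>+\<omega>. ennreal (exp (- v * X r \<omega>)) \<partial>P x) = ennreal (exp (- (\<phi> r v + x * \<psi> r v)))"
    if "0 \<le> x" "0 \<le> r" "0 \<le> v" for x r v
    using expectation_exp(1,2)[OF that] by (subst nn_integral_eq_integral) auto
  have *: "\<phi> (s + t) u + x * \<psi> (s + t) u = \<phi> t u + \<phi> s (\<psi> t u) + x * \<psi> s (\<psi> t u)" if x: "0 \<le> x" for x
  proof -
    have "ennreal (exp (- (\<phi> (s + t) u + x * \<psi> (s + t) u)))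
        = (\<integral>\<^sup>+\<omega>. ennreal (exp (- u * X (s + t) \<omega>)) \<partial>P x)"
      using x s t u by (subst nn) auto
    also have "\<dots> = (\<integral>\<^sup>+\<omega>. \<integral>\<^sup>+\<omega>'. ennreal (exp (- u * X t \<omega>')) \<partial>P (X s \<omega>) \<partial>P x)"
      by (rule nn_integral_markov[OF x s t, where f="\<lambda>y. ennreal (exp (- u * y))"]) measurable
    also have "\<dots> = (\<integral>\<^sup>+\<omega>. ennreal (exp (- \<phi> t u)) * ennreal (exp (- \<psi> t u * X s \<omega>)) \<partial>P x)"
      using nonneg_X[OF s] t u
      by (intro nn_integral_cong, subst nn)
        (auto simp: space_P[OF x] ennreal_mult[symmetric] mult_exp_exp algebra_simps)
    also have "\<dots> = ennreal (exp (- \<phi> t u)) * ennreal (exp (- (\<phi> s (\<psi> t u) + x * \<psi> s (\<psi> t u))))"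
      using measurable_X_P[OF x s] nn[OF x s \<psi>_nonneg[OF t u]] by (subst nn_integral_cmult) auto
    also have "\<dots> = ennreal (exp (- (\<phi> t u + \<phi> s (\<psi> t u) + x * \<psi> s (\<psi> t u))))"
      by (simp add: ennreal_mult[symmetric] mult_exp_exp algebra_simps)
    finally show ?thesis by simp
  qed
  show "\<phi> (s + t) u = \<phi> t u + \<phi> s (\<psi> t u)" using *[of 0] by simp
  then show "\<psi> (s + t) u = \<psi> s (\<psi> t u)" using *[of 1] by simp
qed

text \<open>On [0, infinity) the function exp (- u y) is Lipschitz with constant u and takes values
  in [0,1]. The first fact controls the event that X s is close to X t, the second the event that it
  is not, whose probability is small by stochastic continuity.\<close>

lemma expectation_exp_continuous:
  assumes x: "0 \<le> x" and u: "0 \<le> u"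
  shows "continuous_on {0..} (\<lambda>t. \<integral>\<omega>. exp (- u * X t \<omega>) \<partial>P x)"
  unfolding continuous_on_def
proof
  fix t :: real assume "t \<in> {0..}"
  then have t: "0 \<le> t" by simp
  interpret Px: prob_space "P x" by (rule prob_space_P[OF x])
  define E where "E s = (\<integral>\<omega>. exp (- u * X s \<omega>) \<partial>P x)" for s
  have "(E \<longlongrightarrow> E t) (at t within {0..})"
  proof (rule tendstoI)
    fix e :: real assume e: "0 < e"
    define \<epsilon> where "\<epsilon> = e / (2 * (u + 1))"
    have \<epsilon>: "0 < \<epsilon>" "u * \<epsilon> < e / 2" using e u by (auto simp: \<epsilon>_def field_simps)
    have "eventually (\<lambda>s. measure (P x) {\<omega> \<in> space M. \<bar>X s \<omega> - X t \<omega>\<bar> > \<epsilon>} < e / 2) (at t within {0..})"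
      using stochastically_continuous[OF x t \<epsilon>(1)] e by (intro order_tendstoD) auto
    moreover have "eventually (\<lambda>s. s \<in> {0..}) (at t within {0..})"
      by (auto simp: eventually_at_filter)
    ultimately show "eventually (\<lambda>s. dist (E s) (E t) < e) (at t within {0..})"
    proof eventually_elim
      case (elim s)
      then have s: "0 \<le> s" by simp
      note [measurable] = measurable_X_P[OF x s] measurable_X_P[OF x t]
      define B where "B = {\<omega> \<in> space (P x). \<bar>X s \<omega> - X t \<omega>\<bar> > \<epsilon>}"
      have [measurable]: "B \<in> sets (P x)" unfolding B_def by measurable
      have mB: "measure (P x) B < e / 2" using elim(1) by (simp add: B_def space_P[OF x])
      have lip: "\<bar>exp (- u * a) - exp (- u * b)\<bar> \<le> u * \<bar>a - b\<bar>" if "0 \<le> a" "0 \<le> b" for a b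
      proof -
        have half: "exp (- u * a) - exp (- u * b) \<le> u * (b - a)" if "0 \<le> a" "a \<le> b" for a b
        proof -
          have "exp (- u * a) - exp (- u * b) = exp (- u * a) * (1 - exp (- u * (b - a)))"
            by (simp add: algebra_simps exp_add[symmetric])
          also have "\<dots> \<le> 1 * (1 - exp (- u * (b - a)))"
            using that u by (intro mult_right_mono) auto
          also have "\<dots> \<le> u * (b - a)" using exp_ge_add_one_self[of "- u * (b - a)"] by simp
          finally show ?thesis .
        qed
        show ?thesis
        proof (cases "a \<le> b")
          case True
          then have "exp (- u * b) \<le> exp (- u * a)" using u by (simp add: mult_left_mono)
          then show ?thesis using half[OF that(1) True] True by simp
        next
          case False
          then have "exp (- u * a) \<le> exp (- u * b)" using u by (simp add: mult_left_mono)
          then show ?thesis using half[of b a] that(2) False by simp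
        qed
      qed
      have "\<bar>E s - E t\<bar> = \<bar>\<integral>\<omega>. exp (- u * X s \<omega>) - exp (- u * X t \<omega>) \<partial>P x\<bar>"
        unfolding E_def using expectation_exp(1)[OF x s u] expectation_exp(1)[OF x t u] by simp
      also have "\<dots> \<le> (\<integral>\<omega>. \<bar>exp (- u * X s \<omega>) - exp (- u * X t \<omega>)\<bar> \<partial>P x)"
        using integral_norm_bound[of "P x" "\<lambda>\<omega>. exp (- u * X s \<omega>) - exp (- u * X t \<omega>)"] by simp
      also have "\<dots> \<le> (\<integral>\<omega>. u * \<epsilon> + indicator B \<omega> \<partial>P x)"
      proof (rule integral_mono)
        show "integrable (P x) (\<lambda>\<omega>. \<bar>exp (- u * X s \<omega>) - exp (- u * X t \<omega>)\<bar>)"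
          using expectation_exp(1)[OF x s u] expectation_exp(1)[OF x t u] by simp
        show "integrable (P x) (\<lambda>\<omega>. u * \<epsilon> + indicator B \<omega> :: real)"
          by (intro Bochner_Integration.integrable_add integrable_real_indicator Px.integrable_const)
            (simp_all add: less_top[symmetric])
        fix \<omega> assume \<omega>: "\<omega> \<in> space (P x)"
        then have nn: "0 \<le> X s \<omega>" "0 \<le> X t \<omega>" using nonneg_X s t by (auto simp: space_P[OF x])
        show "\<bar>exp (- u * X s \<omega>) - exp (- u * X t \<omega>)\<bar> \<le> u * \<epsilon> + indicator B \<omega>"
        proof (cases "\<omega> \<in> B")
          case True
          have "0 \<le> exp (- u * X s \<omega>)" "exp (- u * X s \<omega>) \<le> 1" "0 \<le> exp (- u * X t \<omega>)" "exp (- u * X t \<omega>) \<le> 1"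
            using nn u by auto
          then have "\<bar>exp (- u * X s \<omega>) - exp (- u * X t \<omega>)\<bar> \<le> 1" by linarith
          moreover have "0 \<le> u * \<epsilon>" using u \<epsilon>(1) by simp
          ultimately show ?thesis using True by simp
        next
          case False
          have "\<bar>exp (- u * X s \<omega>) - exp (- u * X t \<omega>)\<bar> \<le> u * \<bar>X s \<omega> - X t \<omega>\<bar>" by (rule lip[OF nn])
          also have "\<dots> \<le> u * \<epsilon>" using False \<omega> u by (intro mult_left_mono) (auto simp: B_def)
          finally show ?thesis using False by simp
        qed
      qed
      also have "\<dots> = u * \<epsilon> + measure (P x) B"
        by (subst Bochner_Integration.integral_add)
          (auto simp: Px.prob_space less_top[symmetric] Int_absorb2 sets.sets_into_space)
      finally show ?case using mB \<epsilon>(2) by (simp add: dist_real_def)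
    qed
  qed
  then show "((\<lambda>t. \<integral>\<omega>. exp (- u * X t \<omega>) \<partial>P x) \<longlongrightarrow> (\<integral>\<omega>. exp (- u * X t \<omega>) \<partial>P x)) (at t within {0..})"
    unfolding E_def .
qed

text \<open>Comparing the starting points 0 and 1 isolates \<psi>. Continuity is wanted because the
  semigroup property yields only right derivatives in t.\<close>

lemma \<psi>_continuous:
  assumes u: "0 \<le> u"
  shows "continuous_on {0..} (\<lambda>t. \<psi> t u)"
proof -
  let ?E = "\<lambda>x t. \<integral>\<omega>. exp (- u * X t \<omega>) \<partial>P x"
  have "continuous_on {0..} (\<lambda>t. ln (?E 0 t) - ln (?E 1 t))"
    using u by (intro continuous_intros expectation_exp_continuous ballI) (simp_all only: expectation_exp(2) atLeast_iff exp_not_eq_zero not_False_eq_True zero_le_one order_refl)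
  then show ?thesis
  proof (rule continuous_on_eq)
    fix t :: real assume "t \<in> {0..}"
    then show "ln (?E 0 t) - ln (?E 1 t) = \<psi> t u"
      using u by (subst (1 2) expectation_exp(2)) auto
  qed
qed

context
  fixes L assumes limit: "limit_distribution P X L"
begin

lemma limit_prob_space: "prob_space L" "sets L = sets borel" "AE x in L. 0 \<le> x"
proof -
  have rd: "real_distribution L" and neg: "emeasure L {..<0} = 0"
    using limit by (auto simp: limit_distribution_def)
  interpret real_distribution L by (rule rd)
  show "prob_space L" by unfold_locales
  show "sets L = sets borel" by simp
  show "AE x in L. 0 \<le> x" by (rule AE_I[OF _ neg]) auto
qed

text \<open>The limit law is the same for every starting point, so the part of the exponent that is
  proportional to x must vanish in the limit.\<close>

lemma exponents_tendsto:
  assumes u: "0 \<le> u" and \<tau>: "\<And>n. 0 \<le> \<tau> n" "filterlim \<tau> at_top sequentially"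
  shows "(\<lambda>n. \<phi> (\<tau> n) u) \<longlonglongrightarrow> - ln (laplace L u)" "(\<lambda>n. \<psi> (\<tau> n) u) \<longlonglongrightarrow> 0"
proof -
  have *: "(\<lambda>n. \<phi> (\<tau> n) u + x * \<psi> (\<tau> n) u) \<longlonglongrightarrow> - ln (laplace L u)" if x: "0 \<le> x" for x
  proof -
    \<comment> \<open>Weak convergence is tested with bounded continuous functions on the whole
      line; \<open>max y 0\<close> makes the exponential bounded and changes nothing on [0,
      infinity), where all the laws live.\<close>
    let ?f = "\<lambda>y. exp (- u * max y 0)"
    interpret Px: prob_space "P x" by (rule prob_space_P[OF x])
    have wc: "weak_conv_m (\<lambda>n. distr (P x) borel (X (\<tau> n))) L" and rd: "real_distribution L"
      using limit x \<tau> unfolding limit_distribution_def by blast+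
    have rdn: "real_distribution (distr (P x) borel (X (\<tau> n)))" for n
      by (intro Px.real_distribution_distr measurable_X_P x \<tau>)
    have "(\<lambda>n. \<integral>y. ?f y \<partial>distr (P x) borel (X (\<tau> n))) \<longlonglongrightarrow> (\<integral>y. ?f y \<partial>L)"
      by (rule weak_conv_imp_integral_bdd_continuous_conv[OF rdn rd wc, where B=1])
        (use u in \<open>auto intro!: continuous_intros\<close>)
    also have "(\<integral>y. ?f y \<partial>L) = laplace L u"
    proof -
      note [measurable_cong] = limit_prob_space(2)
      show ?thesis
        unfolding laplace_def
      proof (rule integral_cong_AE)
        show "AE y in L. ?f y = exp (- u * y)"
          using limit_prob_space(3) by eventually_elim simp
      qed measurable
    qed
    also have "(\<lambda>n. \<integral>y. ?f y \<partial>distr (P x) borel (X (\<tau> n)))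
        = (\<lambda>n. exp (- (\<phi> (\<tau> n) u + x * \<psi> (\<tau> n) u)))"
    proof
      fix n
      have "(\<integral>y. ?f y \<partial>distr (P x) borel (X (\<tau> n))) = (\<integral>\<omega>. ?f (X (\<tau> n) \<omega>) \<partial>P x)"
        by (rule integral_distr[OF measurable_X_P[OF x \<tau>(1)]]) measurable
      also have "\<dots> = (\<integral>\<omega>. exp (- u * X (\<tau> n) \<omega>) \<partial>P x)"
        using nonneg_X[OF \<tau>(1)]
        by (intro Bochner_Integration.integral_cong) (auto simp: space_P[OF x])
      finally show "(\<integral>y. ?f y \<partial>distr (P x) borel (X (\<tau> n))) = exp (- (\<phi> (\<tau> n) u + x * \<psi> (\<tau> n) u))"
        using expectation_exp(2)[OF x \<tau>(1) u] by simp
    qed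
    finally have "(\<lambda>n. - ln (exp (- (\<phi> (\<tau> n) u + x * \<psi> (\<tau> n) u)))) \<longlonglongrightarrow> - ln (laplace L u)"
      using laplace_pos(2)[OF limit_prob_space u] by (intro tendsto_intros) auto
    then show ?thesis by (simp only: ln_exp minus_minus)
  qed
  show \<phi>: "(\<lambda>n. \<phi> (\<tau> n) u) \<longlonglongrightarrow> - ln (laplace L u)" using *[of 0] by simp
  from tendsto_diff[OF *[of 1] this] show "(\<lambda>n. \<psi> (\<tau> n) u) \<longlonglongrightarrow> 0" by simp
qed

lemma limit_invariant:
  assumes s: "0 \<le> s" and u: "0 \<le> u"
  shows "\<phi> s u = ln (laplace L (\<psi> s u)) - ln (laplace L u)"
proof -
  have real_lim: "filterlim (\<lambda>n. real n + s) at_top sequentially"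
    using filterlim_tendsto_add_at_top[OF tendsto_const filterlim_real_sequentially, of s]
    by (simp add: add.commute)
  have "(\<lambda>n. \<phi> (real n + s) u) \<longlonglongrightarrow> - ln (laplace L u)"
    using s by (intro exponents_tendsto u real_lim) simp
  moreover have "(\<lambda>n. \<phi> s u + \<phi> (real n) (\<psi> s u)) \<longlonglongrightarrow> \<phi> s u + - ln (laplace L (\<psi> s u))"
    by (intro tendsto_intros exponents_tendsto \<psi>_nonneg s u filterlim_real_sequentially) simp
  ultimately have "- ln (laplace L u) = \<phi> s u + - ln (laplace L (\<psi> s u))"
    using exponents_semigroup(2)[OF _ s u] by (simp add: LIMSEQ_unique)
  then show ?thesis by simp
qed

text \<open>The equation is kept free of division by R, because at this point R may still have
  zeros.\<close>

lemma limit_characteristics_ode: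
  assumes u: "0 < u"
    and F: "((\<lambda>t. \<phi> t u) has_real_derivative F) (at 0 within {0..})"
    and R: "((\<lambda>t. \<psi> t u) has_real_derivative R) (at 0 within {0..})"
  shows "F * laplace L u = - R * (\<integral>x. x * exp (- u * x) \<partial>L)"
proof -
  note L = limit_prob_space
  let ?J = "\<integral>x. x * exp (- u * x) \<partial>L"
  have pos: "0 < laplace L u" using laplace_pos(2)[OF L] u by simp
  have "((\<lambda>v. ln (laplace L v)) has_real_derivative inverse (laplace L u) * - ?J) (at u)"
    using DERIV_chain2[OF DERIV_ln[OF pos] laplace_has_real_derivative(2)[OF L u]] .
  then have "((\<lambda>v. ln (laplace L v)) has_real_derivative inverse (laplace L u) * - ?J) (at (\<psi> 0 u))"
    using exponents_0(2) u by simp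
  from DERIV_chain2[OF this R]
  have "((\<lambda>s. ln (laplace L (\<psi> s u)) - ln (laplace L u)) has_real_derivative
      inverse (laplace L u) * - ?J * R - 0) (at 0 within {0..})"
    by (intro DERIV_diff DERIV_const)
  then have "((\<lambda>s. \<phi> s u) has_real_derivative inverse (laplace L u) * - ?J * R - 0) (at 0 within {0..})"
    by (rule has_field_derivative_transform_within[OF _ zero_less_one]) (use limit_invariant u in auto)
  with F have "F = inverse (laplace L u) * - ?J * R - 0"
    unfolding has_field_derivative_iff at_within_Ici_at_right
    by (intro tendsto_unique[OF trivial_limit_at_right_real])
  then show ?thesis using pos by (simp add: field_simps)
qed

text \<open>If R vanished on [0, infinity), the identity
  \<open>\<psi> (h + t) 1 = \<psi> h (\<psi> t 1)\<close> would carry the right derivative 0 from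
  time 0 to every time t. Then \<open>\<psi> t 1\<close> would stay at 1 and could not tend to
  0.\<close>

lemma limit_characteristic_nonzero:
  assumes R: "\<And>u. 0 \<le> u \<Longrightarrow> ((\<lambda>t. \<psi> t u) has_real_derivative R u) (at 0 within {0..})"
  shows "\<exists>u\<ge>0. R u \<noteq> 0"
proof (rule ccontr)
  assume "\<not> (\<exists>u\<ge>0. R u \<noteq> 0)"
  then have R0: "((\<lambda>t. \<psi> t u) has_real_derivative 0) (at_right 0)" if "0 \<le> u" for u
    using R[OF that] that by (auto intro: DERIV_subset)
  have "\<psi> t 1 = 1" if t: "0 \<le> t" for t
  proof -
    have "((\<lambda>t. \<psi> t 1) has_real_derivative 0) (at_right t)" if t: "0 \<le> t" for t
    proof -
      have "((\<lambda>h. (\<psi> h (\<psi> t 1) - \<psi> 0 (\<psi> t 1)) / (h - 0)) \<longlongrightarrow> 0) (at_right 0)"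
        using R0[OF \<psi>_nonneg[OF t, of 1]] by (simp add: has_field_derivative_iff)
      then have "((\<lambda>h. (\<psi> (h + t) 1 - \<psi> t 1) / (h + t - t)) \<longlongrightarrow> 0) (at_right 0)"
      proof (rule Lim_transform_eventually)
        show "\<forall>\<^sub>F h in at_right 0. (\<psi> h (\<psi> t 1) - \<psi> 0 (\<psi> t 1)) / (h - 0) = (\<psi> (h + t) 1 - \<psi> t 1) / (h + t - t)"
          using eventually_at_right_less[of 0]
          by eventually_elim
            (simp add: exponents_semigroup(1)[OF _ t] exponents_0(2)[OF \<psi>_nonneg[OF t]])
      qed
      then show ?thesis
        unfolding has_field_derivative_iff by (subst at_right_to_0) (simp add: filterlim_filtermap)
    qed
    from continuous_right_derivative_zero_imp_constant[OF \<psi>_continuous this t]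
    show ?thesis by (simp add: exponents_0(2))
  qed
  moreover have "(\<lambda>n. \<psi> (real n) 1) \<longlonglongrightarrow> 0"
    by (intro exponents_tendsto filterlim_real_sequentially) auto
  ultimately show False by (simp add: LIMSEQ_const_iff)
qed

end

end

section \<open>Scale functions\<close>

lemma scale_function_mono:
  assumes "scale_function R W"
  shows "mono W"
proof (rule monoI)
  fix x y :: real assume xy: "x \<le> y"
  have W: "\<And>x. 0 \<le> W x" "\<And>x. x < 0 \<Longrightarrow> W x = 0" "mono_on {0..} W"
    using assms by (auto simp: scale_function_def)
  show "W x \<le> W y"
    using W(1)[of y] W(2)[of x] mono_onD[OF W(3), of x y] xy by (cases "x < 0") auto
qed

lemma scale_function_borel_measurable:
  "scale_function R W \<Longrightarrow> W \<in> borel_measurable borel"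
  by (rule borel_measurable_mono[OF scale_function_mono])

lemma scale_function_laplace:
  assumes "scale_function R W" "0 < u"
  shows "integrable lborel (\<lambda>x. exp (- u * x) * W x)"
    "(\<integral>x. exp (- u * x) * W x \<partial>lborel) = - 1 / R u"
proof -
  have "(\<lambda>x. indicator {0..} x *\<^sub>R (exp (- u * x) * W x)) = (\<lambda>x. exp (- u * x) * W x)"
  proof
    show "indicator {0..} x *\<^sub>R (exp (- u * x) * W x) = exp (- u * x) * W x" for x
      using assms(1) by (cases "x < 0") (auto simp: scale_function_def)
  qed
  moreover have "set_integrable lborel {0..} (\<lambda>x. exp (- u * x) * W x)"
    "(LINT x:{0..}|lborel. exp (- u * x) * W x) = - 1 / R u"
    using assms by (auto simp: scale_function_def)
  ultimately show "integrable lborel (\<lambda>x. exp (- u * x) * W x)"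
    "(\<integral>x. exp (- u * x) * W x \<partial>lborel) = - 1 / R u"
    unfolding set_integrable_def set_lebesgue_integral_def by simp_all
qed

text \<open>An initial value theorem: substituting y = u x turns u times the transform of W into the
  integral of exp (- y) W(y / u). For u >= 1 monotonicity gives W(y / u) <= W(y), so exp (- y) W(y)
  dominates, and W(y / u) tends to W 0 for y >= 0 by right continuity at 0.\<close>

lemma scale_function_at_0:
  assumes W: "scale_function R W"
  shows "(\<lambda>n. - real (Suc n) / R (real (Suc n))) \<longlonglongrightarrow> W 0"
proof -
  have W_nonneg: "\<And>x. 0 \<le> W x" and W_cont: "continuous_on {0..} W" and W_neg: "\<And>x. x < 0 \<Longrightarrow> W x = 0"
    using W by (auto simp: scale_function_def)
  note mono = scale_function_mono[OF W] and [measurable] = scale_function_borel_measurable[OF W]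
  have eq: "- real (Suc n) / R (real (Suc n)) = (\<integral>y. exp (- y) * W (y / real (Suc n)) \<partial>lborel)" for n
  proof -
    let ?u = "real (Suc n)"
    have "(\<integral>x. exp (- ?u * x) * W x \<partial>lborel) = \<bar>1 / ?u\<bar> *\<^sub>R (\<integral>y. exp (- ?u * (0 + 1 / ?u * y)) * W (0 + 1 / ?u * y) \<partial>lborel)"
      by (rule lborel_integral_real_affine) simp
    then have "?u * (\<integral>x. exp (- ?u * x) * W x \<partial>lborel) = (\<integral>y. exp (- y) * W (y / ?u) \<partial>lborel)"
      by (simp del: of_nat_Suc)
    then show ?thesis using scale_function_laplace(2)[OF W, of ?u] by (simp del: of_nat_Suc)
  qed
  have "(\<lambda>n. \<integral>y. exp (- y) * W (y / real (Suc n)) \<partial>lborel) \<longlonglongrightarrow> (\<integral>y. exp (- y) * (W 0 * indicator {0..} y) \<partial>lborel)"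
  proof (rule integral_dominated_convergence[where w="\<lambda>y. exp (- 1 * y) * W y"])
    show "integrable lborel (\<lambda>y. exp (- 1 * y) * W y)" by (rule scale_function_laplace(1)[OF W]) simp
    show "AE y in lborel. (\<lambda>n. exp (- y) * W (y / real (Suc n))) \<longlonglongrightarrow> exp (- y) * (W 0 * indicator {0..} y)"
    proof (intro AE_I2 tendsto_mult tendsto_const)
      fix y :: real
      show "(\<lambda>n. W (y / real (Suc n))) \<longlonglongrightarrow> W 0 * indicator {0..} y"
      proof (cases "0 \<le> y")
        case True
        have "(\<lambda>n. y / real (Suc n)) \<longlonglongrightarrow> 0" by (rule LIMSEQ_Suc[OF lim_const_over_n])
        from continuous_on_tendsto_compose[OF W_cont this] True show ?thesis by simp
      next
        case False
        then have "W (y / real (Suc n)) = 0" for n by (intro W_neg divide_neg_pos) auto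
        then show ?thesis using False by simp
      qed
    qed
    fix n
    show "AE y in lborel. norm (exp (- y) * W (y / real (Suc n))) \<le> exp (- 1 * y) * W y"
    proof (intro AE_I2)
      fix y :: real
      have "W (y / real (Suc n)) \<le> W y"
      proof (cases "0 \<le> y")
        case True
        then have "y / real (Suc n) \<le> y" by (simp add: field_simps)
        then show ?thesis by (rule monoD[OF mono])
      next
        case False
        then have "W (y / real (Suc n)) = 0" by (intro W_neg divide_neg_pos) auto
        then show ?thesis using W_nonneg by simp
      qed
      then show "norm (exp (- y) * W (y / real (Suc n))) \<le> exp (- 1 * y) * W y"
        using W_nonneg by (simp add: abs_mult)
    qed
  qed measurable
  also have "(\<integral>y. exp (- y) * (W 0 * indicator {0..} y) \<partial>lborel) = W 0"
  proof -
    have "has_bochner_integral lborel (\<lambda>y. exp (- y) * indicator {0..} y) (1::real)"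
    proof (rule has_bochner_integral_nn_integral)
      have "(\<integral>\<^sup>+y. ennreal (exp (- y)) * indicator {0..} y \<partial>lborel) = ennreal (0 - (- exp (- 0)))"
      proof (rule nn_integral_FTC_atLeast)
        show "((\<lambda>y. - exp (- y)) has_real_derivative exp (- y)) (at y)" for y :: real
          by (auto intro!: derivative_eq_intros)
        show "((\<lambda>y::real. - exp (- y)) \<longlongrightarrow> 0) at_top"
          by (intro tendsto_minus_cancel_left[THEN iffD1])
            (auto intro!: filterlim_compose[OF exp_at_bot] filterlim_uminus_at_top[THEN iffD1] simp: filterlim_ident)
      qed auto
      then show "(\<integral>\<^sup>+y. ennreal (exp (- y) * indicator {0..} y) \<partial>lborel) = ennreal 1"
        by (simp add: ennreal_mult' ennreal_indicator)
    qed auto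
    then have "(\<integral>y. exp (- y) * indicator {0..} y \<partial>lborel) = (1::real)"
      by (rule has_bochner_integral_integral_eq)
    then show ?thesis by (simp add: mult.left_commute)
  qed
  finally show ?thesis unfolding eq .
qed

lemma scale_function_R_nonzero:
  assumes W: "scale_function R W" and ex: "0 < v" "R v \<noteq> 0" and u: "0 < u"
  shows "R u \<noteq> 0"
proof
  assume R: "R u = 0"
  have W_nonneg: "\<And>x. 0 \<le> W x" using W by (auto simp: scale_function_def)
  \<comment> \<open>Division by zero yields 0, so the identity for the transform forces it to vanish
    at u; as the integrand is nonnegative, W itself is zero almost everywhere.\<close>
  have "(\<integral>x. exp (- u * x) * W x \<partial>lborel) = 0" using scale_function_laplace(2)[OF W u] R by simp
  then have "AE x in lborel. exp (- u * x) * W x = 0"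
    using scale_function_laplace(1)[OF W u] W_nonneg
    by (subst (asm) integral_nonneg_eq_0_iff_AE) auto
  then have "AE x in lborel. exp (- v * x) * W x = 0" by eventually_elim simp
  then have "(\<integral>x. exp (- v * x) * W x \<partial>lborel) = 0" by (rule integral_eq_zero_AE)
  then show False using scale_function_laplace(2)[OF W ex(1)] ex(2) by simp
qed

section \<open>The effective drift as the limit of - R(u) / u\<close>

lemma exp_minus_minus_one_plus_bounds:
  fixes y :: real
  assumes "0 \<le> y"
  shows "0 \<le> exp (- y) - 1 + y" "exp (- y) - 1 + y \<le> y\<^sup>2" "exp (- y) - 1 + y \<le> y"
proof -
  show "0 \<le> exp (- y) - 1 + y" using exp_ge_add_one_self[of "- y"] by simp
  show "exp (- y) - 1 + y \<le> y" using assms by simp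
  have "exp (- y) \<le> 1 / (1 + y)"
    using exp_ge_add_one_self[of y] assms by (simp add: exp_minus inverse_eq_divide frac_le)
  also have "\<dots> \<le> 1 - y + y\<^sup>2"
    using assms by (simp add: field_simps power2_eq_square)
  finally show "exp (- y) - 1 + y \<le> y\<^sup>2" by simp
qed

text \<open>The integral in \<open>R_fun\<close> can be split at 1 because compensated small jumps
  are bounded by a multiple of \<xi> squared and the large jumps have finite mass. The large-jump
  part is bounded uniformly in u, so it disappears after division by u.\<close>

lemma R_fun_small_large_jumps:
  assumes \<mu>: "levy_measure \<mu>" and u: "0 < u"
  shows "integrable \<mu> (\<lambda>\<xi>. indicator {0<..1} \<xi> * (exp (- u * \<xi>) - 1 + u * \<xi>))"
    "integrable \<mu> (\<lambda>\<xi>. indicator {1<..} \<xi> * (exp (- u * \<xi>) - 1))"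
    "\<bar>\<integral>\<xi>. indicator {1<..} \<xi> * (exp (- u * \<xi>) - 1) \<partial>\<mu>\<bar> \<le> measure \<mu> {1<..}"
    "R_fun \<alpha> \<beta> \<mu> u = - \<alpha> * u\<^sup>2 + \<beta> * u
      - (\<integral>\<xi>. indicator {0<..1} \<xi> * (exp (- u * \<xi>) - 1 + u * \<xi>) \<partial>\<mu>)
      - (\<integral>\<xi>. indicator {1<..} \<xi> * (exp (- u * \<xi>) - 1) \<partial>\<mu>)"
proof -
  have [measurable_cong]: "sets \<mu> = sets borel"
    and fin: "(\<integral>\<^sup>+\<xi>\<in>{0<..}. ennreal (min (\<xi>\<^sup>2) 1) \<partial>\<mu>) < \<infinity>"
    using \<mu> by (auto simp: levy_measure_def)
  have int_min: "integrable \<mu> (\<lambda>\<xi>. indicator {0<..} \<xi> * min (\<xi>\<^sup>2) 1)"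
  proof (rule integrableI_nonneg)
    have "(\<integral>\<^sup>+\<xi>. ennreal (indicator {0<..} \<xi> * min (\<xi>\<^sup>2) 1) \<partial>\<mu>) = (\<integral>\<^sup>+\<xi>\<in>{0<..}. ennreal (min (\<xi>\<^sup>2) 1) \<partial>\<mu>)"
      by (intro nn_integral_cong) (auto split: split_indicator)
    then show "(\<integral>\<^sup>+\<xi>. ennreal (indicator {0<..} \<xi> * min (\<xi>\<^sup>2) 1) \<partial>\<mu>) < \<infinity>" using fin by simp
  qed auto
  have int_ind: "integrable \<mu> (\<lambda>\<xi>. indicator {1<..} \<xi> :: real)"
  proof (rule Bochner_Integration.integrable_bound[OF int_min])
    show "AE \<xi> in \<mu>. norm (indicator {1<..} \<xi> :: real) \<le> norm (indicator {0<..} \<xi> * min (\<xi>\<^sup>2) 1)"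
      by (intro AE_I2) (auto split: split_indicator simp: min_def)
  qed auto
  show i1: "integrable \<mu> (\<lambda>\<xi>. indicator {0<..1} \<xi> * (exp (- u * \<xi>) - 1 + u * \<xi>))"
  proof (rule Bochner_Integration.integrable_bound)
    show "integrable \<mu> (\<lambda>\<xi>. u\<^sup>2 * (indicator {0<..} \<xi> * min (\<xi>\<^sup>2) 1))" using int_min by simp
    show "AE \<xi> in \<mu>. norm (indicator {0<..1} \<xi> * (exp (- u * \<xi>) - 1 + u * \<xi>))
        \<le> norm (u\<^sup>2 * (indicator {0<..} \<xi> * min (\<xi>\<^sup>2) 1))"
    proof (intro AE_I2)
      fix \<xi> :: real
      show "norm (indicator {0<..1} \<xi> * (exp (- u * \<xi>) - 1 + u * \<xi>))
          \<le> norm (u\<^sup>2 * (indicator {0<..} \<xi> * min (\<xi>\<^sup>2) 1))"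
      proof (cases "\<xi> \<in> {0<..1}")
        case True
        then have "\<xi>\<^sup>2 \<le> 1" by (simp add: power_le_one)
        then show ?thesis
          using True exp_minus_minus_one_plus_bounds[of "u * \<xi>"] u
          by (simp add: power_mult_distrib abs_of_nonneg)
      qed simp
    qed
  qed auto
  show i2: "integrable \<mu> (\<lambda>\<xi>. indicator {1<..} \<xi> * (exp (- u * \<xi>) - 1))"
  proof (rule Bochner_Integration.integrable_bound[OF int_ind])
    show "AE \<xi> in \<mu>. norm (indicator {1<..} \<xi> * (exp (- u * \<xi>) - 1)) \<le> norm (indicator {1<..} \<xi> :: real)"
      using u by (intro AE_I2) (auto split: split_indicator simp: abs_le_iff)
  qed auto
  have "\<bar>\<integral>\<xi>. indicator {1<..} \<xi> * (exp (- u * \<xi>) - 1) \<partial>\<mu>\<bar>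
      \<le> (\<integral>\<xi>. \<bar>indicator {1<..} \<xi> * (exp (- u * \<xi>) - 1)\<bar> \<partial>\<mu>)"
    using integral_norm_bound[of \<mu> "\<lambda>\<xi>. indicator {1<..} \<xi> * (exp (- u * \<xi>) - 1)"] by simp
  also have "\<dots> \<le> (\<integral>\<xi>. indicator {1<..} \<xi> \<partial>\<mu>)"
    using i2 int_ind u by (intro integral_mono) (auto split: split_indicator simp: abs_le_iff)
  also have "\<dots> = measure \<mu> {1<..}" by simp
  finally show "\<bar>\<integral>\<xi>. indicator {1<..} \<xi> * (exp (- u * \<xi>) - 1) \<partial>\<mu>\<bar> \<le> measure \<mu> {1<..}" .
  have "(LINT \<xi>:{0<..}|\<mu>. exp (- u * \<xi>) - 1 + u * \<xi> * indicator {0<..1} \<xi>)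
      = (\<integral>\<xi>. indicator {0<..1} \<xi> * (exp (- u * \<xi>) - 1 + u * \<xi>) + indicator {1<..} \<xi> * (exp (- u * \<xi>) - 1) \<partial>\<mu>)"
    unfolding set_lebesgue_integral_def
    by (intro Bochner_Integration.integral_cong) (auto split: split_indicator)
  also have "\<dots> = (\<integral>\<xi>. indicator {0<..1} \<xi> * (exp (- u * \<xi>) - 1 + u * \<xi>) \<partial>\<mu>)
      + (\<integral>\<xi>. indicator {1<..} \<xi> * (exp (- u * \<xi>) - 1) \<partial>\<mu>)"
    by (rule Bochner_Integration.integral_add[OF i1 i2])
  finally show "R_fun \<alpha> \<beta> \<mu> u = - \<alpha> * u\<^sup>2 + \<beta> * u
      - (\<integral>\<xi>. indicator {0<..1} \<xi> * (exp (- u * \<xi>) - 1 + u * \<xi>) \<partial>\<mu>)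
      - (\<integral>\<xi>. indicator {1<..} \<xi> * (exp (- u * \<xi>) - 1) \<partial>\<mu>)"
    unfolding R_fun_def by simp
qed

text \<open>By \<open>scale_function_at_0\<close>, W 0 is the limit of - u / R(u), so the matter is
  the limit of - R(u) / u. With bounded variation, dominated convergence gives the effective drift.
  Otherwise a nonzero W 0 would keep - R(u) / u bounded: then \<alpha> u is bounded, which forces
  \<alpha> = 0, and Fatou makes the integral of \<xi> over (0,1] finite, a contradiction.\<close>

lemma scale_function_0_effective_drift:
  assumes \<alpha>: "0 \<le> \<alpha>" and \<mu>: "levy_measure \<mu>" and W: "scale_function (R_fun \<alpha> \<beta> \<mu>) W"
    and R: "\<And>u. 0 < u \<Longrightarrow> R_fun \<alpha> \<beta> \<mu> u \<noteq> 0"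
  shows "real_of_ereal (ereal b / effective_drift \<alpha> \<beta> \<mu>) = b * W 0"
proof -
  have [measurable_cong]: "sets \<mu> = sets borel" using \<mu> by (auto simp: levy_measure_def)
  define u where "u n = real (Suc n)" for n
  have u: "0 < u n" for n by (simp add: u_def)
  have u_lim: "filterlim u at_top sequentially"
    unfolding u_def by (rule filterlim_compose[OF filterlim_real_sequentially filterlim_Suc])
  define h where "h n \<xi> = indicator {0<..1} \<xi> * (exp (- u n * \<xi>) - 1 + u n * \<xi>) / u n" for n and \<xi> :: real
  define a where "a n = (\<integral>\<xi>. h n \<xi> \<partial>\<mu>)" for n
  define d where "d n = (\<integral>\<xi>. indicator {1<..} \<xi> * (exp (- u n * \<xi>) - 1) \<partial>\<mu>) / u n" for n
  have h_int: "integrable \<mu> (h n)" for n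
    using R_fun_small_large_jumps(1)[OF \<mu> u] unfolding h_def by (intro integrable_divide) auto
  have h_nonneg: "0 \<le> h n \<xi>" and h_le: "h n \<xi> \<le> indicator {0<..1} \<xi> * \<xi>" for n \<xi>
    using exp_minus_minus_one_plus_bounds[of "u n * \<xi>"] u[of n]
    by (auto simp: h_def field_simps split: split_indicator)
  have h_lim: "(\<lambda>n. h n \<xi>) \<longlonglongrightarrow> indicator {0<..1} \<xi> * \<xi>" for \<xi>
  proof (cases "\<xi> \<in> {0<..1}")
    case True
    have "(\<lambda>n. \<xi> - (1 - exp (- u n * \<xi>)) / u n) \<longlonglongrightarrow> \<xi> - 0"
    proof (intro tendsto_diff tendsto_const)
      show "(\<lambda>n. (1 - exp (- u n * \<xi>)) / u n) \<longlonglongrightarrow> 0"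
      proof (rule Lim_null_comparison)
        show "\<forall>\<^sub>F n in sequentially. norm ((1 - exp (- u n * \<xi>)) / u n) \<le> 1 / u n"
          using True u by (intro always_eventually allI)
            (simp add: abs_of_pos divide_right_mono less_imp_le)
        show "(\<lambda>n. 1 / u n) \<longlonglongrightarrow> 0"
          by (intro tendsto_divide_0[OF tendsto_const] filterlim_at_top_imp_at_infinity u_lim)
      qed
    qed
    moreover have "h n \<xi> = \<xi> - (1 - exp (- u n * \<xi>)) / u n" for n
      using True u[of n] by (simp add: h_def field_simps)
    ultimately show ?thesis using True by simp
  qed (auto simp: h_def)
  have d_lim: "d \<longlonglongrightarrow> 0"
  proof (rule Lim_null_comparison)
    show "\<forall>\<^sub>F n in sequentially. norm (d n) \<le> measure \<mu> {1<..} / u n"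
    proof (intro always_eventually allI)
      show "norm (d n) \<le> measure \<mu> {1<..} / u n" for n
        using R_fun_small_large_jumps(3)[OF \<mu> u[of n]] u[of n]
        by (simp add: d_def divide_right_mono)
    qed
    show "(\<lambda>n. measure \<mu> {1<..} / u n) \<longlonglongrightarrow> 0"
      by (intro tendsto_divide_0[OF tendsto_const] filterlim_at_top_imp_at_infinity u_lim)
  qed
  have R_eq: "- R_fun \<alpha> \<beta> \<mu> (u n) / u n = \<alpha> * u n - \<beta> + a n + d n" for n
  proof -
    have "(\<integral>\<xi>. indicator {0<..1} \<xi> * (exp (- u n * \<xi>) - 1 + u n * \<xi>) \<partial>\<mu>) = a n * u n"
      using u[of n] unfolding a_def h_def by simp
    then show ?thesis
      unfolding R_fun_small_large_jumps(4)[OF \<mu> u[of n]] d_def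
      using u[of n] by (simp add: field_simps power2_eq_square)
  qed
  have lim0: "(\<lambda>n. - u n / R_fun \<alpha> \<beta> \<mu> (u n)) \<longlonglongrightarrow> W 0"
    using scale_function_at_0[OF W] by (simp add: u_def)
  let ?bv = "\<alpha> = 0 \<and> (\<integral>\<^sup>+\<xi>\<in>{0<..1}. ennreal \<xi> \<partial>\<mu>) < \<infinity>"
  show ?thesis
  proof (cases ?bv)
    case True
    have int: "integrable \<mu> (\<lambda>\<xi>. indicator {0<..1} \<xi> * \<xi>)"
    proof (rule integrableI_nonneg)
      have "(\<integral>\<^sup>+\<xi>. ennreal (indicator {0<..1} \<xi> * \<xi>) \<partial>\<mu>) = (\<integral>\<^sup>+\<xi>\<in>{0<..1}. ennreal \<xi> \<partial>\<mu>)"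
        by (intro nn_integral_cong) (auto split: split_indicator)
      then show "(\<integral>\<^sup>+\<xi>. ennreal (indicator {0<..1} \<xi> * \<xi>) \<partial>\<mu>) < \<infinity>" using True by simp
    qed (auto split: split_indicator)
    define lam where "lam = (LINT \<xi>:{0<..1}|\<mu>. \<xi>) - \<beta>"
    have "a \<longlonglongrightarrow> (\<integral>\<xi>. indicator {0<..1} \<xi> * \<xi> \<partial>\<mu>)"
      unfolding a_def
    proof (rule integral_dominated_convergence[OF _ _ int])
      show "AE \<xi> in \<mu>. norm (h n \<xi>) \<le> indicator {0<..1} \<xi> * \<xi>" for n
        using h_nonneg h_le by simp
    qed (use h_lim h_int in auto)
    then have "(\<lambda>n. 0 - \<beta> + a n + d n) \<longlonglongrightarrow> 0 - \<beta> + (\<integral>\<xi>. indicator {0<..1} \<xi> * \<xi> \<partial>\<mu>) + 0"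
      by (intro tendsto_intros d_lim)
    then have "(\<lambda>n. - R_fun \<alpha> \<beta> \<mu> (u n) / u n) \<longlonglongrightarrow> lam"
      unfolding R_eq using True by (simp add: lam_def set_lebesgue_integral_def)
    \<comment> \<open>The product of the two sequences is constantly 1. This also shows that the
      drift is nonzero, so that b divided by it is meaningful.\<close>
    from tendsto_mult[OF lim0 this]
    have "(\<lambda>n. 1) \<longlonglongrightarrow> W 0 * lam" using u R by (simp add: less_imp_neq[symmetric])
    then have "W 0 * lam = 1" by (simp add: LIMSEQ_const_iff)
    then have "lam \<noteq> 0" "W 0 = 1 / lam" by (auto simp: eq_divide_eq)
    moreover have "effective_drift \<alpha> \<beta> \<mu> = ereal lam"
      using True by (simp add: effective_drift_def lam_def)
    ultimately show ?thesis by simp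
  next
    case False
    have "W 0 = 0"
    proof (rule ccontr)
      assume W0: "W 0 \<noteq> 0"
      then have "(\<lambda>n. inverse (- u n / R_fun \<alpha> \<beta> \<mu> (u n))) \<longlonglongrightarrow> inverse (W 0)"
        by (intro tendsto_inverse lim0)
      then have "(\<lambda>n. \<alpha> * u n - \<beta> + a n + d n) \<longlonglongrightarrow> inverse (W 0)"
        unfolding R_eq[symmetric] by (simp add: field_simps)
      from tendsto_diff[OF this d_lim]
      have "(\<lambda>n. \<alpha> * u n - \<beta> + a n) \<longlonglongrightarrow> inverse (W 0)" by simp
      from tendsto_add[OF this tendsto_const[of \<beta>]]
      have lim: "(\<lambda>n. \<alpha> * u n + a n) \<longlonglongrightarrow> inverse (W 0) + \<beta>" by simp
      then obtain B where B: "\<And>n. \<alpha> * u n + a n \<le> B"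
        using convergent_imp_Bseq[OF convergentI[OF lim]] by (auto simp: Bseq_def abs_le_iff)
      have a_nonneg: "0 \<le> a n" for n unfolding a_def using h_nonneg by simp
      have "\<alpha> = 0"
      proof (rule ccontr)
        assume "\<alpha> \<noteq> 0"
        obtain n where "B / \<alpha> \<le> real n" using real_arch_simple by blast
        then have "B / \<alpha> < u n" by (simp add: u_def)
        then have "B < \<alpha> * u n" using \<alpha> \<open>\<alpha> \<noteq> 0\<close> by (simp add: field_simps)
        then show False using B[of n] a_nonneg[of n] by simp
      qed
      moreover have "(\<integral>\<^sup>+\<xi>\<in>{0<..1}. ennreal \<xi> \<partial>\<mu>) < \<infinity>"
      proof -
        have "(\<integral>\<^sup>+\<xi>\<in>{0<..1}. ennreal \<xi> \<partial>\<mu>) = (\<integral>\<^sup>+\<xi>. liminf (\<lambda>n. ennreal (h n \<xi>)) \<partial>\<mu>)"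
        proof (rule nn_integral_cong)
          fix \<xi> :: real
          have "liminf (\<lambda>n. ennreal (h n \<xi>)) = ennreal (indicator {0<..1} \<xi> * \<xi>)"
            by (intro lim_imp_Liminf tendsto_ennrealI h_lim) simp
          then show "ennreal \<xi> * indicator {0<..1} \<xi> = liminf (\<lambda>n. ennreal (h n \<xi>))"
            by (auto split: split_indicator)
        qed
        also have "\<dots> \<le> liminf (\<lambda>n. \<integral>\<^sup>+\<xi>. ennreal (h n \<xi>) \<partial>\<mu>)"
          using h_int by (intro nn_integral_liminf) auto
        also have "\<dots> \<le> liminf (\<lambda>n. ennreal B)"
        proof (intro Liminf_mono always_eventually allI)
          fix n
          have "(\<integral>\<^sup>+\<xi>. ennreal (h n \<xi>) \<partial>\<mu>) = ennreal (a n)"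
            unfolding a_def using h_int h_nonneg by (intro nn_integral_eq_integral) auto
          also have "\<dots> \<le> ennreal B" using B[of n] \<open>\<alpha> = 0\<close> by (intro ennreal_leI) simp
          finally show "(\<integral>\<^sup>+\<xi>. ennreal (h n \<xi>) \<partial>\<mu>) \<le> ennreal B" .
        qed
        also have "\<dots> < \<infinity>" by (simp add: Liminf_const)
        finally show ?thesis .
      qed
      ultimately show False using False by blast
    qed
    moreover have "effective_drift \<alpha> \<beta> \<mu> = \<infinity>"
      using False by (auto simp: effective_drift_def)
    ultimately show ?thesis by simp
  qed
qed

lemma nn_integral_exp_atLeast:
  fixes u y :: real
  assumes u: "0 < u"
  shows "(\<integral>\<^sup>+x. ennreal (u * exp (- u * x)) * indicator {y..} x \<partial>lborel) = ennreal (exp (- u * y))"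
proof -
  have "(\<integral>\<^sup>+x. ennreal (u * exp (- u * x)) * indicator {y..} x \<partial>lborel) = ennreal (0 - (- exp (- u * y)))"
  proof (rule nn_integral_FTC_atLeast)
    show "((\<lambda>x. - exp (- u * x)) has_real_derivative u * exp (- u * x)) (at x)" for x :: real
      by (auto intro!: derivative_eq_intros)
    show "((\<lambda>x. - exp (- u * x)) \<longlongrightarrow> 0) at_top"
      using u by real_asymp
  qed (use u in auto)
  then show ?thesis by simp
qed

section \<open>Laplace transforms of dW and of the increments of W\<close>

locale scale_function_right_derivative =
  fixes R W W' :: "real \<Rightarrow> real"
  assumes W: "scale_function R W"
    and W': "\<And>x. x > 0 \<Longrightarrow> (W has_real_derivative W' x) (at_right x)"
begin

lemmas W_mono = scale_function_mono[OF W]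
lemmas W_measurable[measurable] = scale_function_borel_measurable[OF W]
lemmas W_integrable = scale_function_laplace(1)[OF W]

definition w :: "real \<Rightarrow> real" where
  "w u = (\<integral>x. exp (- u * x) * W x \<partial>lborel)"

lemma W_nonneg: "0 \<le> W x" and W_neg: "x < 0 \<Longrightarrow> W x = 0"
  and W_cont: "continuous_on {0..} W"
  using W by (auto simp: scale_function_def)

lemma w_nonneg: "0 \<le> w u"
  unfolding w_def by (simp add: W_nonneg)

lemma w_eq: "0 < u \<Longrightarrow> w u = - 1 / R u"
  unfolding w_def by (rule scale_function_laplace(2)[OF W])

lemma nn_integral_W: "0 < u \<Longrightarrow> (\<integral>\<^sup>+x. ennreal (exp (- u * x) * W x) \<partial>lborel) = ennreal (w u)"
  unfolding w_def using W_integrable W_nonneg by (intro nn_integral_eq_integral) auto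

text \<open>The fundamental theorem above wants a monotone continuous function on the whole line
  with a right derivative everywhere. Freezing W at the value W a to the left of a > 0 produces one,
  and stays clear of 0, where W may jump or have no right derivative.\<close>

lemma truncated:
  assumes a: "0 < a"
  shows "(\<lambda>x. if a \<le> x then W' x else 0) \<in> borel_measurable borel"
    "0 \<le> (if a \<le> x then W' x else 0)"
    "a \<le> x \<Longrightarrow> (\<integral>\<^sup>+y. ennreal (if a \<le> y then W' y else 0) * indicator {a<..x} y \<partial>lborel) = ennreal (W x - W a)"
proof -
  let ?G = "\<lambda>x. W (max a x)" and ?D = "\<lambda>x. if a \<le> x then W' x else 0"
  have G: "mono ?G" by (intro monoI monoD[OF W_mono]) auto
  have cont: "continuous_on UNIV ?G"
    by (rule continuous_on_compose2[OF W_cont]) (use a in \<open>auto intro!: continuous_intros\<close>)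
  have der: "(?G has_real_derivative ?D x) (at_right x)" for x
  proof (cases "a \<le> x")
    case True
    then have "(W has_real_derivative W' x) (at_right x)" using a by (intro W') auto
    then have "((\<lambda>y. (?G y - ?G x) / (y - x)) \<longlongrightarrow> W' x) (at_right x)"
      unfolding has_field_derivative_iff
    proof (rule Lim_transform_eventually)
      show "\<forall>\<^sub>F y in at_right x. (W y - W x) / (y - x) = (?G y - ?G x) / (y - x)"
        using eventually_at_right_less[of x] by eventually_elim (use True in \<open>simp add: max_absorb2\<close>)
    qed
    then show ?thesis using True by (simp add: has_field_derivative_iff)
  next
    case False
    have "((\<lambda>_. W a) has_real_derivative 0) (at x)" by simp
    then have "(?G has_real_derivative 0) (at x)"
      by (rule has_field_derivative_transform_within_open[of _ _ _ "{..<a}"]) (use False in auto)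
    then show ?thesis using False by (auto intro: has_field_derivative_at_within)
  qed
  show "?D \<in> borel_measurable borel" "0 \<le> ?D x"
    by (rule mono_right_derivative_borel_measurable[OF G der])+
  assume "a \<le> x"
  then show "(\<integral>\<^sup>+y. ennreal (?D y) * indicator {a<..x} y \<partial>lborel) = ennreal (W x - W a)"
    using nn_integral_right_derivative_mono[OF G cont der, of a x] by simp
qed

text \<open>This is the density of the Stieltjes measure dW on (0, infinity); the jump W 0 at the
  origin is accounted for separately. Nothing is known about \<open>W'\<close> outside (0,
  infinity), hence the value 0 there.\<close>

definition V :: "real \<Rightarrow> real" where
  "V x = (if 0 < x then W' x else 0)"

lemma V_nonneg: "0 \<le> V x"
  using truncated(2)[of x x] by (simp add: V_def)

lemma V_measurable[measurable]: "V \<in> borel_measurable borel"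
proof (rule borel_measurable_LIMSEQ_real)
  show "(\<lambda>x. if 1 / real (Suc n) \<le> x then W' x else 0) \<in> borel_measurable borel" for n
    by (rule truncated(1)) simp
  fix x :: real
  show "(\<lambda>n. if 1 / real (Suc n) \<le> x then W' x else 0) \<longlonglongrightarrow> V x"
  proof (cases "0 < x")
    case True
    obtain N where N: "1 / real (Suc N) < x" using reals_Archimedean[OF True] by (auto simp: inverse_eq_divide)
    have "1 / real (Suc n) \<le> x" if "n \<ge> N" for n
    proof -
      have "1 / real (Suc n) \<le> 1 / real (Suc N)" using that by (intro frac_le) auto
      then show ?thesis using N by simp
    qed
    then have "\<forall>\<^sub>F n in sequentially. (if 1 / real (Suc n) \<le> x then W' x else 0) = V x"
      using True by (auto simp: eventually_sequentially V_def simp del: of_nat_Suc)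
    then show ?thesis by (rule tendsto_eventually)
  next
    case False
    then have "\<not> 1 / real (Suc n) \<le> x" for n
      using False by (intro notI) (drule order.strict_trans2[rotated, of _ _ 0], simp_all)
    then show ?thesis using False by (simp add: V_def del: of_nat_Suc)
  qed
qed

text \<open>Let the truncation point decrease to 0: the integrals increase by monotone convergence,
  and W at the truncation point tends to W 0 by right continuity.\<close>

lemma W_eq_nn_integral:
  assumes x: "0 \<le> x"
  shows "ennreal (W x) = ennreal (W 0) + (\<integral>\<^sup>+y. ennreal (V y) * indicator {..x} y \<partial>lborel)"
proof (cases "x = 0")
  case True
  have "(\<integral>\<^sup>+y. ennreal (V y) * indicator {..x} y \<partial>lborel) = (\<integral>\<^sup>+y. 0 \<partial>(lborel :: real measure))"
    using True by (intro nn_integral_cong) (auto simp: V_def split: split_indicator)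
  then show ?thesis using True by simp
next
  case False
  with x have x: "0 < x" by simp
  define a where "a n = x / real (Suc n)" for n
  have a: "0 < a n" "a n \<le> x" for n using x by (auto simp: a_def field_simps)
  have a_lim: "a \<longlonglongrightarrow> 0" unfolding a_def by (rule LIMSEQ_Suc[OF lim_const_over_n])
  have a_dec: "a n \<le> a k" if "k \<le> n" for k n
    unfolding a_def using x that by (intro frac_le) auto
  have "(\<integral>\<^sup>+y. ennreal (V y) * indicator {..x} y \<partial>lborel) = (\<integral>\<^sup>+y. (SUP n. ennreal (V y) * indicator {a n<..x} y) \<partial>lborel)"
  proof (rule nn_integral_cong)
    fix y :: real
    show "ennreal (V y) * indicator {..x} y = (SUP n. ennreal (V y) * indicator {a n<..x} y)"
    proof (cases "0 < y \<and> y \<le> x")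
      case True
      then obtain n where n: "a n < y"
        using order_tendstoD(2)[OF a_lim, of y] by (auto simp: eventually_sequentially)
      show ?thesis
      proof (rule antisym)
        show "ennreal (V y) * indicator {..x} y \<le> (SUP n. ennreal (V y) * indicator {a n<..x} y)"
          by (rule SUP_upper2[of n]) (use n True in auto)
      qed (auto intro!: SUP_least split: split_indicator)
    next
      case False
      have "ennreal (V y) * indicator {a n<..x} y = 0" for n
        using False a(1)[of n] by (auto split: split_indicator)
      moreover have "ennreal (V y) * indicator {..x} y = 0"
        using False by (auto simp: V_def split: split_indicator)
      ultimately show ?thesis by (simp only: SUP_const UNIV_not_empty not_False_eq_True)
    qed
  qed
  also have "\<dots> = (SUP n. \<integral>\<^sup>+y. ennreal (V y) * indicator {a n<..x} y \<partial>lborel)"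
  proof (rule nn_integral_monotone_convergence_SUP)
    show "incseq (\<lambda>n y. ennreal (V y) * indicator {a n<..x} y)"
    proof (intro incseq_SucI le_funI)
      fix n y
      have "a (Suc n) \<le> a n" by (rule a_dec) simp
      then show "ennreal (V y) * indicator {a n<..x} y \<le> ennreal (V y) * indicator {a (Suc n)<..x} y"
        by (auto split: split_indicator)
    qed
  qed measurable
  also have "\<dots> = (SUP n. ennreal (W x - W (a n)))"
  proof (intro SUP_cong refl)
    fix n
    have "(\<integral>\<^sup>+y. ennreal (V y) * indicator {a n<..x} y \<partial>lborel)
        = (\<integral>\<^sup>+y. ennreal (if a n \<le> y then W' y else 0) * indicator {a n<..x} y \<partial>lborel)"
      using a(1)[of n] by (intro nn_integral_cong) (auto simp: V_def split: split_indicator)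
    also have "\<dots> = ennreal (W x - W (a n))" by (rule truncated(3)[OF a])
    finally show "(\<integral>\<^sup>+y. ennreal (V y) * indicator {a n<..x} y \<partial>lborel) = ennreal (W x - W (a n))" .
  qed
  also have "\<dots> = ennreal (W x - W 0)"
  proof (rule LIMSEQ_unique[OF LIMSEQ_SUP])
    show "incseq (\<lambda>n. ennreal (W x - W (a n)))"
      by (intro incseq_SucI ennreal_leI diff_left_mono monoD[OF W_mono] a_dec) simp
    have "(\<lambda>n. W (a n)) \<longlonglongrightarrow> W 0"
      by (rule continuous_on_tendsto_compose[OF W_cont a_lim])
        (use a(1) in \<open>auto intro!: always_eventually less_imp_le\<close>)
    then show "(\<lambda>n. ennreal (W x - W (a n))) \<longlonglongrightarrow> ennreal (W x - W 0)"
      by (intro tendsto_ennrealI tendsto_intros)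
  qed
  finally show ?thesis
    using W_nonneg monoD[OF W_mono, of 0 x] x by (simp add: ennreal_plus[symmetric] del: ennreal_plus)
qed

text \<open>Write exp (- u y) as the integral of u exp (- u x) over x >= y and exchange the order of
  integration. The right-hand side is thus the transform of dW, the atom at 0 contributing W
  0.\<close>

lemma laplace_V:
  assumes u: "0 < u"
  shows "ennreal (u * w u) = ennreal (W 0) + (\<integral>\<^sup>+x. ennreal (exp (- u * x) * V x) \<partial>lborel)"
proof -
  have [measurable]: "Measurable.pred (borel \<Otimes>\<^sub>M borel) (\<lambda>z :: real \<times> real. fst z \<in> {snd z..})"
    "Measurable.pred (borel \<Otimes>\<^sub>M borel) (\<lambda>z :: real \<times> real. snd z \<in> {fst z..})"
    unfolding atLeast_iff by measurable
  have "ennreal (u * w u) = (\<integral>\<^sup>+x. ennreal u * ennreal (exp (- u * x) * W x) \<partial>lborel)"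
    using u by (subst nn_integral_cmult, measurable) (simp only: nn_integral_W ennreal_mult w_nonneg less_imp_le)
  also have "\<dots> = (\<integral>\<^sup>+x. ennreal (u * exp (- u * x)) * indicator {0..} x * ennreal (W 0)
      + (\<integral>\<^sup>+y. ennreal (u * exp (- u * x)) * (ennreal (V y) * indicator {y..} x) \<partial>lborel) \<partial>lborel)"
  proof (rule nn_integral_cong)
    fix x :: real
    have "(\<integral>\<^sup>+y. ennreal (u * exp (- u * x)) * (ennreal (V y) * indicator {y..} x) \<partial>lborel)
       = ennreal (u * exp (- u * x)) * (\<integral>\<^sup>+y. ennreal (V y) * indicator {..x} y \<partial>lborel)"
      by (subst nn_integral_cmult[symmetric])
        (auto intro!: nn_integral_cong split: split_indicator)
    moreover have "(\<integral>\<^sup>+y. ennreal (V y) * indicator {..x} y \<partial>lborel) = 0" if "x < 0"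
    proof -
      have "(\<integral>\<^sup>+y. ennreal (V y) * indicator {..x} y \<partial>lborel) = (\<integral>\<^sup>+y. 0 \<partial>(lborel :: real measure))"
        using that by (intro nn_integral_cong) (auto simp: V_def split: split_indicator)
      then show ?thesis by simp
    qed
    ultimately show "ennreal u * ennreal (exp (- u * x) * W x) = ennreal (u * exp (- u * x)) * indicator {0..} x * ennreal (W 0)
      + (\<integral>\<^sup>+y. ennreal (u * exp (- u * x)) * (ennreal (V y) * indicator {y..} x) \<partial>lborel)"
      using u W_eq_nn_integral[of x] W_neg[of x]
      by (cases "0 \<le> x") (auto simp: ennreal_mult W_nonneg distrib_left mult.assoc)
  qed
  also have "\<dots> = (\<integral>\<^sup>+x. ennreal (u * exp (- u * x)) * indicator {0..} x * ennreal (W 0) \<partial>lborel)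
      + (\<integral>\<^sup>+x. \<integral>\<^sup>+y. ennreal (u * exp (- u * x)) * (ennreal (V y) * indicator {y..} x) \<partial>lborel \<partial>lborel)"
    by (intro nn_integral_add) measurable
  also have "(\<integral>\<^sup>+x. ennreal (u * exp (- u * x)) * indicator {0..} x * ennreal (W 0) \<partial>lborel) = ennreal (W 0)"
    using nn_integral_exp_atLeast[OF u, of 0] by (subst nn_integral_multc) auto
  also have "(\<integral>\<^sup>+x. \<integral>\<^sup>+y. ennreal (u * exp (- u * x)) * (ennreal (V y) * indicator {y..} x) \<partial>lborel \<partial>lborel)
      = (\<integral>\<^sup>+y. \<integral>\<^sup>+x. ennreal (u * exp (- u * x)) * (ennreal (V y) * indicator {y..} x) \<partial>lborel \<partial>lborel)"
    by (rule lborel_pair.Fubini') measurable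
  also have "\<dots> = (\<integral>\<^sup>+y. ennreal (exp (- u * y) * V y) \<partial>lborel)"
  proof (rule nn_integral_cong)
    fix y :: real
    have "(\<integral>\<^sup>+x. ennreal (u * exp (- u * x)) * (ennreal (V y) * indicator {y..} x) \<partial>lborel)
        = (\<integral>\<^sup>+x. ennreal (V y) * (ennreal (u * exp (- u * x)) * indicator {y..} x) \<partial>lborel)"
      by (intro nn_integral_cong) (simp add: mult_ac)
    also have "\<dots> = ennreal (V y) * ennreal (exp (- u * y))"
      by (subst nn_integral_cmult, measurable) (simp only: nn_integral_exp_atLeast[OF u])
    finally show "(\<integral>\<^sup>+x. ennreal (u * exp (- u * x)) * (ennreal (V y) * indicator {y..} x) \<partial>lborel) = ennreal (exp (- u * y) * V y)"
      by (simp add: ennreal_mult' V_nonneg mult.commute)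
  qed
  finally show ?thesis .
qed

text \<open>A shift by \<xi> multiplies the transform by exp (- u \<xi>). The shifted term is added
  to both sides and cancelled, which is legitimate because it is finite.\<close>

lemma laplace_increment:
  assumes u: "0 < u" and \<xi>: "0 \<le> \<xi>"
  shows "ennreal ((1 - exp (- u * \<xi>)) * w u) = (\<integral>\<^sup>+x. ennreal (exp (- u * x)) * ennreal (W x - W (x - \<xi>)) \<partial>lborel)"
proof -
  have inc: "0 \<le> W x - W (x - \<xi>)" for x using monoD[OF W_mono, of "x - \<xi>" x] \<xi> by simp
  have "(\<integral>\<^sup>+x. ennreal (exp (- u * x) * W (x - \<xi>)) \<partial>lborel)
      = (\<integral>\<^sup>+x. ennreal (exp (- u * \<xi>)) * ennreal (exp (- u * x) * W x) \<partial>lborel)"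
    by (subst nn_integral_real_affine[where t="\<xi>" and c=1])
      (auto intro!: nn_integral_cong simp: ennreal_mult'[symmetric] mult_exp_exp algebra_simps mult.assoc[symmetric])
  also have "\<dots> = ennreal (exp (- u * \<xi>) * w u)"
    by (subst nn_integral_cmult, measurable) (simp only: nn_integral_W[OF u] ennreal_mult w_nonneg exp_ge_zero)
  finally have shift: "(\<integral>\<^sup>+x. ennreal (exp (- u * x) * W (x - \<xi>)) \<partial>lborel) = ennreal (exp (- u * \<xi>) * w u)" .
  have "ennreal (w u) = (\<integral>\<^sup>+x. ennreal (exp (- u * x)) * ennreal (W x - W (x - \<xi>)) + ennreal (exp (- u * x) * W (x - \<xi>)) \<partial>lborel)"
    unfolding nn_integral_W[OF u, symmetric]
    by (intro nn_integral_cong)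
      (use inc W_nonneg in \<open>auto simp: ennreal_mult[symmetric] ennreal_plus[symmetric] algebra_simps simp del: ennreal_plus\<close>)
  also have "\<dots> = (\<integral>\<^sup>+x. ennreal (exp (- u * x)) * ennreal (W x - W (x - \<xi>)) \<partial>lborel) + ennreal (exp (- u * \<xi>) * w u)"
    by (subst nn_integral_add, measurable) (simp only: shift)
  finally have eq: "ennreal (w u) = (\<integral>\<^sup>+x. ennreal (exp (- u * x)) * ennreal (W x - W (x - \<xi>)) \<partial>lborel) + ennreal (exp (- u * \<xi>) * w u)" .
  have "exp (- u * \<xi>) * w u \<le> 1 * w u" using u \<xi> w_nonneg by (intro mult_right_mono) auto
  then have "ennreal (w u) = ennreal ((1 - exp (- u * \<xi>)) * w u) + ennreal (exp (- u * \<xi>) * w u)"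
    using w_nonneg[of u] by (simp add: ennreal_plus[symmetric] algebra_simps del: ennreal_plus)
  then show ?thesis using eq by (simp add: add.commute[of _ "ennreal (exp (- u * \<xi>) * w u)"] ennreal_add_left_cancel)
qed

end

text \<open>Wanted for Tonelli with respect to m and Lebesgue measure. On (1/(n + 1), infinity) the
  integrand min (\<xi> squared) 1 is at least 1/(n + 1) squared, so these sets have finite mass, and
  the remaining half-line is a null set.\<close>

lemma levy_measure_sigma_finite:
  assumes m: "levy_measure m"
  shows "sigma_finite_measure m"
proof
  have [measurable_cong]: "sets m = sets borel" and null: "emeasure m {..0} = 0"
    and fin: "(\<integral>\<^sup>+\<xi>\<in>{0<..}. ennreal (min (\<xi>\<^sup>2) 1) \<partial>m) < \<infinity>"
    using m by (auto simp: levy_measure_def)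
  define A where "A n = {1 / real (Suc n)<..}" for n
  have A_fin: "emeasure m (A n) \<noteq> \<infinity>" for n
  proof -
    define e where "e = (1 / real (Suc n))\<^sup>2"
    have e: "0 < e" "e \<le> 1" by (auto simp: e_def power_le_one)
    have "ennreal e * emeasure m (A n) = (\<integral>\<^sup>+\<xi>. ennreal e * indicator (A n) \<xi> \<partial>m)"
      by (subst nn_integral_cmult_indicator) (auto simp: A_def)
    also have "\<dots> \<le> (\<integral>\<^sup>+\<xi>\<in>{0<..}. ennreal (min (\<xi>\<^sup>2) 1) \<partial>m)"
    proof (rule nn_integral_mono)
      fix \<xi> :: real
      show "ennreal e * indicator (A n) \<xi> \<le> ennreal (min (\<xi>\<^sup>2) 1) * indicator {0<..} \<xi>"
      proof (cases "\<xi> \<in> A n")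
        case True
        then have gt: "1 / real (Suc n) < \<xi>" by (simp add: A_def)
        then have "0 < \<xi>" by (rule order.strict_trans[rotated]) simp
        moreover have "e \<le> \<xi>\<^sup>2" unfolding e_def using gt by (intro power_mono) auto
        ultimately show ?thesis using True e by (auto intro!: ennreal_leI)
      qed simp
    qed
    also have "\<dots> < \<infinity>" by (rule fin)
    finally show ?thesis using e by (auto simp: ennreal_mult_eq_top_iff)
  qed
  show "\<exists>A. countable A \<and> A \<subseteq> sets m \<and> \<Union> A = space m \<and> (\<forall>a\<in>A. emeasure m a \<noteq> \<infinity>)"
  proof (intro exI[of _ "insert {..0} (range A)"] conjI)
    show "insert {..0} (range A) \<subseteq> sets m" by (auto simp: A_def)
    have "x \<in> {..0} \<or> (\<exists>n. x \<in> A n)" for x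
      using reals_Archimedean[of x] by (cases "0 < x") (auto simp: A_def inverse_eq_divide)
    then show "\<Union> (insert {..0} (range A)) = space m"
      using sets_eq_imp_space_eq[OF \<open>sets m = sets borel\<close>] by auto
  qed (use A_fin null in auto)
qed


section \<open>The density K behind - F / R\<close>

locale scale_function_immigration = scale_function_right_derivative +
  fixes b :: real and m :: "real measure"
  assumes b: "0 \<le> b" and m: "levy_measure m"
    and m_fin: "(\<integral>\<^sup>+\<xi>\<in>{0<..}. ennreal (min \<xi> 1) \<partial>m) < \<infinity>"
begin

lemma sets_m[measurable_cong]: "sets m = sets borel"
  using m by (simp add: levy_measure_def)

sublocale m: sigma_finite_measure m
  by (rule levy_measure_sigma_finite[OF m])

lemma F_fun_eq:
  assumes u: "0 < u"
  obtains J where "0 \<le> J" "F_fun b m u = b * u + J"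
    "(\<integral>\<^sup>+\<xi>\<in>{0<..}. ennreal (1 - exp (- u * \<xi>)) \<partial>m) = ennreal J"
proof
  define J where "J = (\<integral>\<xi>. indicator {0<..} \<xi> * (1 - exp (- u * \<xi>)) \<partial>m)"
  have nonneg: "0 \<le> indicator {0<..} \<xi> * (1 - exp (- u * \<xi>))" for \<xi> :: real
    using u by (auto split: split_indicator)
  have int_min: "integrable m (\<lambda>\<xi>. indicator {0<..} \<xi> * min \<xi> 1)"
  proof (rule integrableI_nonneg)
    have "(\<integral>\<^sup>+\<xi>. ennreal (indicator {0<..} \<xi> * min \<xi> 1) \<partial>m) = (\<integral>\<^sup>+\<xi>\<in>{0<..}. ennreal (min \<xi> 1) \<partial>m)"
      by (intro nn_integral_cong) (auto split: split_indicator)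
    then show "(\<integral>\<^sup>+\<xi>. ennreal (indicator {0<..} \<xi> * min \<xi> 1) \<partial>m) < \<infinity>" using m_fin by simp
  qed (auto split: split_indicator)
  have int: "integrable m (\<lambda>\<xi>. indicator {0<..} \<xi> * (1 - exp (- u * \<xi>)))"
  proof (rule Bochner_Integration.integrable_bound)
    \<comment> \<open>The factor u + 1 serves both ranges: 1 - exp (- u \<xi>) is at most u \<xi>,
      which counts for \<xi> <= 1, and at most 1, which counts for larger \<xi>.\<close>
    show "integrable m (\<lambda>\<xi>. (u + 1) * (indicator {0<..} \<xi> * min \<xi> 1))" using int_min by simp
    show "AE \<xi> in m. norm (indicator {0<..} \<xi> * (1 - exp (- u * \<xi>))) \<le> norm ((u + 1) * (indicator {0<..} \<xi> * min \<xi> 1))"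
    proof (intro AE_I2)
      fix \<xi> :: real
      show "norm (indicator {0<..} \<xi> * (1 - exp (- u * \<xi>))) \<le> norm ((u + 1) * (indicator {0<..} \<xi> * min \<xi> 1))"
      proof (cases "0 < \<xi>")
        case True
        have "1 - exp (- u * \<xi>) \<le> u * \<xi>" using exp_ge_add_one_self[of "- u * \<xi>"] by simp
        also have "\<dots> \<le> (u + 1) * \<xi>" using True by (simp add: algebra_simps)
        finally have "1 - exp (- u * \<xi>) \<le> (u + 1) * \<xi>" .
        moreover have "1 - exp (- u * \<xi>) \<le> 1" by simp
        then have "1 - exp (- u * \<xi>) \<le> u + 1" by (rule order_trans) (use u in simp)
        ultimately have "1 - exp (- u * \<xi>) \<le> (u + 1) * min \<xi> 1" by (simp add: min_def)
        then show ?thesis using True u by (simp add: abs_of_nonneg)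
      qed simp
    qed
  qed auto
  show "0 \<le> J" unfolding J_def by (intro Bochner_Integration.integral_nonneg nonneg)
  have "(LINT \<xi>:{0<..}|m. exp (- u * \<xi>) - 1) = (\<integral>\<xi>. - (indicator {0<..} \<xi> * (1 - exp (- u * \<xi>))) \<partial>m)"
    unfolding set_lebesgue_integral_def
    by (intro Bochner_Integration.integral_cong) (auto split: split_indicator)
  also have "\<dots> = - J" unfolding J_def by (rule Bochner_Integration.integral_minus)
  finally show "F_fun b m u = b * u + J" by (simp add: F_fun_def)
  have "(\<integral>\<^sup>+\<xi>\<in>{0<..}. ennreal (1 - exp (- u * \<xi>)) \<partial>m) = (\<integral>\<^sup>+\<xi>. ennreal (indicator {0<..} \<xi> * (1 - exp (- u * \<xi>))) \<partial>m)"
    by (intro nn_integral_cong) (auto split: split_indicator)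
  also have "\<dots> = ennreal J"
    unfolding J_def using int nonneg by (intro nn_integral_eq_integral) auto
  finally show "(\<integral>\<^sup>+\<xi>\<in>{0<..}. ennreal (1 - exp (- u * \<xi>)) \<partial>m) = ennreal J" .
qed

text \<open>The function k with values in \<open>ennreal\<close>: a divergent inner integral counts
  as infinity instead of the default value 0 of the Bochner integral, as Tonelli requires. The
  indicator confines K to (0, infinity), so that its convolution with a law on [0, infinity) lives
  there as well.\<close>

definition K :: "real \<Rightarrow> ennreal" where
  "K x = ennreal (b * V x) + indicator {0<..} x * (\<integral>\<^sup>+\<xi>\<in>{0<..}. ennreal (W x - W (x - \<xi>)) \<partial>m)"

lemma K_measurable[measurable]: "K \<in> borel_measurable borel"
  unfolding K_def by measurable

lemma K_nonpos: "x \<le> 0 \<Longrightarrow> K x = 0"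
  by (simp add: K_def V_def)

text \<open>Since w u = - 1 / R u, the left side is - F / R. The drift part b u of F goes through
  \<open>laplace_V\<close>; the jump part goes through \<open>laplace_increment\<close>, integrated
  over m.\<close>

lemma laplace_K:
  assumes u: "0 < u"
  shows "ennreal (F_fun b m u * w u) = ennreal (b * W 0) + (\<integral>\<^sup>+x. ennreal (exp (- u * x)) * K x \<partial>lborel)"
proof -
  interpret pair_sigma_finite lborel m ..
  obtain J where J: "0 \<le> J" "F_fun b m u = b * u + J"
    "(\<integral>\<^sup>+\<xi>\<in>{0<..}. ennreal (1 - exp (- u * \<xi>)) \<partial>m) = ennreal J"
    using F_fun_eq[OF u] by metis
  have drift: "ennreal (b * (u * w u)) = ennreal (b * W 0) + (\<integral>\<^sup>+x. ennreal (exp (- u * x)) * ennreal (b * V x) \<partial>lborel)"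
  proof -
    have "ennreal (b * (u * w u)) = ennreal b * ennreal (u * w u)"
      using b u w_nonneg by (intro ennreal_mult) auto
    also have "\<dots> = ennreal b * ennreal (W 0) + ennreal b * (\<integral>\<^sup>+x. ennreal (exp (- u * x) * V x) \<partial>lborel)"
      unfolding laplace_V[OF u] by (rule distrib_left)
    also have "ennreal b * (\<integral>\<^sup>+x. ennreal (exp (- u * x) * V x) \<partial>lborel)
        = (\<integral>\<^sup>+x. ennreal b * ennreal (exp (- u * x) * V x) \<partial>lborel)"
      by (rule nn_integral_cmult[symmetric]) measurable
    also have "\<dots> = (\<integral>\<^sup>+x. ennreal (exp (- u * x)) * ennreal (b * V x) \<partial>lborel)"
      using b V_nonneg by (intro nn_integral_cong) (simp add: ennreal_mult mult_ac)
    finally show ?thesis using b W_nonneg by (simp add: ennreal_mult)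
  qed
  have jumps: "ennreal (J * w u) = (\<integral>\<^sup>+x. ennreal (exp (- u * x)) *
      (indicator {0<..} x * (\<integral>\<^sup>+\<xi>\<in>{0<..}. ennreal (W x - W (x - \<xi>)) \<partial>m)) \<partial>lborel)"
  proof -
    have "ennreal (J * w u) = (\<integral>\<^sup>+\<xi>\<in>{0<..}. ennreal (1 - exp (- u * \<xi>)) \<partial>m) * ennreal (w u)"
      using J w_nonneg by (simp add: ennreal_mult)
    also have "\<dots> = (\<integral>\<^sup>+\<xi>. ennreal (1 - exp (- u * \<xi>)) * indicator {0<..} \<xi> * ennreal (w u) \<partial>m)"
      by (rule nn_integral_multc[symmetric]) measurable
    also have "\<dots> = (\<integral>\<^sup>+\<xi>. \<integral>\<^sup>+x. indicator {0<..} \<xi> * (ennreal (exp (- u * x)) * ennreal (W x - W (x - \<xi>))) \<partial>lborel \<partial>m)"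
    proof (rule nn_integral_cong)
      fix \<xi> :: real
      have "(\<integral>\<^sup>+x. indicator {0<..} \<xi> * (ennreal (exp (- u * x)) * ennreal (W x - W (x - \<xi>))) \<partial>lborel)
          = indicator {0<..} \<xi> * (\<integral>\<^sup>+x. ennreal (exp (- u * x)) * ennreal (W x - W (x - \<xi>)) \<partial>lborel)"
        by (rule nn_integral_cmult) measurable
      moreover have "ennreal ((1 - exp (- u * \<xi>)) * w u) = ennreal (1 - exp (- u * \<xi>)) * ennreal (w u)"
        if "0 < \<xi>" using u that w_nonneg by (intro ennreal_mult) auto
      ultimately show "ennreal (1 - exp (- u * \<xi>)) * indicator {0<..} \<xi> * ennreal (w u)
          = (\<integral>\<^sup>+x. indicator {0<..} \<xi> * (ennreal (exp (- u * x)) * ennreal (W x - W (x - \<xi>))) \<partial>lborel)"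
        using laplace_increment[OF u, of \<xi>] by (cases "0 < \<xi>") (simp_all add: less_imp_le)
    qed
    also have "\<dots> = (\<integral>\<^sup>+x. \<integral>\<^sup>+\<xi>. indicator {0<..} \<xi> * (ennreal (exp (- u * x)) * ennreal (W x - W (x - \<xi>))) \<partial>m \<partial>lborel)"
      by (rule Fubini') measurable
    also have "\<dots> = (\<integral>\<^sup>+x. ennreal (exp (- u * x)) *
        (indicator {0<..} x * (\<integral>\<^sup>+\<xi>\<in>{0<..}. ennreal (W x - W (x - \<xi>)) \<partial>m)) \<partial>lborel)"
    proof (rule nn_integral_cong_AE)
      \<comment> \<open>At x = 0 the inner integral is W 0 times the mass of m and need not vanish,
        whereas the indicator gives 0; for x < 0 both sides vanish because W does.\<close>
      have "AE x in lborel. x \<noteq> (0::real)" by (rule AE_lborel_singleton)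
      then show "AE x in lborel. (\<integral>\<^sup>+\<xi>. indicator {0<..} \<xi> * (ennreal (exp (- u * x)) * ennreal (W x - W (x - \<xi>))) \<partial>m)
          = ennreal (exp (- u * x)) * (indicator {0<..} x * (\<integral>\<^sup>+\<xi>\<in>{0<..}. ennreal (W x - W (x - \<xi>)) \<partial>m))"
      proof eventually_elim
        case (elim x)
        have "(\<integral>\<^sup>+\<xi>. indicator {0<..} \<xi> * (ennreal (exp (- u * x)) * ennreal (W x - W (x - \<xi>))) \<partial>m)
            = (\<integral>\<^sup>+\<xi>. ennreal (exp (- u * x)) * (ennreal (W x - W (x - \<xi>)) * indicator {0<..} \<xi>) \<partial>m)"
          by (intro nn_integral_cong) (simp add: mult_ac)
        also have "\<dots> = ennreal (exp (- u * x)) * (\<integral>\<^sup>+\<xi>\<in>{0<..}. ennreal (W x - W (x - \<xi>)) \<partial>m)"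
          by (rule nn_integral_cmult) measurable
        also have "(\<integral>\<^sup>+\<xi>\<in>{0<..}. ennreal (W x - W (x - \<xi>)) \<partial>m)
            = indicator {0<..} x * (\<integral>\<^sup>+\<xi>\<in>{0<..}. ennreal (W x - W (x - \<xi>)) \<partial>m)"
        proof (cases "0 < x")
          case False
          then have "x < 0" using elim by simp
          then have "(\<integral>\<^sup>+\<xi>\<in>{0<..}. ennreal (W x - W (x - \<xi>)) \<partial>m) = (\<integral>\<^sup>+\<xi>. 0 \<partial>m)"
            by (intro nn_integral_cong) (auto simp: W_neg split: split_indicator)
          then show ?thesis using False by simp
        qed simp
        finally show ?case .
      qed
    qed
    finally show ?thesis .
  qed
  have "F_fun b m u * w u = b * (u * w u) + J * w u" unfolding J(2) by (simp add: algebra_simps)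
  then have "ennreal (F_fun b m u * w u) = ennreal (b * (u * w u)) + ennreal (J * w u)"
    using b u w_nonneg J(1) by (simp add: ennreal_plus)
  also have "\<dots> = ennreal (b * W 0) + ((\<integral>\<^sup>+x. ennreal (exp (- u * x)) * ennreal (b * V x) \<partial>lborel)
      + (\<integral>\<^sup>+x. ennreal (exp (- u * x)) *
      (indicator {0<..} x * (\<integral>\<^sup>+\<xi>\<in>{0<..}. ennreal (W x - W (x - \<xi>)) \<partial>m)) \<partial>lborel))"
    unfolding drift jumps by (rule add.assoc)
  also have "(\<integral>\<^sup>+x. ennreal (exp (- u * x)) * ennreal (b * V x) \<partial>lborel)
      + (\<integral>\<^sup>+x. ennreal (exp (- u * x)) *
      (indicator {0<..} x * (\<integral>\<^sup>+\<xi>\<in>{0<..}. ennreal (W x - W (x - \<xi>)) \<partial>m)) \<partial>lborel)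
      = (\<integral>\<^sup>+x. ennreal (exp (- u * x)) * K x \<partial>lborel)"
    unfolding K_def distrib_left by (rule nn_integral_add[symmetric]) measurable
  finally show ?thesis .
qed

text \<open>
  The Bochner integral in \<^const>\<open>k_fun\<close> has the value \<open>0\<close> where it diverges, so the identity can fail there.
\<close>

lemma k_fun_eq_K: "AE x in lborel. 0 < x \<longrightarrow> ennreal (k_fun b m W W' x) = K x"
proof -
  \<comment> \<open>Finiteness of the transform at the single point 1 makes K finite almost
    everywhere.\<close>
  have "(\<integral>\<^sup>+x. ennreal (exp (- 1 * x)) * K x \<partial>lborel) \<le> ennreal (F_fun b m 1 * w 1)"
    unfolding laplace_K[OF zero_less_one] by simp
  also have "\<dots> < \<infinity>" by simp
  finally have "AE x in lborel. ennreal (exp (- 1 * x)) * K x \<noteq> \<infinity>"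
    by (intro nn_integral_noteq_infinite) auto
  then show ?thesis
  proof eventually_elim
    case (elim x)
    show ?case
    proof
      assume x: "0 < x"
      let ?I = "\<integral>\<^sup>+\<xi>\<in>{0<..}. ennreal (W x - W (x - \<xi>)) \<partial>m"
      have fin: "?I < \<infinity>" using elim x by (auto simp: K_def ennreal_mult_eq_top_iff less_top)
      have "(LINT \<xi>:{0<..}|m. W x - W (x - \<xi>)) = enn2real (\<integral>\<^sup>+\<xi>. ennreal (indicator {0<..} \<xi> *\<^sub>R (W x - W (x - \<xi>))) \<partial>m)"
        unfolding set_lebesgue_integral_def
        by (rule integral_eq_nn_integral) (auto split: split_indicator intro!: monoD[OF W_mono])
      also have "(\<integral>\<^sup>+\<xi>. ennreal (indicator {0<..} \<xi> *\<^sub>R (W x - W (x - \<xi>))) \<partial>m) = ?I"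
        by (intro nn_integral_cong) (auto split: split_indicator)
      finally have "k_fun b m W W' x = b * V x + enn2real ?I"
        using x by (simp add: k_fun_def V_def)
      then show "ennreal (k_fun b m W W' x) = K x"
        using x b V_nonneg fin by (simp add: K_def ennreal_plus)
    qed
  qed
qed

end

section \<open>The convolution equation and the atom\<close>

text \<open>
  In terms of measures the equation below reads \<open>x L(dx) = c L(dx) + (K(x) dx * L)(dx)\<close>.
\<close>

locale laplace_equation =
  fixes L :: "real measure" and c :: real and K :: "real \<Rightarrow> ennreal"
  assumes L: "prob_space L" "sets L = sets borel" "AE x in L. 0 \<le> x"
    and c: "0 \<le> c"
    and K[measurable]: "K \<in> borel_measurable borel" and K_nonpos: "\<And>x. x \<le> 0 \<Longrightarrow> K x = 0"
    and equation: "\<And>u. 0 < u \<Longrightarrow> ennreal ((\<integral>x. x * exp (- u * x) \<partial>L) / laplace L u)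
      = ennreal c + (\<integral>\<^sup>+x. ennreal (exp (- u * x)) * K x \<partial>lborel)"
begin

sublocale prob_space L by (rule L(1))

lemmas [measurable_cong] = L(2)

definition \<kappa> :: "real \<Rightarrow> real" where
  "\<kappa> u = (\<integral>x. x * exp (- u * x) \<partial>L) / laplace L u - c"

text \<open>The Laplace exponent of L translated by -c, that is - ln of the integral of exp (- u (x
  - c)) with respect to L.\<close>

definition h :: "real \<Rightarrow> real" where
  "h u = - ln (laplace L u) - c * u"

lemma laplace_positive: "0 \<le> u \<Longrightarrow> 0 < laplace L u"
  by (rule laplace_pos(2)[OF L])

lemma \<kappa>:
  assumes u: "0 < u"
  shows "0 \<le> \<kappa> u" "ennreal (\<kappa> u) = (\<integral>\<^sup>+x. ennreal (exp (- u * x)) * K x \<partial>lborel)"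
proof -
  have "0 \<le> (\<integral>x. x * exp (- u * x) \<partial>L)"
    using L(3) by (intro integral_nonneg_AE) auto
  \<comment> \<open>An inequality in \<open>ennreal\<close> can be read back in the reals only if
    the larger side is nonnegative, as negative numbers are mapped to 0.\<close>
  then have nonneg: "0 \<le> (\<integral>x. x * exp (- u * x) \<partial>L) / laplace L u"
    using laplace_positive[of u] u by (intro divide_nonneg_pos) auto
  have "ennreal c \<le> ennreal ((\<integral>x. x * exp (- u * x) \<partial>L) / laplace L u)"
    unfolding equation[OF u] by simp
  then show \<kappa>: "0 \<le> \<kappa> u" using nonneg by (simp add: \<kappa>_def ennreal_le_iff)
  have "ennreal c + ennreal (\<kappa> u) = ennreal ((\<integral>x. x * exp (- u * x) \<partial>L) / laplace L u)"
    using c \<kappa> by (simp add: ennreal_plus[symmetric] \<kappa>_def del: ennreal_plus)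
  then show "ennreal (\<kappa> u) = (\<integral>\<^sup>+x. ennreal (exp (- u * x)) * K x \<partial>lborel)"
    unfolding equation[OF u] by (simp add: ennreal_add_left_cancel)
qed

lemma h_deriv: "0 < u \<Longrightarrow> (h has_real_derivative \<kappa> u) (at u)"
proof -
  assume u: "0 < u"
  have pos: "0 < laplace L u" using laplace_positive u by simp
  have "((\<lambda>v. ln (laplace L v)) has_real_derivative inverse (laplace L u) * - (\<integral>x. x * exp (- u * x) \<partial>L)) (at u)"
    using DERIV_chain2[OF DERIV_ln[OF pos] laplace_has_real_derivative(2)[OF L u]] .
  then have "(h has_real_derivative - (inverse (laplace L u) * - (\<integral>x. x * exp (- u * x) \<partial>L)) - c * 1) (at u)"
    unfolding h_def by (intro DERIV_diff DERIV_minus DERIV_cmult DERIV_ident)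
  then show ?thesis by (simp add: \<kappa>_def field_simps)
qed

lemma exp_minus_h: "0 \<le> u \<Longrightarrow> exp (- h u) = exp (c * u) * laplace L u"
  using laplace_positive[of u] by (simp add: h_def exp_add)

text \<open>Integrate the derivative \<kappa> of h over [1, U] and exchange the integrals. Starting
  at 1 avoids u = 0, where h need not be differentiable, and leaves a factor exp (- x) that tames
  large x.\<close>

lemma h_increment:
  assumes U: "1 \<le> U"
  shows "ennreal (h U - h 1) = (\<integral>\<^sup>+x. ennreal ((exp (- x) - exp (- U * x)) / x) * K x \<partial>lborel)"
proof -
  have [measurable]: "\<kappa> \<in> borel_measurable borel"
    unfolding \<kappa>_def laplace_def by measurable
  have "ennreal (h U - h 1) = (\<integral>\<^sup>+s. ennreal (\<kappa> s) * indicator {1..U} s \<partial>lborel)"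
    using U by (intro nn_integral_FTC_Icc[symmetric]) (auto intro: h_deriv \<kappa>)
  also have "\<dots> = (\<integral>\<^sup>+s. \<integral>\<^sup>+x. ennreal (exp (- s * x)) * K x * indicator {1..U} s \<partial>lborel \<partial>lborel)"
  proof (rule nn_integral_cong)
    fix s :: real
    have "(\<integral>\<^sup>+x. ennreal (exp (- s * x)) * K x * indicator {1..U} s \<partial>lborel)
       = (\<integral>\<^sup>+x. ennreal (exp (- s * x)) * K x \<partial>lborel) * indicator {1..U} s"
      by (rule nn_integral_multc) measurable
    then show "ennreal (\<kappa> s) * indicator {1..U} s = (\<integral>\<^sup>+x. ennreal (exp (- s * x)) * K x * indicator {1..U} s \<partial>lborel)"
      using \<kappa>(2)[of s] by (cases "s \<in> {1..U}") (simp_all del: nn_integral_indicator)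
  qed
  also have "\<dots> = (\<integral>\<^sup>+x. \<integral>\<^sup>+s. ennreal (exp (- s * x)) * K x * indicator {1..U} s \<partial>lborel \<partial>lborel)"
    by (rule lborel_pair.Fubini') measurable
  also have "\<dots> = (\<integral>\<^sup>+x. ennreal ((exp (- x) - exp (- U * x)) / x) * K x \<partial>lborel)"
  proof (rule nn_integral_cong)
    fix x :: real
    show "(\<integral>\<^sup>+s. ennreal (exp (- s * x)) * K x * indicator {1..U} s \<partial>lborel) = ennreal ((exp (- x) - exp (- U * x)) / x) * K x"
    proof (cases "0 < x")
      case True
      have "(\<integral>\<^sup>+s. ennreal (exp (- s * x)) * K x * indicator {1..U} s \<partial>lborel)
          = (\<integral>\<^sup>+s. ennreal (exp (- s * x)) * indicator {1..U} s * K x \<partial>lborel)"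
        by (intro nn_integral_cong) (simp add: mult_ac)
      also have "\<dots> = (\<integral>\<^sup>+s. ennreal (exp (- s * x)) * indicator {1..U} s \<partial>lborel) * K x"
        by (rule nn_integral_multc) measurable
      also have "(\<integral>\<^sup>+s. ennreal (exp (- s * x)) * indicator {1..U} s \<partial>lborel)
          = ennreal (- exp (- U * x) / x - - exp (- 1 * x) / x)"
      proof (rule nn_integral_FTC_Icc)
        show "((\<lambda>s. - exp (- s * x) / x) has_real_derivative exp (- s * x)) (at s)" for s
          using True by (auto intro!: derivative_eq_intros)
      qed (use U in auto)
      also have "- exp (- U * x) / x - - exp (- 1 * x) / x = (exp (- x) - exp (- U * x)) / x"
        by (simp add: diff_divide_distrib)
      finally show ?thesis .
    qed (simp add: K_nonpos)
  qed
  finally show ?thesis .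
qed

lemma h_mono:
  assumes "0 < u" "u \<le> v"
  shows "h u \<le> h v"
proof (rule DERIV_nonneg_imp_nondecreasing[where f=h])
  show "\<exists>y. (h has_real_derivative y) (at x) \<and> 0 \<le> y" if "u \<le> x" for x
    using assms(1) that by (intro exI[of _ "\<kappa> x"] conjI h_deriv \<kappa>) auto
qed fact

text \<open>Exponential Markov bound: the mass of \<open>{..a}\<close> is at most exp (a U) times
  the transform at U, which is exp (- (c - a) U) exp (- h U). As h is nondecreasing, this tends to 0
  for a < c when U grows.\<close>

lemma AE_ge: "AE x in L. c \<le> x"
proof -
  have null: "AE x in L. \<not> x \<le> a" if a: "a < c" for a
  proof -
    have le: "prob {..a} \<le> exp (- (c - a) * U) * exp (- h 1)" if U: "1 \<le> U" for U
    proof -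
      have "exp (- U * a) * prob {..a} = (\<integral>x. exp (- U * a) * indicator {..a} x \<partial>L)" by simp
      also have "\<dots> \<le> (\<integral>x. exp (- U * x) \<partial>L)"
        using U
        by (intro integral_mono laplace_pos(1)[OF L] integrable_mult_right integrable_real_indicator)
          (auto split: split_indicator intro: mult_left_mono simp: less_top[symmetric])
      also have "\<dots> = exp (- c * U) * exp (- h U)"
        using U exp_minus_h[of U] by (simp add: laplace_def mult.assoc[symmetric] mult_exp_exp)
      also have "\<dots> \<le> exp (- c * U) * exp (- h 1)" using h_mono[of 1 U] U by simp
      finally have "exp (U * a) * (exp (- U * a) * prob {..a}) \<le> exp (U * a) * (exp (- c * U) * exp (- h 1))"
        by (intro mult_left_mono) auto
      moreover have "exp (U * a) * (exp (- U * a) * prob {..a}) = prob {..a}"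
        by (simp add: exp_minus)
      moreover have "exp (U * a) * (exp (- c * U) * exp (- h 1)) = exp (- (c - a) * U) * exp (- h 1)"
        by (simp only: mult_exp_exp) (simp add: algebra_simps)
      ultimately show ?thesis by (simp only:)
    qed
    have "((\<lambda>U. exp (- (c - a) * U) * exp (- h 1)) \<longlongrightarrow> 0 * exp (- h 1)) at_top"
      using a by (intro tendsto_mult tendsto_const) real_asymp
    then have "((\<lambda>U. exp (- (c - a) * U) * exp (- h 1)) \<longlongrightarrow> 0) at_top" by simp
    moreover have "\<forall>\<^sub>F U in at_top. prob {..a} \<le> exp (- (c - a) * U) * exp (- h 1)"
      using eventually_ge_at_top[of 1] by eventually_elim (rule le)
    ultimately have "prob {..a} \<le> 0" by (intro tendsto_lowerbound) auto
    then have "emeasure L {..a} = 0" by (simp add: emeasure_eq_measure measure_le_0_iff)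
    then show ?thesis by (intro AE_I[of _ _ "{..a}"]) auto
  qed
  have "AE x in L. \<forall>n. \<not> x \<le> c - 1 / real (Suc n)"
    by (intro AE_all_countable[THEN iffD2] allI null) simp
  then show ?thesis
  proof eventually_elim
    case (elim x)
    show ?case
    proof (rule ccontr)
      assume "\<not> c \<le> x"
      then obtain n where "1 / real (Suc n) < c - x"
        using reals_Archimedean[of "c - x"] by (auto simp: inverse_eq_divide)
      then show False using elim[rule_format, of n] by simp
    qed
  qed
qed

text \<open>\<open>A\<close> and \<open>B\<close> are the two sides of the convolution equation
  after subtracting c L(dx). Going back from A to L loses only the point c, because the density x -
  c is positive on the rest of the support.\<close>

lemma null_set_off_atom:
  assumes N: "N \<in> null_sets lborel" and cN: "c \<notin> N"
  shows "emeasure L N = 0"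
proof -
  have [measurable]: "N \<in> sets borel" using N by auto
  interpret pair_sigma_finite L lborel ..
  define kL where "kL z = (\<integral>\<^sup>+y. K (z - y) \<partial>L)" for z
  have [measurable]: "kL \<in> borel_measurable borel" unfolding kL_def by measurable
  \<comment> \<open>Here \<open>ennreal\<close> would cut off negative values of x - c; by
    \<open>AE_ge\<close> these do not occur, so A really is (x - c) L(dx).\<close>
  define A where "A = density L (\<lambda>x. ennreal (x - c))"
  define B where "B = density lborel kL"
  have LA: "(\<integral>\<^sup>+x. ennreal (exp (- u * x)) \<partial>A) = ennreal (\<kappa> u * laplace L u)" if u: "0 < u" for u
  proof -
    have i: "integrable L (\<lambda>x. exp (- u * x))" "integrable L (\<lambda>x. x * exp (- u * x))"
      using laplace_pos(1)[OF L] laplace_has_real_derivative(1)[OF L u] u by auto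
    have "(\<integral>\<^sup>+x. ennreal (exp (- u * x)) \<partial>A) = (\<integral>\<^sup>+x. ennreal (x - c) * ennreal (exp (- u * x)) \<partial>L)"
      unfolding A_def by (subst nn_integral_density) auto
    also have "\<dots> = (\<integral>\<^sup>+x. ennreal (x * exp (- u * x) - c * exp (- u * x)) \<partial>L)"
      using AE_ge by (intro nn_integral_cong_AE) (auto simp: ennreal_mult'[symmetric] algebra_simps)
    also have "\<dots> = ennreal (\<integral>x. x * exp (- u * x) - c * exp (- u * x) \<partial>L)"
    proof (rule nn_integral_eq_integral)
      show "AE x in L. 0 \<le> x * exp (- u * x) - c * exp (- u * x)"
        using AE_ge by eventually_elim (simp add: mult_right_mono)
    qed (use i in simp)
    also have "(\<integral>x. x * exp (- u * x) - c * exp (- u * x) \<partial>L) = (\<integral>x. x * exp (- u * x) \<partial>L) - c * laplace L u"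
      unfolding laplace_def using i by simp
    also have "\<dots> = \<kappa> u * laplace L u"
      using laplace_positive[of u] u by (simp add: \<kappa>_def field_simps)
    finally show ?thesis .
  qed
  have LB: "(\<integral>\<^sup>+x. ennreal (exp (- u * x)) \<partial>B) = ennreal (\<kappa> u * laplace L u)" if u: "0 < u" for u
  proof -
    have "(\<integral>\<^sup>+x. ennreal (exp (- u * x)) \<partial>B) = (\<integral>\<^sup>+z. kL z * ennreal (exp (- u * z)) \<partial>lborel)"
      unfolding B_def by (subst nn_integral_density) auto
    also have "\<dots> = (\<integral>\<^sup>+z. \<integral>\<^sup>+y. K (z - y) * ennreal (exp (- u * z)) \<partial>L \<partial>lborel)"
      unfolding kL_def by (intro nn_integral_cong nn_integral_multc[symmetric]) measurable
    also have "\<dots> = (\<integral>\<^sup>+y. \<integral>\<^sup>+z. K (z - y) * ennreal (exp (- u * z)) \<partial>lborel \<partial>L)"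
      by (rule Fubini') measurable
    also have "\<dots> = (\<integral>\<^sup>+y. ennreal (exp (- u * y)) * ennreal (\<kappa> u) \<partial>L)"
    proof (rule nn_integral_cong)
      fix y
      have "(\<integral>\<^sup>+z. K (z - y) * ennreal (exp (- u * z)) \<partial>lborel)
          = (\<integral>\<^sup>+x. ennreal (exp (- u * y)) * (ennreal (exp (- u * x)) * K x) \<partial>lborel)"
      proof (subst nn_integral_real_affine[where t=y and c=1])
        have "K (y + 1 * x - y) * ennreal (exp (- u * (y + 1 * x)))
            = ennreal (exp (- u * y)) * (ennreal (exp (- u * x)) * K x)" for x
                  proof -
          have "exp (- u * (y + 1 * x)) = exp (- u * y) * exp (- u * x)"
            by (simp add: mult_exp_exp distrib_left)
          moreover have "y + 1 * x - y = x" by simp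
          ultimately show ?thesis by (simp only: ennreal_mult exp_ge_zero mult_ac)
        qed
        then show "ennreal \<bar>1\<bar> * (\<integral>\<^sup>+x. K (y + 1 * x - y) * ennreal (exp (- u * (y + 1 * x))) \<partial>lborel)
            = (\<integral>\<^sup>+x. ennreal (exp (- u * y)) * (ennreal (exp (- u * x)) * K x) \<partial>lborel)"
          by simp
      qed auto
      also have "\<dots> = ennreal (exp (- u * y)) * (\<integral>\<^sup>+x. ennreal (exp (- u * x)) * K x \<partial>lborel)"
        by (rule nn_integral_cmult) measurable
      finally show "(\<integral>\<^sup>+z. K (z - y) * ennreal (exp (- u * z)) \<partial>lborel) = ennreal (exp (- u * y)) * ennreal (\<kappa> u)"
        using \<kappa>(2)[OF u] by simp
    qed
    also have "\<dots> = (\<integral>\<^sup>+y. ennreal (exp (- u * y)) \<partial>L) * ennreal (\<kappa> u)"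
      by (rule nn_integral_multc) measurable
    also have "(\<integral>\<^sup>+y. ennreal (exp (- u * y)) \<partial>L) = ennreal (laplace L u)"
      unfolding laplace_def using u by (intro nn_integral_eq_integral laplace_pos(1)[OF L]) auto
    finally show ?thesis
      using laplace_positive[of u] \<kappa>(1)[OF u] u by (simp add: ennreal_mult mult.commute)
  qed
  have "A = B"
  proof (rule laplace_transform_unique)
    show "sets A = sets borel" "sets B = sets borel" by (auto simp: A_def B_def L(2))
    show "AE x in A. 0 \<le> x" unfolding A_def using L(3) by (subst AE_density) auto
    have "kL z = 0" if "z < 0" for z
    proof -
      have "AE y in L. K (z - y) = 0"
        using L(3) by eventually_elim (use that in \<open>simp add: K_nonpos\<close>)
      then show ?thesis unfolding kL_def by (subst nn_integral_0_iff_AE) auto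
    qed
    then have "0 < kL z \<Longrightarrow> 0 \<le> z" for z by (metis less_irrefl not_le)
    then show "AE x in B. 0 \<le> x" unfolding B_def by (subst AE_density) auto
  qed (simp_all only: LA LB, simp)
  have "emeasure B N = 0"
    using N unfolding B_def by (subst emeasure_density) (auto simp: nn_integral_null_set)
  then have "(\<integral>\<^sup>+x. ennreal (x - c) * indicator N x \<partial>L) = 0"
    unfolding \<open>A = B\<close>[symmetric] A_def by (subst (asm) emeasure_density) auto
  then have "AE x in L. ennreal (x - c) * indicator N x = 0"
    by (subst (asm) nn_integral_0_iff_AE) auto
  with AE_ge have "AE x in L. x \<notin> N"
  proof eventually_elim
    case (elim x)
    then show ?case using cN by (cases "x = c") (auto simp: ennreal_eq_0_iff)
  qed
  then show ?thesis by (subst (asm) AE_iff_measurable[OF _ refl]) (auto simp: sets_eq_imp_space_eq[OF L(2)])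
qed

text \<open>By \<open>AE_ge\<close> the integrand exp (- n (x - c)) is at most 1 and tends to the
  indicator of the left end point c of the support.\<close>

lemma atom_limit: "(\<lambda>n. exp (- h (real n))) \<longlonglongrightarrow> prob {c}"
proof -
  have "(\<lambda>n. \<integral>x. exp (- real n * (x - c)) \<partial>L) \<longlonglongrightarrow> (\<integral>x. indicator {c} x \<partial>L)"
  proof (rule integral_dominated_convergence[where w="\<lambda>_. 1"])
    show "AE x in L. (\<lambda>n. exp (- real n * (x - c))) \<longlonglongrightarrow> indicator {c} x"
      using AE_ge
    proof eventually_elim
      case (elim x)
      show ?case
      proof (cases "x = c")
        case False
        then have "0 < x - c" using elim by simp
        then have "((\<lambda>t. exp (- t * (x - c))) \<longlongrightarrow> 0) at_top" by real_asymp
        then have "(\<lambda>n. exp (- real n * (x - c))) \<longlonglongrightarrow> 0"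
          by (rule filterlim_compose) (rule filterlim_real_sequentially)
        then show ?thesis using False by simp
      qed simp
    qed
    show "AE x in L. norm (exp (- real n * (x - c))) \<le> 1" for n
      using AE_ge by eventually_elim simp
  qed auto
  also have "(\<integral>x. indicator {c} x \<partial>L) = prob {c}" by simp
  also have "(\<lambda>n. \<integral>x. exp (- real n * (x - c)) \<partial>L) = (\<lambda>n. exp (- h (real n)))"
  proof
    fix n
    have "(\<integral>x. exp (- real n * (x - c)) \<partial>L) = (\<integral>x. exp (c * real n) * exp (- real n * x) \<partial>L)"
      by (simp add: mult_exp_exp algebra_simps)
    then show "(\<integral>x. exp (- real n * (x - c)) \<partial>L) = exp (- h (real n))"
      by (simp add: exp_minus_h laplace_def)
  qed
  finally show ?thesis .
qed

lemma increment_SUP: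
  "(SUP n. ennreal (h (real (Suc n)) - h 1)) = (\<integral>\<^sup>+x. ennreal (exp (- x) / x) * K x \<partial>lborel)"
proof -
  let ?q = "\<lambda>n x. ennreal ((exp (- x) - exp (- real (Suc n) * x)) / x) * K x"
  have "(SUP n. ennreal (h (real (Suc n)) - h 1)) = (SUP n. \<integral>\<^sup>+x. ?q n x \<partial>lborel)"
    by (intro SUP_cong refl h_increment) simp
  also have "\<dots> = (\<integral>\<^sup>+x. (SUP n. ?q n x) \<partial>lborel)"
  proof (rule nn_integral_monotone_convergence_SUP[symmetric])
    show "incseq ?q"
    proof (intro incseq_SucI le_funI)
      fix n and x :: real
      show "?q n x \<le> ?q (Suc n) x"
      proof (cases "0 < x")
        case True
        then show ?thesis
          by (intro mult_right_mono ennreal_leI divide_right_mono diff_left_mono) auto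
      qed (simp add: K_nonpos)
    qed
  qed measurable
  also have "\<dots> = (\<integral>\<^sup>+x. ennreal (exp (- x) / x) * K x \<partial>lborel)"
  proof (rule nn_integral_cong)
    fix x :: real
    show "(SUP n. ?q n x) = ennreal (exp (- x) / x) * K x"
    proof (cases "0 < x")
      case True
      have "(SUP n. ennreal ((exp (- x) - exp (- real (Suc n) * x)) / x)) = ennreal (exp (- x) / x)"
      proof (rule LIMSEQ_unique[OF LIMSEQ_SUP])
        show "incseq (\<lambda>n. ennreal ((exp (- x) - exp (- real (Suc n) * x)) / x))"
          using True by (intro incseq_SucI ennreal_leI divide_right_mono diff_left_mono) auto
        have "((\<lambda>t. exp (- t * x)) \<longlongrightarrow> 0) at_top" using True by real_asymp
        then have "((\<lambda>t. (exp (- x) - exp (- t * x)) / x) \<longlongrightarrow> (exp (- x) - 0) / x) at_top"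
          using True by (intro tendsto_intros) auto
        then have "((\<lambda>t. (exp (- x) - exp (- t * x)) / x) \<longlongrightarrow> exp (- x) / x) at_top" by simp
        then have "(\<lambda>n. (exp (- x) - exp (- real (Suc n) * x)) / x) \<longlonglongrightarrow> exp (- x) / x"
          by (rule filterlim_compose) (rule filterlim_compose[OF filterlim_real_sequentially filterlim_Suc])
        then show "(\<lambda>n. ennreal ((exp (- x) - exp (- real (Suc n) * x)) / x)) \<longlonglongrightarrow> ennreal (exp (- x) / x)"
          by (rule tendsto_ennrealI)
      qed
      then show ?thesis by (simp add: SUP_mult_right_ennreal[symmetric])
    qed (simp add: K_nonpos)
  qed
  finally show ?thesis .
qed

text \<open>On (0,1) the factor exp (- x) lies between exp (- 1) and 1. On [1, infinity) the
  integrand is at most exp (- x) K(x), whose integral is at most the finite number \<kappa>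
  1.\<close>

lemma nn_integral_near_0_iff:
  "(\<integral>\<^sup>+x. ennreal (exp (- x) / x) * K x \<partial>lborel) < \<infinity> \<longleftrightarrow> (\<integral>\<^sup>+x\<in>{0<..<1}. ennreal (1 / x) * K x \<partial>lborel) < \<infinity>"
    (is "?S < \<infinity> \<longleftrightarrow> ?I < \<infinity>")
proof
  assume S: "?S < \<infinity>"
  have "?I \<le> (\<integral>\<^sup>+x. ennreal (exp 1) * (ennreal (exp (- x) / x) * K x) \<partial>lborel)"
  proof (rule nn_integral_mono)
    fix x :: real
    show "ennreal (1 / x) * K x * indicator {0<..<1} x \<le> ennreal (exp 1) * (ennreal (exp (- x) / x) * K x)"
    proof (cases "x \<in> {0<..<1}")
      case True
      then have "1 / x \<le> exp 1 * (exp (- x) / x)"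
        by (simp add: mult_exp_exp divide_right_mono)
      then have "ennreal (1 / x) \<le> ennreal (exp 1 * (exp (- x) / x))" by (rule ennreal_leI)
      also have "\<dots> = ennreal (exp 1) * ennreal (exp (- x) / x)" using True by (intro ennreal_mult) auto
      finally have "ennreal (1 / x) * K x \<le> ennreal (exp 1) * ennreal (exp (- x) / x) * K x"
        by (rule mult_right_mono) simp
      then show ?thesis using True by (simp add: mult.assoc)
    qed simp
  qed
  also have "\<dots> = ennreal (exp 1) * ?S" by (rule nn_integral_cmult) measurable
  also have "\<dots> < \<infinity>" using S by (simp add: ennreal_mult_less_top)
  finally show "?I < \<infinity>" .
next
  assume I: "?I < \<infinity>"
  have "?S \<le> (\<integral>\<^sup>+x. ennreal (1 / x) * K x * indicator {0<..<1} x + ennreal (exp (- 1 * x)) * K x \<partial>lborel)"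
  proof (rule nn_integral_mono)
    fix x :: real
    show "ennreal (exp (- x) / x) * K x \<le> ennreal (1 / x) * K x * indicator {0<..<1} x + ennreal (exp (- 1 * x)) * K x"
    proof (cases "0 < x")
      case True
      show ?thesis
      proof (cases "x < 1")
        case less: True
        have "ennreal (exp (- x) / x) \<le> ennreal (1 / x)"
          using True by (intro ennreal_leI divide_right_mono) auto
        then have "ennreal (exp (- x) / x) * K x \<le> ennreal (1 / x) * K x" by (rule mult_right_mono) simp
        then show ?thesis using True less by (simp add: add_increasing2)
      next
        case False
        have "ennreal (exp (- x) / x) \<le> ennreal (exp (- 1 * x))"
          using True False by (intro ennreal_leI) (simp add: field_simps)
        then have "ennreal (exp (- x) / x) * K x \<le> ennreal (exp (- 1 * x)) * K x" by (rule mult_right_mono) simp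
        then show ?thesis by (rule add_increasing[rotated]) simp
      qed
    qed (simp add: K_nonpos)
  qed
  also have "\<dots> = ?I + ennreal (\<kappa> 1)"
    unfolding \<kappa>(2)[OF zero_less_one] by (rule nn_integral_add) measurable
  also have "\<dots> < \<infinity>" using I by simp
  finally show "?S < \<infinity>" .
qed

text \<open>The sequence exp (- h n) decreases to the mass of c. Its limit is positive exactly if h
  n stays bounded, and the supremum of the increments of h is the integral in
  \<open>increment_SUP\<close>.\<close>

lemma atom_iff: "0 < prob {c} \<longleftrightarrow> (\<integral>\<^sup>+x\<in>{0<..<1}. ennreal (1 / x) * K x \<partial>lborel) < \<infinity>"
  unfolding nn_integral_near_0_iff[symmetric]
proof
  assume pos: "0 < prob {c}"
  have le: "h (real (Suc n)) \<le> - ln (prob {c})" for n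
  proof -
    have "decseq (\<lambda>n. exp (- h (real (Suc n))))"
    proof (intro decseq_SucI)
      fix n
      have "h (real (Suc n)) \<le> h (real (Suc (Suc n)))" by (rule h_mono) simp_all
      then show "exp (- h (real (Suc (Suc n)))) \<le> exp (- h (real (Suc n)))" by simp
    qed
    then have "prob {c} \<le> exp (- h (real (Suc n)))"
      using LIMSEQ_Suc[OF atom_limit] by (rule decseq_ge)
    then have "ln (prob {c}) \<le> ln (exp (- h (real (Suc n))))" using pos by (intro ln_mono) auto
    then show ?thesis by (simp only: ln_exp)
  qed
  have "(SUP n. ennreal (h (real (Suc n)) - h 1)) \<le> ennreal (- ln (prob {c}) - h 1)"
    using le by (intro SUP_least ennreal_leI) simp
  also have "\<dots> < \<infinity>" by simp
  finally show "(\<integral>\<^sup>+x. ennreal (exp (- x) / x) * K x \<partial>lborel) < \<infinity>"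
    unfolding increment_SUP .
next
  assume fin: "(\<integral>\<^sup>+x. ennreal (exp (- x) / x) * K x \<partial>lborel) < \<infinity>"
  define S where "S = enn2real (\<integral>\<^sup>+x. ennreal (exp (- x) / x) * K x \<partial>lborel)"
  have S: "0 \<le> S" "(\<integral>\<^sup>+x. ennreal (exp (- x) / x) * K x \<partial>lborel) = ennreal S"
    using fin by (simp_all add: S_def)
  have "exp (- (h 1 + S)) \<le> exp (- h (real (Suc n)))" for n
  proof -
    have "ennreal (h (real (Suc n)) - h 1) \<le> ennreal S"
      unfolding S(2)[symmetric] increment_SUP[symmetric] by (rule SUP_upper) simp
    then have "h (real (Suc n)) - h 1 \<le> S" using S(1) by (simp add: ennreal_le_iff)
    then show ?thesis by simp
  qed
  then have "exp (- (h 1 + S)) \<le> prob {c}"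
    by (intro LIMSEQ_le_const[OF LIMSEQ_Suc[OF atom_limit]]) auto
  then show "0 < prob {c}" by (rule less_le_trans[OF exp_gt_zero])
qed

end

section \<open>Absolute continuity of the limit distribution\<close>

lemma absolutely_continuous_on_if_null:
  assumes A: "A \<in> sets borel" and L: "sets L = sets borel"
    and null: "\<And>N. N \<in> null_sets lborel \<Longrightarrow> N \<subseteq> A \<Longrightarrow> emeasure L N = 0"
  shows "absolutely_continuous_on A L"
  unfolding absolutely_continuous_on_def absolutely_continuous_def
proof
  fix N assume "N \<in> null_sets (restrict_space lborel A)"
  then have N: "N \<subseteq> A" "N \<in> null_sets lborel"
    using A by (auto simp: null_sets_restrict_space)
  then have "N \<in> null_sets L" using null[OF N(2,1)] by (auto simp: null_sets_def L)
  then show "N \<in> null_sets (restrict_space L A)"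
    using A N(1) by (auto simp: null_sets_restrict_space L)
qed

theorem proposition4p5:
  fixes M :: "'w measure" and P :: "real \<Rightarrow> 'w measure" and X :: "real \<Rightarrow> 'w \<Rightarrow> real"
    and b \<alpha> \<beta> :: real and m \<mu> L :: "real measure" and W W' :: "real \<Rightarrow> real"
  defines "lam0 \<equiv> effective_drift \<alpha> \<beta> \<mu>"
  defines "c \<equiv> real_of_ereal (ereal b / lam0)"
  defines "I \<equiv> (\<integral>\<^sup>+x\<in>{0<..<1}. ennreal (k_fun b m W W' x / x) \<partial>lborel)"
  assumes "conservative_CBI M P X"
    and "admissible_parameters b m \<alpha> \<beta> \<mu>"
    and "functional_characteristics P X (F_fun b m) (R_fun \<alpha> \<beta> \<mu>)"
    and "limit_distribution P X L"
    and "scale_function (R_fun \<alpha> \<beta> \<mu>) W"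
    and "\<And>x. x > 0 \<Longrightarrow> (W has_real_derivative W' x) (at_right x)"
  shows "(I = \<infinity> \<longrightarrow> absolutely_continuous_on {0..} L) \<and>
         (I < \<infinity> \<longrightarrow> absolutely_continuous_on ({0..} - {c}) L \<and> measure L {c} > 0)"
proof -
  let ?F = "F_fun b m" and ?R = "R_fun \<alpha> \<beta> \<mu>"
  have adm: "0 \<le> b" "0 \<le> \<alpha>" "levy_measure m" "levy_measure \<mu>"
    "(\<integral>\<^sup>+\<xi>\<in>{0<..}. ennreal (min \<xi> 1) \<partial>m) < \<infinity>"
    using assms(5) by (auto simp: admissible_parameters_def)
  obtain \<phi> \<psi> where aff: "affine_exponents P X \<phi> \<psi>"
    and der: "\<And>u. 0 \<le> u \<Longrightarrow> ((\<lambda>t. \<phi> t u) has_real_derivative ?F u) (at 0 within {0..})"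
      "\<And>u. 0 \<le> u \<Longrightarrow> ((\<lambda>t. \<psi> t u) has_real_derivative ?R u) (at 0 within {0..})"
    using assms(6) unfolding functional_characteristics_def by blast
  interpret CBI: conservative_CBI M P X by fact
  interpret X: affine_markov_process M P X \<phi> \<psi> by unfold_locales (rule aff)
  note L = X.limit_prob_space[OF assms(7)]
  have ode: "?F u * laplace L u = - ?R u * (\<integral>x. x * exp (- u * x) \<partial>L)" if "0 < u" for u
    using that by (intro X.limit_characteristics_ode[OF assms(7)] der) auto
  \<comment> \<open>\<open>limit_characteristic_nonzero\<close> only provides a point u >= 0; as R
    vanishes at 0, that point is positive.\<close>
  have "?R 0 = 0" by (simp add: R_fun_def)
  then obtain v where v: "0 < v" "?R v \<noteq> 0"
    using X.limit_characteristic_nonzero[OF assms(7) der(2)] by (metis order_le_less)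
  have R: "?R u \<noteq> 0" if "0 < u" for u
    using scale_function_R_nonzero[OF assms(8)] v that .
  interpret S: scale_function_immigration ?R W W' b m
    using assms(8,9) adm by unfold_locales
  have c: "c = b * W 0"
    unfolding c_def lam0_def
    by (rule scale_function_0_effective_drift[OF adm(2,4) assms(8) R])
  interpret E: laplace_equation L c S.K
  proof (rule laplace_equation.intro)
    show "prob_space L" "sets L = sets borel" "AE x in L. 0 \<le> x" by (rule L)+
    show "0 \<le> c" using adm(1) S.W_nonneg by (simp add: c)
    show "S.K \<in> borel_measurable borel" by (rule S.K_measurable)
    show "S.K x = 0" if "x \<le> 0" for x using that by (rule S.K_nonpos)
    fix u :: real assume u: "0 < u"
    have "(\<integral>x. x * exp (- u * x) \<partial>L) / laplace L u = ?F u * S.w u"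
      using ode[OF u] R[OF u] laplace_pos(2)[OF L, of u] u by (simp add: S.w_eq field_simps)
    then show "ennreal ((\<integral>x. x * exp (- u * x) \<partial>L) / laplace L u)
        = ennreal c + (\<integral>\<^sup>+x. ennreal (exp (- u * x)) * S.K x \<partial>lborel)"
      using S.laplace_K[OF u] by (simp only: c)
  qed
  have "I = (\<integral>\<^sup>+x\<in>{0<..<1}. ennreal (1 / x) * S.K x \<partial>lborel)"
    unfolding I_def
  proof (rule nn_integral_cong_AE)
    show "AE x in lborel. ennreal (k_fun b m W W' x / x) * indicator {0<..<1} x
        = ennreal (1 / x) * S.K x * indicator {0<..<1} x"
      using S.k_fun_eq_K
    proof eventually_elim
      case (elim x)
      show ?case
      proof (cases "x \<in> {0<..<1}")
        case True
        then have "ennreal (1 / x * k_fun b m W W' x) = ennreal (1 / x) * S.K x"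
          using elim by (subst ennreal_mult') auto
        then show ?thesis using True by simp
      qed simp
    qed
  qed
  then have atom: "0 < measure L {c} \<longleftrightarrow> I < \<infinity>" using E.atom_iff by simp
  have "absolutely_continuous_on ({0..} - {c}) L"
    using E.null_set_off_atom by (intro absolutely_continuous_on_if_null L) auto
  moreover have "absolutely_continuous_on {0..} L" if "I = \<infinity>"
  proof (rule absolutely_continuous_on_if_null)
    fix N :: "real set" assume N: "N \<in> null_sets lborel"
    have sets: "N \<in> sets L" "{c} \<in> sets L" using N by (auto simp: L(2))
    have "\<not> 0 < measure L {c}" using atom that by simp
    then have "measure L {c} = 0" using measure_nonneg[of L "{c}"] by linarith
    then have c0: "emeasure L {c} = 0" by (simp add: E.emeasure_eq_measure)
    \<comment> \<open>A Lebesgue null set may contain c, so it is split into the part off c, handled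
      by \<open>null_set_off_atom\<close>, and the point c, which carries no mass when I is
      infinite.\<close>
    have "N - {c} \<in> null_sets lborel" using N by (rule null_sets.Diff) (simp add: finite_imp_null_set_lborel)
    then have Nc: "emeasure L (N - {c}) = 0" by (rule E.null_set_off_atom) simp
    have "emeasure L N \<le> emeasure L ((N - {c}) \<union> {c})"
      using sets by (intro emeasure_mono sets.Un sets.Diff) auto
    also have "\<dots> \<le> emeasure L (N - {c}) + emeasure L {c}"
      using sets by (intro emeasure_subadditive sets.Diff)
    finally show "emeasure L N = 0" by (simp add: c0 Nc)
  qed (use L in auto)
  ultimately show ?thesis using atom by blast
qed

end
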